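(* Let $\mathcal{C}$ be a pointed bicomplete closed symmetric monoidal category. The cokernel induces a functor from Smith ideals in $\mathcal{C}$ to monoid homomorphisms in $\mathcal{C}$ whose right adjoint is the kernel. That is, if $j\colon I\to R$ is a Smith ideal, then the cokernel $R\to R/I$ is canonically a monoid homomorphism. Furthermore, for a Smith ideal $j$, the cokernel also induces a functor from modules over the Smith ideal $j$ to modules over the monoid homomorphism $\mathrm{coker}\, j$, whose right adjoint is the kernel.
   Context: $\mathrm{Arr}\,\mathcal{C}$ is the category whose objects are morphisms of $\mathcal{C}$ and whose morphisms are commutative squares. For $f\colon X_0\to X_1$ and $g\colon Y_0\to Y_1$: the tensor product monoidal structure on $\mathrm{Arr}\,\mathcal{C}$ has product $f\otimes g\colon X_0\otimes Y_0\to X_1\otimes Y_1$ and unit $1_S\colon S\to S$ ($S$ the unit of $\mathcal{C}$); the pushout product monoidal structure has product $f\mathbin{\square} g\colon (X_0\otimes Y_1)\amalg_{X_0\otimes Y_0}(X_1\otimes Y_0)\to X_1\otimes Y_1$ and unit $0\to S$. A Smith ideal is a monoid $j\colon I\to R$ for the pushout product monoidal structure, and a module over it is a module over the monoid $j$ in that structure. Monoid homomorphisms in $\mathcal{C}$ are the same as monoids for the tensor product monoidal structure, and a module over a monoid homomorphism is a module over it in that structure. Morphisms of Smith ideals and of monoid homomorphisms are the monoid morphisms in the respective structures. Pointed means the initial object $0$ is also terminal. The cokernel functor sends $f\colon A\to B$ to $B\to B/A$ (with $B/A$ the pushout of $0\leftarrow A\to B$), and the kernel functor sends $p\colon X\to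 Y$ to $\ker p\to X$ (with $\ker p$ the pullback of $0\to Y\leftarrow X$). *)

theory Defs
  imports Main
begin

section \<open>Categories, functors, adjunctions\<close>

record ('o, 'a) category =
  Obj :: "'o set"
  Arr :: "'a set"
  Dom :: "'a \<Rightarrow> 'o"
  Cod :: "'a \<Rightarrow> 'o"
  Ide :: "'o \<Rightarrow> 'a"
  Comp :: "'a \<Rightarrow> 'a \<Rightarrow> 'a" (infixr "\<bullet>\<index>" 55)

definition hom :: "('o, 'a, 'm) category_scheme \<Rightarrow> 'o \<Rightarrow> 'o \<Rightarrow> 'a set" where
  "hom C x y = {f \<in> Arr C. Dom C f = x \<and> Cod C f = y}"

locale category =
  fixes C :: "('o, 'a, 'm) category_scheme" (structure)
  assumes dom_closed: "f \<in> Arr C \<Longrightarrow> Dom C f \<in> Obj C"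
    and cod_closed: "f \<in> Arr C \<Longrightarrow> Cod C f \<in> Obj C"
    and ide_hom: "x \<in> Obj C \<Longrightarrow> Ide C x \<in> hom C x x"
    and comp_hom: "\<lbrakk>f \<in> hom C x y; g \<in> hom C y z\<rbrakk> \<Longrightarrow> g \<bullet> f \<in> hom C x z"
    and comp_ide: "f \<in> hom C x y \<Longrightarrow> f \<bullet> Ide C x = f"
    and ide_comp: "f \<in> hom C x y \<Longrightarrow> Ide C y \<bullet> f = f"
    and comp_assoc: "\<lbrakk>f \<in> hom C w x; g \<in> hom C x y; h \<in> hom C y z\<rbrakk>
      \<Longrightarrow> (h \<bullet> g) \<bullet> f = h \<bullet> (g \<bullet> f)"

definition is_iso :: "('o, 'a, 'm) category_scheme \<Rightarrow> 'a \<Rightarrow> bool" where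
  "is_iso C f \<longleftrightarrow> f \<in> Arr C \<and>
    (\<exists>g \<in> hom C (Cod C f) (Dom C f).
      g \<bullet>\<^bsub>C\<^esub> f = Ide C (Dom C f) \<and> f \<bullet>\<^bsub>C\<^esub> g = Ide C (Cod C f))"

record ('o1, 'a1, 'o2, 'a2) func =
  FO :: "'o1 \<Rightarrow> 'o2"
  FA :: "'a1 \<Rightarrow> 'a2"

locale cat_functor = A: category A + B: category B
  for A :: "('o1, 'a1, 'm1) category_scheme" and B :: "('o2, 'a2, 'm2) category_scheme" +
  fixes F :: "('o1, 'a1, 'o2, 'a2) func"
  assumes FO_closed: "x \<in> Obj A \<Longrightarrow> FO F x \<in> Obj B"
    and FA_hom: "f \<in> hom A x y \<Longrightarrow> FA F f \<in> hom B (FO F x) (FO F y)"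
    and FA_ide: "x \<in> Obj A \<Longrightarrow> FA F (Ide A x) = Ide B (FO F x)"
    and FA_comp: "\<lbrakk>f \<in> hom A x y; g \<in> hom A y z\<rbrakk>
      \<Longrightarrow> FA F (g \<bullet>\<^bsub>A\<^esub> f) = FA F g \<bullet>\<^bsub>B\<^esub> FA F f"

definition right_adjoint ::
    "('o1, 'a1, 'm1) category_scheme \<Rightarrow> ('o2, 'a2, 'm2) category_scheme
      \<Rightarrow> ('o1, 'a1, 'o2, 'a2) func \<Rightarrow> ('o2, 'a2, 'o1, 'a1) func \<Rightarrow> bool" where
  "right_adjoint A B F G \<longleftrightarrow> cat_functor A B F \<and> cat_functor B A G \<and>
    (\<exists>\<phi>. (\<forall>a \<in> Obj A. \<forall>b \<in> Obj B. bij_betw (\<phi> a b) (hom B (FO F a) b) (hom A a (FO G b))) \<and>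
      (\<forall>a \<in> Obj A. \<forall>a' \<in> Obj A. \<forall>b \<in> Obj B. \<forall>b' \<in> Obj B.
        \<forall>h \<in> hom A a' a. \<forall>g \<in> hom B (FO F a) b. \<forall>k \<in> hom B b b'.
          \<phi> a' b' (k \<bullet>\<^bsub>B\<^esub> g \<bullet>\<^bsub>B\<^esub> FA F h) = FA G k \<bullet>\<^bsub>A\<^esub> \<phi> a b g \<bullet>\<^bsub>A\<^esub> h))"

section \<open>Limits, colimits, zero objects\<close>

definition is_cone :: "('i, 'u, 'n) category_scheme \<Rightarrow> ('o, 'a, 'm) category_scheme
    \<Rightarrow> ('i, 'u, 'o, 'a) func \<Rightarrow> 'o \<Rightarrow> ('i \<Rightarrow> 'a) \<Rightarrow> bool" where
  "is_cone J C D x \<pi> \<longleftrightarrow> x \<in> Obj C \<and> (\<forall>j \<in> Obj J. \<pi> j \<in> hom C x (FO D j)) \<and>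
    (\<forall>u \<in> Arr J. FA D u \<bullet>\<^bsub>C\<^esub> \<pi> (Dom J u) = \<pi> (Cod J u))"

definition is_limit :: "('i, 'u, 'n) category_scheme \<Rightarrow> ('o, 'a, 'm) category_scheme
    \<Rightarrow> ('i, 'u, 'o, 'a) func \<Rightarrow> 'o \<Rightarrow> ('i \<Rightarrow> 'a) \<Rightarrow> bool" where
  "is_limit J C D x \<pi> \<longleftrightarrow> is_cone J C D x \<pi> \<and>
    (\<forall>y \<rho>. is_cone J C D y \<rho> \<longrightarrow> (\<exists>!h. h \<in> hom C y x \<and> (\<forall>j \<in> Obj J. \<pi> j \<bullet>\<^bsub>C\<^esub> h = \<rho> j)))"

definition is_cocone :: "('i, 'u, 'n) category_scheme \<Rightarrow> ('o, 'a, 'm) category_scheme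
    \<Rightarrow> ('i, 'u, 'o, 'a) func \<Rightarrow> 'o \<Rightarrow> ('i \<Rightarrow> 'a) \<Rightarrow> bool" where
  "is_cocone J C D x \<iota> \<longleftrightarrow> x \<in> Obj C \<and> (\<forall>j \<in> Obj J. \<iota> j \<in> hom C (FO D j) x) \<and>
    (\<forall>u \<in> Arr J. \<iota> (Cod J u) \<bullet>\<^bsub>C\<^esub> FA D u = \<iota> (Dom J u))"

definition is_colimit :: "('i, 'u, 'n) category_scheme \<Rightarrow> ('o, 'a, 'm) category_scheme
    \<Rightarrow> ('i, 'u, 'o, 'a) func \<Rightarrow> 'o \<Rightarrow> ('i \<Rightarrow> 'a) \<Rightarrow> bool" where
  "is_colimit J C D x \<iota> \<longleftrightarrow> is_cocone J C D x \<iota> \<and>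
    (\<forall>y \<rho>. is_cocone J C D y \<rho> \<longrightarrow> (\<exists>!h. h \<in> hom C x y \<and> (\<forall>j \<in> Obj J. h \<bullet>\<^bsub>C\<^esub> \<iota> j = \<rho> j)))"

text \<open>
  The type \<open>'u\<close> plays the role of the universe of sets: a collection is a small set iff it has
  strictly smaller cardinality than \<open>'u\<close> (limitation of size). For \<open>'u\<close> of inaccessible
  cardinality this is smallness with respect to a Grothendieck universe. Up to isomorphism,
  every small category has its objects and arrows in \<open>'u\<close>.
\<close>

definition small_category :: "('u, 'u) category \<Rightarrow> bool" where
  "small_category J \<longleftrightarrow> category J \<and> (card_of (Arr J), card_of (UNIV :: 'u set)) \<in> ordLess"

definition bicomplete :: "'u itself \<Rightarrow> ('o, 'a, 'm) category_scheme \<Rightarrow> bool" where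
  "bicomplete U C \<longleftrightarrow> (\<forall>(J :: ('u, 'u) category) D. small_category J \<and> cat_functor J C D \<longrightarrow>
    (\<exists>x \<pi>. is_limit J C D x \<pi>) \<and> (\<exists>x \<iota>. is_colimit J C D x \<iota>))"

definition is_initial :: "('o, 'a, 'm) category_scheme \<Rightarrow> 'o \<Rightarrow> bool" where
  "is_initial C z \<longleftrightarrow> z \<in> Obj C \<and> (\<forall>x \<in> Obj C. \<exists>!f. f \<in> hom C z x)"

definition is_terminal :: "('o, 'a, 'm) category_scheme \<Rightarrow> 'o \<Rightarrow> bool" where
  "is_terminal C z \<longleftrightarrow> z \<in> Obj C \<and> (\<forall>x \<in> Obj C. \<exists>!f. f \<in> hom C x z)"

definition pointed :: "('o, 'a, 'm) category_scheme \<Rightarrow> bool" where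
  "pointed C \<longleftrightarrow> (\<exists>z. is_initial C z \<and> is_terminal C z)"

definition zero_ob :: "('o, 'a, 'm) category_scheme \<Rightarrow> 'o" where
  "zero_ob C = (SOME z. is_initial C z)"

definition from_zero :: "('o, 'a, 'm) category_scheme \<Rightarrow> 'o \<Rightarrow> 'a" where
  "from_zero C x = (THE f. f \<in> hom C (zero_ob C) x)"

definition to_zero :: "('o, 'a, 'm) category_scheme \<Rightarrow> 'o \<Rightarrow> 'a" where
  "to_zero C x = (THE f. f \<in> hom C x (zero_ob C))"

definition is_pushout :: "('o, 'a, 'm) category_scheme \<Rightarrow> 'a \<Rightarrow> 'a \<Rightarrow> 'a \<Rightarrow> 'a \<Rightarrow> bool" where
  "is_pushout C f g i k \<longleftrightarrow> f \<in> Arr C \<and> g \<in> Arr C \<and> Dom C f = Dom C g \<and>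
    i \<in> hom C (Cod C f) (Cod C i) \<and> k \<in> hom C (Cod C g) (Cod C i) \<and>
    i \<bullet>\<^bsub>C\<^esub> f = k \<bullet>\<^bsub>C\<^esub> g \<and>
    (\<forall>y. \<forall>a \<in> hom C (Cod C f) y. \<forall>b \<in> hom C (Cod C g) y. a \<bullet>\<^bsub>C\<^esub> f = b \<bullet>\<^bsub>C\<^esub> g \<longrightarrow>
      (\<exists>!h. h \<in> hom C (Cod C i) y \<and> h \<bullet>\<^bsub>C\<^esub> i = a \<and> h \<bullet>\<^bsub>C\<^esub> k = b))"

definition is_pullback :: "('o, 'a, 'm) category_scheme \<Rightarrow> 'a \<Rightarrow> 'a \<Rightarrow> 'a \<Rightarrow> 'a \<Rightarrow> bool" where
  "is_pullback C f g i k \<longleftrightarrow> f \<in> Arr C \<and> g \<in> Arr C \<and> Cod C f = Cod C g \<and>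
    i \<in> hom C (Dom C i) (Dom C f) \<and> k \<in> hom C (Dom C i) (Dom C g) \<and>
    f \<bullet>\<^bsub>C\<^esub> i = g \<bullet>\<^bsub>C\<^esub> k \<and>
    (\<forall>y. \<forall>a \<in> hom C y (Dom C f). \<forall>b \<in> hom C y (Dom C g). f \<bullet>\<^bsub>C\<^esub> a = g \<bullet>\<^bsub>C\<^esub> b \<longrightarrow>
      (\<exists>!h. h \<in> hom C y (Dom C i) \<and> i \<bullet>\<^bsub>C\<^esub> h = a \<and> k \<bullet>\<^bsub>C\<^esub> h = b))"

definition pushout :: "('o, 'a, 'm) category_scheme \<Rightarrow> 'a \<Rightarrow> 'a \<Rightarrow> 'a \<times> 'a" where
  "pushout C f g = (SOME (i, k). is_pushout C f g i k)"

definition pullback :: "('o, 'a, 'm) category_scheme \<Rightarrow> 'a \<Rightarrow> 'a \<Rightarrow> 'a \<times> 'a" where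
  "pullback C f g = (SOME (i, k). is_pullback C f g i k)"

section \<open>Closed symmetric monoidal categories\<close>

record ('o, 'a) monoidal = "('o, 'a) category" +
  tensO :: "'o \<Rightarrow> 'o \<Rightarrow> 'o" (infixl "\<otimes>\<index>" 70)
  tensA :: "'a \<Rightarrow> 'a \<Rightarrow> 'a" (infixl "\<star>\<index>" 70)
  unit_ob :: "'o"
  assoc :: "'o \<Rightarrow> 'o \<Rightarrow> 'o \<Rightarrow> 'a"
  lunit :: "'o \<Rightarrow> 'a"
  runit :: "'o \<Rightarrow> 'a"

record ('o, 'a) sym_monoidal = "('o, 'a) monoidal" +
  braid :: "'o \<Rightarrow> 'o \<Rightarrow> 'a"

locale monoidal_category = category C
  for C :: "('o, 'a, 'm) monoidal_scheme" (structure) +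
  assumes tensO_closed: "\<lbrakk>x \<in> Obj C; y \<in> Obj C\<rbrakk> \<Longrightarrow> x \<otimes> y \<in> Obj C"
    and tensA_hom: "\<lbrakk>f \<in> hom C x y; g \<in> hom C x' y'\<rbrakk> \<Longrightarrow> f \<star> g \<in> hom C (x \<otimes> x') (y \<otimes> y')"
    and tens_ide: "\<lbrakk>x \<in> Obj C; y \<in> Obj C\<rbrakk> \<Longrightarrow> Ide C x \<star> Ide C y = Ide C (x \<otimes> y)"
    and tens_comp: "\<lbrakk>f \<in> hom C x y; g \<in> hom C y z; f' \<in> hom C x' y'; g' \<in> hom C y' z'\<rbrakk>
      \<Longrightarrow> (g \<bullet> f) \<star> (g' \<bullet> f') = (g \<star> g') \<bullet> (f \<star> f')"
    and unit_closed: "unit_ob C \<in> Obj C"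
    and assoc_hom: "\<lbrakk>x \<in> Obj C; y \<in> Obj C; z \<in> Obj C\<rbrakk>
      \<Longrightarrow> assoc C x y z \<in> hom C ((x \<otimes> y) \<otimes> z) (x \<otimes> (y \<otimes> z))"
    and assoc_iso: "\<lbrakk>x \<in> Obj C; y \<in> Obj C; z \<in> Obj C\<rbrakk> \<Longrightarrow> is_iso C (assoc C x y z)"
    and assoc_natural: "\<lbrakk>f \<in> hom C x x'; g \<in> hom C y y'; h \<in> hom C z z'\<rbrakk>
      \<Longrightarrow> assoc C x' y' z' \<bullet> ((f \<star> g) \<star> h) = (f \<star> (g \<star> h)) \<bullet> assoc C x y z"
    and lunit_hom: "x \<in> Obj C \<Longrightarrow> lunit C x \<in> hom C (unit_ob C \<otimes> x) x"
    and lunit_iso: "x \<in> Obj C \<Longrightarrow> is_iso C (lunit C x)"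
    and lunit_natural: "f \<in> hom C x y \<Longrightarrow> lunit C y \<bullet> (Ide C (unit_ob C) \<star> f) = f \<bullet> lunit C x"
    and runit_hom: "x \<in> Obj C \<Longrightarrow> runit C x \<in> hom C (x \<otimes> unit_ob C) x"
    and runit_iso: "x \<in> Obj C \<Longrightarrow> is_iso C (runit C x)"
    and runit_natural: "f \<in> hom C x y \<Longrightarrow> runit C y \<bullet> (f \<star> Ide C (unit_ob C)) = f \<bullet> runit C x"
    and pentagon: "\<lbrakk>w \<in> Obj C; x \<in> Obj C; y \<in> Obj C; z \<in> Obj C\<rbrakk>
      \<Longrightarrow> (Ide C w \<star> assoc C x y z) \<bullet> assoc C w (x \<otimes> y) z \<bullet> (assoc C w x y \<star> Ide C z)
        = assoc C w x (y \<otimes> z) \<bullet> assoc C (w \<otimes> x) y z"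
    and triangle: "\<lbrakk>x \<in> Obj C; y \<in> Obj C\<rbrakk>
      \<Longrightarrow> (Ide C x \<star> lunit C y) \<bullet> assoc C x (unit_ob C) y = runit C x \<star> Ide C y"

locale symmetric_monoidal_category = monoidal_category C
  for C :: "('o, 'a, 'm) sym_monoidal_scheme" (structure) +
  assumes braid_hom: "\<lbrakk>x \<in> Obj C; y \<in> Obj C\<rbrakk> \<Longrightarrow> braid C x y \<in> hom C (x \<otimes> y) (y \<otimes> x)"
    and braid_natural: "\<lbrakk>f \<in> hom C x x'; g \<in> hom C y y'\<rbrakk>
      \<Longrightarrow> braid C x' y' \<bullet> (f \<star> g) = (g \<star> f) \<bullet> braid C x y"
    and braid_inv: "\<lbrakk>x \<in> Obj C; y \<in> Obj C\<rbrakk> \<Longrightarrow> braid C y x \<bullet> braid C x y = Ide C (x \<otimes> y)"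
    and hexagon: "\<lbrakk>x \<in> Obj C; y \<in> Obj C; z \<in> Obj C\<rbrakk>
      \<Longrightarrow> assoc C y z x \<bullet> braid C x (y \<otimes> z) \<bullet> assoc C x y z
        = (Ide C y \<star> braid C x z) \<bullet> assoc C y x z \<bullet> (braid C x y \<star> Ide C z)"

definition tensor_right :: "('o, 'a, 'm) monoidal_scheme \<Rightarrow> 'o \<Rightarrow> ('o, 'a, 'o, 'a) func" where
  "tensor_right C y = \<lparr>FO = (\<lambda>x. x \<otimes>\<^bsub>C\<^esub> y), FA = (\<lambda>f. f \<star>\<^bsub>C\<^esub> Ide C y)\<rparr>"

definition monoidal_closed :: "('o, 'a, 'm) monoidal_scheme \<Rightarrow> bool" where
  "monoidal_closed C \<longleftrightarrow> (\<forall>y \<in> Obj C. \<exists>H. right_adjoint C C (tensor_right C y) H)"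

section \<open>Monoids and modules\<close>

text \<open>An arrow of a category of structured objects: an arrow together with its source and target.\<close>

datatype ('x, 'b) mor = Mor (src: 'x) (tgt: 'x) (the_map: 'b)

record ('o, 'a) mon =
  mon_ob :: 'o
  mult :: 'a
  unit :: 'a

record ('o, 'a) module =
  mod_ob :: 'o
  act :: 'a

definition is_monoid :: "('o, 'a, 'm) monoidal_scheme \<Rightarrow> ('o, 'a) mon \<Rightarrow> bool" where
  "is_monoid M A \<longleftrightarrow> mon_ob A \<in> Obj M \<and>
    mult A \<in> hom M (mon_ob A \<otimes>\<^bsub>M\<^esub> mon_ob A) (mon_ob A) \<and>
    unit A \<in> hom M (unit_ob M) (mon_ob A) \<and>
    mult A \<bullet>\<^bsub>M\<^esub> (mult A \<star>\<^bsub>M\<^esub> Ide M (mon_ob A))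
      = mult A \<bullet>\<^bsub>M\<^esub> (Ide M (mon_ob A) \<star>\<^bsub>M\<^esub> mult A) \<bullet>\<^bsub>M\<^esub> assoc M (mon_ob A) (mon_ob A) (mon_ob A) \<and>
    mult A \<bullet>\<^bsub>M\<^esub> (unit A \<star>\<^bsub>M\<^esub> Ide M (mon_ob A)) = lunit M (mon_ob A) \<and>
    mult A \<bullet>\<^bsub>M\<^esub> (Ide M (mon_ob A) \<star>\<^bsub>M\<^esub> unit A) = runit M (mon_ob A)"

definition is_monoid_hom ::
    "('o, 'a, 'm) monoidal_scheme \<Rightarrow> ('o, 'a) mon \<Rightarrow> ('o, 'a) mon \<Rightarrow> 'a \<Rightarrow> bool" where
  "is_monoid_hom M A B f \<longleftrightarrow> is_monoid M A \<and> is_monoid M B \<and> f \<in> hom M (mon_ob A) (mon_ob B) \<and>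
    f \<bullet>\<^bsub>M\<^esub> mult A = mult B \<bullet>\<^bsub>M\<^esub> (f \<star>\<^bsub>M\<^esub> f) \<and> f \<bullet>\<^bsub>M\<^esub> unit A = unit B"

definition Mon :: "('o, 'a, 'm) monoidal_scheme
    \<Rightarrow> (('o, 'a) mon, (('o, 'a) mon, 'a) mor) category" where
  "Mon M = \<lparr>Obj = {A. is_monoid M A},
    Arr = {Mor A B f | A B f. is_monoid_hom M A B f},
    Dom = src, Cod = tgt,
    Ide = (\<lambda>A. Mor A A (Ide M (mon_ob A))),
    Comp = (\<lambda>g f. Mor (src f) (tgt g) (the_map g \<bullet>\<^bsub>M\<^esub> the_map f))\<rparr>"

definition is_module ::
    "('o, 'a, 'm) monoidal_scheme \<Rightarrow> ('o, 'a) mon \<Rightarrow> ('o, 'a) module \<Rightarrow> bool" where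
  "is_module M A X \<longleftrightarrow> mod_ob X \<in> Obj M \<and>
    act X \<in> hom M (mon_ob A \<otimes>\<^bsub>M\<^esub> mod_ob X) (mod_ob X) \<and>
    act X \<bullet>\<^bsub>M\<^esub> (mult A \<star>\<^bsub>M\<^esub> Ide M (mod_ob X))
      = act X \<bullet>\<^bsub>M\<^esub> (Ide M (mon_ob A) \<star>\<^bsub>M\<^esub> act X) \<bullet>\<^bsub>M\<^esub> assoc M (mon_ob A) (mon_ob A) (mod_ob X) \<and>
    act X \<bullet>\<^bsub>M\<^esub> (unit A \<star>\<^bsub>M\<^esub> Ide M (mod_ob X)) = lunit M (mod_ob X)"

definition is_module_hom :: "('o, 'a, 'm) monoidal_scheme \<Rightarrow> ('o, 'a) mon
    \<Rightarrow> ('o, 'a) module \<Rightarrow> ('o, 'a) module \<Rightarrow> 'a \<Rightarrow> bool" where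
  "is_module_hom M A X Y f \<longleftrightarrow> is_module M A X \<and> is_module M A Y \<and>
    f \<in> hom M (mod_ob X) (mod_ob Y) \<and>
    f \<bullet>\<^bsub>M\<^esub> act X = act Y \<bullet>\<^bsub>M\<^esub> (Ide M (mon_ob A) \<star>\<^bsub>M\<^esub> f)"

definition Mod :: "('o, 'a, 'm) monoidal_scheme \<Rightarrow> ('o, 'a) mon
    \<Rightarrow> (('o, 'a) module, (('o, 'a) module, 'a) mor) category" where
  "Mod M A = \<lparr>Obj = {X. is_module M A X},
    Arr = {Mor X Y f | X Y f. is_module_hom M A X Y f},
    Dom = src, Cod = tgt,
    Ide = (\<lambda>X. Mor X X (Ide M (mod_ob X))),
    Comp = (\<lambda>g f. Mor (src f) (tgt g) (the_map g \<bullet>\<^bsub>M\<^esub> the_map f))\<rparr>"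

text \<open>
  The functors on monoids and modules induced by a lax monoidal functor \<open>F\<close> to \<open>N\<close> with
  structure maps \<open>\<theta> x y : F x \<otimes> F y \<rightarrow> F (x \<otimes> y)\<close> and \<open>\<theta>0\<close> from the unit of \<open>N\<close> to \<open>F\<close> of the unit.
\<close>

definition induced_mon :: "('o2, 'a2, 'm) monoidal_scheme \<Rightarrow> ('o1, 'a1, 'o2, 'a2) func
    \<Rightarrow> ('o1 \<Rightarrow> 'o1 \<Rightarrow> 'a2) \<Rightarrow> 'a2 \<Rightarrow> ('o1, 'a1) mon \<Rightarrow> ('o2, 'a2) mon" where
  "induced_mon N F \<theta> \<theta>0 A = \<lparr>mon_ob = FO F (mon_ob A),
    mult = FA F (mult A) \<bullet>\<^bsub>N\<^esub> \<theta> (mon_ob A) (mon_ob A),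
    unit = FA F (unit A) \<bullet>\<^bsub>N\<^esub> \<theta>0\<rparr>"

definition induced_Mon :: "('o2, 'a2, 'm) monoidal_scheme \<Rightarrow> ('o1, 'a1, 'o2, 'a2) func
    \<Rightarrow> ('o1 \<Rightarrow> 'o1 \<Rightarrow> 'a2) \<Rightarrow> 'a2
    \<Rightarrow> (('o1, 'a1) mon, (('o1, 'a1) mon, 'a1) mor, ('o2, 'a2) mon, (('o2, 'a2) mon, 'a2) mor) func"
  where
  "induced_Mon N F \<theta> \<theta>0 = \<lparr>FO = induced_mon N F \<theta> \<theta>0,
    FA = (\<lambda>h. Mor (induced_mon N F \<theta> \<theta>0 (src h)) (induced_mon N F \<theta> \<theta>0 (tgt h)) (FA F (the_map h)))\<rparr>"

definition induced_module :: "('o2, 'a2, 'm) monoidal_scheme \<Rightarrow> ('o1, 'a1, 'o2, 'a2) func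
    \<Rightarrow> ('o1 \<Rightarrow> 'o1 \<Rightarrow> 'a2) \<Rightarrow> ('o1, 'a1) mon \<Rightarrow> ('o1, 'a1) module \<Rightarrow> ('o2, 'a2) module" where
  "induced_module N F \<theta> A X = \<lparr>mod_ob = FO F (mod_ob X),
    act = FA F (act X) \<bullet>\<^bsub>N\<^esub> \<theta> (mon_ob A) (mod_ob X)\<rparr>"

definition induced_Mod :: "('o2, 'a2, 'm) monoidal_scheme \<Rightarrow> ('o1, 'a1, 'o2, 'a2) func
    \<Rightarrow> ('o1 \<Rightarrow> 'o1 \<Rightarrow> 'a2) \<Rightarrow> ('o1, 'a1) mon
    \<Rightarrow> (('o1, 'a1) module, (('o1, 'a1) module, 'a1) mor,
        ('o2, 'a2) module, (('o2, 'a2) module, 'a2) mor) func" where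
  "induced_Mod N F \<theta> A = \<lparr>FO = induced_module N F \<theta> A,
    FA = (\<lambda>h. Mor (induced_module N F \<theta> A (src h)) (induced_module N F \<theta> A (tgt h)) (FA F (the_map h)))\<rparr>"

text \<open>Restriction of scalars along (the underlying arrow \<open>u\<close> of) a monoid morphism.\<close>

definition restrict_module ::
    "('o, 'a, 'm) monoidal_scheme \<Rightarrow> 'a \<Rightarrow> ('o, 'a) module \<Rightarrow> ('o, 'a) module" where
  "restrict_module M u X = \<lparr>mod_ob = mod_ob X, act = act X \<bullet>\<^bsub>M\<^esub> (u \<star>\<^bsub>M\<^esub> Ide M (mod_ob X))\<rparr>"

definition restrict_Mod :: "('o, 'a, 'm) monoidal_scheme \<Rightarrow> 'a
    \<Rightarrow> (('o, 'a) module, (('o, 'a) module, 'a) mor, ('o, 'a) module, (('o, 'a) module, 'a) mor) func"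
  where
  "restrict_Mod M u = \<lparr>FO = restrict_module M u,
    FA = (\<lambda>h. Mor (restrict_module M u (src h)) (restrict_module M u (tgt h)) (the_map h))\<rparr>"

definition func_comp :: "('o2, 'a2, 'o3, 'a3) func \<Rightarrow> ('o1, 'a1, 'o2, 'a2) func
    \<Rightarrow> ('o1, 'a1, 'o3, 'a3) func" where
  "func_comp G F = \<lparr>FO = FO G \<circ> FO F, FA = FA G \<circ> FA F\<rparr>"

section \<open>The arrow category and its two monoidal structures\<close>

text \<open>
  A morphism \<open>f \<rightarrow> g\<close> of the arrow category is \<open>Mor f g (a, b)\<close> with
  \<open>a : Dom f \<rightarrow> Dom g\<close>, \<open>b : Cod f \<rightarrow> Cod g\<close> and \<open>g a = b f\<close>.
\<close>

abbreviation dom_part :: "('x, 'a \<times> 'a) mor \<Rightarrow> 'a" where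
  "dom_part s \<equiv> fst (the_map s)"

abbreviation cod_part :: "('x, 'a \<times> 'a) mor \<Rightarrow> 'a" where
  "cod_part s \<equiv> snd (the_map s)"

type_synonym 'a square = "('a, 'a \<times> 'a) mor"

definition arrow_category :: "('o, 'a, 'm) category_scheme \<Rightarrow> ('a, 'a square) category" where
  "arrow_category C = \<lparr>Obj = Arr C,
    Arr = {Mor f g (a, b) | f g a b. f \<in> Arr C \<and> g \<in> Arr C \<and>
      a \<in> hom C (Dom C f) (Dom C g) \<and> b \<in> hom C (Cod C f) (Cod C g) \<and> g \<bullet>\<^bsub>C\<^esub> a = b \<bullet>\<^bsub>C\<^esub> f},
    Dom = src, Cod = tgt,
    Ide = (\<lambda>f. Mor f f (Ide C (Dom C f), Ide C (Cod C f))),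
    Comp = (\<lambda>t s. Mor (src s) (tgt t)
      (dom_part t \<bullet>\<^bsub>C\<^esub> dom_part s, cod_part t \<bullet>\<^bsub>C\<^esub> cod_part s))\<rparr>"

definition arr_tensor :: "('o, 'a, 'm) monoidal_scheme \<Rightarrow> ('a, 'a square) monoidal" where
  "arr_tensor C = category.extend (arrow_category C)
    \<lparr>tensO = (\<lambda>f g. f \<star>\<^bsub>C\<^esub> g),
     tensA = (\<lambda>s t. Mor (src s \<star>\<^bsub>C\<^esub> src t) (tgt s \<star>\<^bsub>C\<^esub> tgt t)
       (dom_part s \<star>\<^bsub>C\<^esub> dom_part t, cod_part s \<star>\<^bsub>C\<^esub> cod_part t)),
     unit_ob = Ide C (unit_ob C),
     assoc = (\<lambda>f g h. Mor ((f \<star>\<^bsub>C\<^esub> g) \<star>\<^bsub>C\<^esub> h) (f \<star>\<^bsub>C\<^esub> (g \<star>\<^bsub>C\<^esub> h))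
       (assoc C (Dom C f) (Dom C g) (Dom C h), assoc C (Cod C f) (Cod C g) (Cod C h))),
     lunit = (\<lambda>f. Mor (Ide C (unit_ob C) \<star>\<^bsub>C\<^esub> f) f (lunit C (Dom C f), lunit C (Cod C f))),
     runit = (\<lambda>f. Mor (f \<star>\<^bsub>C\<^esub> Ide C (unit_ob C)) f (runit C (Dom C f), runit C (Cod C f)))\<rparr>"

text \<open>
  For \<open>f : X0 \<rightarrow> X1\<close> and \<open>g : Y0 \<rightarrow> Y1\<close>, the coprojections of \<open>X0 \<otimes> Y1\<close> and \<open>X1 \<otimes> Y0\<close> into
  the pushout of \<open>X0 \<otimes> Y1 \<leftarrow> X0 \<otimes> Y0 \<rightarrow> X1 \<otimes> Y0\<close>.
\<close>

definition pp_in1 :: "('o, 'a, 'm) monoidal_scheme \<Rightarrow> 'a \<Rightarrow> 'a \<Rightarrow> 'a" where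
  "pp_in1 C f g = fst (pushout C (Ide C (Dom C f) \<star>\<^bsub>C\<^esub> g) (f \<star>\<^bsub>C\<^esub> Ide C (Dom C g)))"

definition pp_in2 :: "('o, 'a, 'm) monoidal_scheme \<Rightarrow> 'a \<Rightarrow> 'a \<Rightarrow> 'a" where
  "pp_in2 C f g = snd (pushout C (Ide C (Dom C f) \<star>\<^bsub>C\<^esub> g) (f \<star>\<^bsub>C\<^esub> Ide C (Dom C g)))"

definition pp_cotuple :: "('o, 'a, 'm) monoidal_scheme \<Rightarrow> 'a \<Rightarrow> 'a \<Rightarrow> 'a \<Rightarrow> 'a \<Rightarrow> 'a" where
  "pp_cotuple C f g a b = (THE h. h \<in> hom C (Cod C (pp_in1 C f g)) (Cod C a) \<and>
    h \<bullet>\<^bsub>C\<^esub> pp_in1 C f g = a \<and> h \<bullet>\<^bsub>C\<^esub> pp_in2 C f g = b)"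

definition pp :: "('o, 'a, 'm) monoidal_scheme \<Rightarrow> 'a \<Rightarrow> 'a \<Rightarrow> 'a" where
  "pp C f g = pp_cotuple C f g (f \<star>\<^bsub>C\<^esub> Ide C (Cod C g)) (Ide C (Cod C f) \<star>\<^bsub>C\<^esub> g)"

definition pp_map :: "('o, 'a, 'm) monoidal_scheme \<Rightarrow> 'a square \<Rightarrow> 'a square \<Rightarrow> 'a square" where
  "pp_map C s t = Mor (pp C (src s) (src t)) (pp C (tgt s) (tgt t))
    (pp_cotuple C (src s) (src t)
       (pp_in1 C (tgt s) (tgt t) \<bullet>\<^bsub>C\<^esub> (dom_part s \<star>\<^bsub>C\<^esub> cod_part t))
       (pp_in2 C (tgt s) (tgt t) \<bullet>\<^bsub>C\<^esub> (cod_part s \<star>\<^bsub>C\<^esub> dom_part t)),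
     cod_part s \<star>\<^bsub>C\<^esub> cod_part t)"

text \<open>
  The domain of the iterated pushout product is glued from the three objects
  \<open>X0 \<otimes> Y1 \<otimes> Z1\<close>, \<open>X1 \<otimes> Y0 \<otimes> Z1\<close> and \<open>X1 \<otimes> Y1 \<otimes> Z0\<close>; the associator is induced by
  that of \<open>C\<close> on each of them.
\<close>

definition pp_assoc :: "('o, 'a, 'm) monoidal_scheme \<Rightarrow> 'a \<Rightarrow> 'a \<Rightarrow> 'a \<Rightarrow> 'a square" where
  "pp_assoc C f g h = Mor (pp C (pp C f g) h) (pp C f (pp C g h))
    (THE u. u \<in> hom C (Dom C (pp C (pp C f g) h)) (Dom C (pp C f (pp C g h))) \<and>
       u \<bullet>\<^bsub>C\<^esub> pp_in1 C (pp C f g) h \<bullet>\<^bsub>C\<^esub> (pp_in1 C f g \<star>\<^bsub>C\<^esub> Ide C (Cod C h))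
         = pp_in1 C f (pp C g h) \<bullet>\<^bsub>C\<^esub> assoc C (Dom C f) (Cod C g) (Cod C h) \<and>
       u \<bullet>\<^bsub>C\<^esub> pp_in1 C (pp C f g) h \<bullet>\<^bsub>C\<^esub> (pp_in2 C f g \<star>\<^bsub>C\<^esub> Ide C (Cod C h))
         = pp_in2 C f (pp C g h) \<bullet>\<^bsub>C\<^esub> (Ide C (Cod C f) \<star>\<^bsub>C\<^esub> pp_in1 C g h)
             \<bullet>\<^bsub>C\<^esub> assoc C (Cod C f) (Dom C g) (Cod C h) \<and>
       u \<bullet>\<^bsub>C\<^esub> pp_in2 C (pp C f g) h
         = pp_in2 C f (pp C g h) \<bullet>\<^bsub>C\<^esub> (Ide C (Cod C f) \<star>\<^bsub>C\<^esub> pp_in2 C g h)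
             \<bullet>\<^bsub>C\<^esub> assoc C (Cod C f) (Cod C g) (Dom C h),
     assoc C (Cod C f) (Cod C g) (Cod C h))"

text \<open>
  The unit is \<open>0 \<rightarrow> S\<close>. In the domain of \<open>(0 \<rightarrow> S) \<box> f\<close> the summand \<open>0 \<otimes> X1\<close> is initial when
  \<open>C\<close> is closed, so that the unitor is determined on the other summand \<open>S \<otimes> X0\<close>; likewise on the right.
\<close>

definition pp_unit :: "('o, 'a, 'm) monoidal_scheme \<Rightarrow> 'a" where
  "pp_unit C = from_zero C (unit_ob C)"

definition pp_lunit :: "('o, 'a, 'm) monoidal_scheme \<Rightarrow> 'a \<Rightarrow> 'a square" where
  "pp_lunit C f = Mor (pp C (pp_unit C) f) f
    (THE u. u \<in> hom C (Dom C (pp C (pp_unit C) f)) (Dom C f) \<and>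
       u \<bullet>\<^bsub>C\<^esub> pp_in2 C (pp_unit C) f = lunit C (Dom C f),
     lunit C (Cod C f))"

definition pp_runit :: "('o, 'a, 'm) monoidal_scheme \<Rightarrow> 'a \<Rightarrow> 'a square" where
  "pp_runit C f = Mor (pp C f (pp_unit C)) f
    (THE u. u \<in> hom C (Dom C (pp C f (pp_unit C))) (Dom C f) \<and>
       u \<bullet>\<^bsub>C\<^esub> pp_in1 C f (pp_unit C) = runit C (Dom C f),
     runit C (Cod C f))"

definition arr_pushout :: "('o, 'a, 'm) monoidal_scheme \<Rightarrow> ('a, 'a square) monoidal" where
  "arr_pushout C = category.extend (arrow_category C)
    \<lparr>tensO = pp C, tensA = pp_map C, unit_ob = pp_unit C,
     assoc = pp_assoc C, lunit = pp_lunit C, runit = pp_runit C\<rparr>"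

definition Smith_ideals :: "('o, 'a, 'm) monoidal_scheme
    \<Rightarrow> (('a, 'a square) mon, (('a, 'a square) mon, 'a square) mor) category" where
  "Smith_ideals C = Mon (arr_pushout C)"

definition Monoid_homs :: "('o, 'a, 'm) monoidal_scheme
    \<Rightarrow> (('a, 'a square) mon, (('a, 'a square) mon, 'a square) mor) category" where
  "Monoid_homs C = Mon (arr_tensor C)"

text \<open>The source and target monoids of a monoid for the tensor product structure.\<close>

definition dom_mon :: "('o, 'a, 'm) category_scheme \<Rightarrow> ('a, 'a square) mon \<Rightarrow> ('o, 'a) mon" where
  "dom_mon C P = \<lparr>mon_ob = Dom C (mon_ob P), mult = dom_part (mult P), unit = dom_part (unit P)\<rparr>"

definition cod_mon :: "('o, 'a, 'm) category_scheme \<Rightarrow> ('a, 'a square) mon \<Rightarrow> ('o, 'a) mon" where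
  "cod_mon C P = \<lparr>mon_ob = Cod C (mon_ob P), mult = cod_part (mult P), unit = cod_part (unit P)\<rparr>"

section \<open>Cokernel and kernel\<close>

definition coker :: "('o, 'a, 'm) category_scheme \<Rightarrow> 'a \<Rightarrow> 'a" where
  "coker C f = snd (pushout C (to_zero C (Dom C f)) f)"

definition ker :: "('o, 'a, 'm) category_scheme \<Rightarrow> 'a \<Rightarrow> 'a" where
  "ker C p = snd (pullback C (from_zero C (Cod C p)) p)"

definition lift_coker :: "('o, 'a, 'm) category_scheme \<Rightarrow> 'a \<Rightarrow> 'a \<Rightarrow> 'a" where
  "lift_coker C q a = (THE w. w \<in> hom C (Cod C q) (Cod C a) \<and> w \<bullet>\<^bsub>C\<^esub> q = a)"

definition lift_ker :: "('o, 'a, 'm) category_scheme \<Rightarrow> 'a \<Rightarrow> 'a \<Rightarrow> 'a" where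
  "lift_ker C i a = (THE w. w \<in> hom C (Dom C a) (Dom C i) \<and> i \<bullet>\<^bsub>C\<^esub> w = a)"

definition Coker :: "('o, 'a, 'm) category_scheme \<Rightarrow> ('a, 'a square, 'a, 'a square) func" where
  "Coker C = \<lparr>FO = coker C,
    FA = (\<lambda>s. Mor (coker C (src s)) (coker C (tgt s))
      (cod_part s, lift_coker C (coker C (src s)) (coker C (tgt s) \<bullet>\<^bsub>C\<^esub> cod_part s)))\<rparr>"

definition Ker :: "('o, 'a, 'm) category_scheme \<Rightarrow> ('a, 'a square, 'a, 'a square) func" where
  "Ker C = \<lparr>FO = ker C,
    FA = (\<lambda>s. Mor (ker C (src s)) (ker C (tgt s))
      (lift_ker C (ker C (tgt s)) (dom_part s \<bullet>\<^bsub>C\<^esub> ker C (src s)), dom_part s))\<rparr>"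

text \<open>
  The monoidal structure maps \<open>coker f \<otimes> coker g \<rightarrow> coker (f \<box> g)\<close> and \<open>1 \<rightarrow> coker (0 \<rightarrow> S)\<close> (which
  are the identity of \<open>X1 \<otimes> Y1\<close>, respectively \<open>S\<close>, on domains), and
  \<open>ker p \<box> ker q \<rightarrow> ker (p \<otimes> q)\<close> and \<open>(0 \<rightarrow> S) \<rightarrow> ker 1\<close> (which are identities on codomains).
\<close>

definition coker_mu :: "('o, 'a, 'm) monoidal_scheme \<Rightarrow> 'a \<Rightarrow> 'a \<Rightarrow> 'a square" where
  "coker_mu C f g = Mor (coker C f \<star>\<^bsub>C\<^esub> coker C g) (coker C (pp C f g))
    (Ide C (Cod C f \<otimes>\<^bsub>C\<^esub> Cod C g),
     lift_coker C (coker C f \<star>\<^bsub>C\<^esub> coker C g) (coker C (pp C f g)))"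

definition coker_eps :: "('o, 'a, 'm) monoidal_scheme \<Rightarrow> 'a square" where
  "coker_eps C = Mor (Ide C (unit_ob C)) (coker C (pp_unit C))
    (Ide C (unit_ob C), coker C (pp_unit C))"

definition ker_mu :: "('o, 'a, 'm) monoidal_scheme \<Rightarrow> 'a \<Rightarrow> 'a \<Rightarrow> 'a square" where
  "ker_mu C p q = Mor (pp C (ker C p) (ker C q)) (ker C (p \<star>\<^bsub>C\<^esub> q))
    (lift_ker C (ker C (p \<star>\<^bsub>C\<^esub> q)) (pp C (ker C p) (ker C q)),
     Ide C (Dom C p \<otimes>\<^bsub>C\<^esub> Dom C q))"

definition ker_eps :: "('o, 'a, 'm) monoidal_scheme \<Rightarrow> 'a square" where
  "ker_eps C = Mor (pp_unit C) (ker C (Ide C (unit_ob C)))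
    (from_zero C (Dom C (ker C (Ide C (unit_ob C)))), Ide C (unit_ob C))"

definition coker_mon_functor :: "('o, 'a, 'm) monoidal_scheme
    \<Rightarrow> (('a, 'a square) mon, (('a, 'a square) mon, 'a square) mor,
        ('a, 'a square) mon, (('a, 'a square) mon, 'a square) mor) func" where
  "coker_mon_functor C = induced_Mon (arr_tensor C) (Coker C) (coker_mu C) (coker_eps C)"

definition ker_mon_functor :: "('o, 'a, 'm) monoidal_scheme
    \<Rightarrow> (('a, 'a square) mon, (('a, 'a square) mon, 'a square) mor,
        ('a, 'a square) mon, (('a, 'a square) mon, 'a square) mor) func" where
  "ker_mon_functor C = induced_Mon (arr_pushout C) (Ker C) (ker_mu C) (ker_eps C)"

text \<open>The canonical square \<open>j \<rightarrow> ker (coker j)\<close>.\<close>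

definition ker_coker_unit :: "('o, 'a, 'm) category_scheme \<Rightarrow> 'a \<Rightarrow> 'a square" where
  "ker_coker_unit C j = Mor j (ker C (coker C j)) (lift_ker C (ker C (coker C j)) j, Ide C (Cod C j))"

definition coker_mod_functor :: "('o, 'a, 'm) monoidal_scheme \<Rightarrow> ('a, 'a square) mon
    \<Rightarrow> (('a, 'a square) module, (('a, 'a square) module, 'a square) mor,
        ('a, 'a square) module, (('a, 'a square) module, 'a square) mor) func" where
  "coker_mod_functor C J = induced_Mod (arr_tensor C) (Coker C) (coker_mu C) J"

text \<open>
  The kernel of a module over \<open>coker j\<close> is a module over \<open>ker (coker j)\<close>, hence over \<open>j\<close>.
\<close>

definition ker_mod_functor :: "('o, 'a, 'm) monoidal_scheme \<Rightarrow> ('a, 'a square) mon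
    \<Rightarrow> (('a, 'a square) module, (('a, 'a square) module, 'a square) mor,
        ('a, 'a square) module, (('a, 'a square) module, 'a square) mor) func" where
  "ker_mod_functor C J = func_comp
    (restrict_Mod (arr_pushout C) (ker_coker_unit C (mon_ob J)))
    (induced_Mod (arr_pushout C) (Ker C) (ker_mu C) (FO (coker_mon_functor C) J))"

end

theory Submission
  imports Defs
begin

text \<open>
  A commutative square into a monomorphism is determined by its map of codomains, and a square out of an
  epimorphism by its map of domains (\<open>square_eq_mono\<close>, \<open>square_eq_epi\<close>). Kernels are monic and cokernels
  are epic, and this decides nearly every question about them by looking at one component.

  For arrows alone: a square \<open>coker f \<rightarrow> p\<close> amounts to a map \<open>a : Cod f \<rightarrow> Dom p\<close> with \<open>p a f = 0\<close>, and so
  does a square \<open>f \<rightarrow> ker p\<close>. Hence the cokernel is left adjoint to the kernel (\<open>Coker_Ker_adjunction\<close>).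

  With structure: the codomain of a pushout product is the tensor product of the codomains, so the target of a
  Smith ideal is a monoid in \<open>C\<close>; and source and target of a monoid for the tensor product of arrows are
  monoids. Conversely a monoid structure on an arrow can be checked on codomains for the pushout product if
  the arrow is monic, and on domains for the tensor product if it is epic (\<open>is_monoid_pushoutI\<close>,
  \<open>is_monoid_tensorI\<close>), and the same holds for morphisms (\<open>is_monoid_hom_pushout_iff\<close>,
  \<open>is_monoid_hom_tensor_iff\<close>). The canonical maps \<open>coker f \<otimes> coker g \<rightarrow> coker (f \<box> g)\<close> and
  \<open>ker p \<box> ker q \<rightarrow> ker (p \<otimes> q)\<close> are identities on domains and on codomains, respectively. So the cokernel
  of a Smith ideal \<open>X\<close> is a monoid with the target of \<open>X\<close> as its source (\<open>dom_mon_coker\<close>), the kernel of a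
  monoid homomorphism \<open>Y\<close> is a Smith ideal with the source of \<open>Y\<close> as its target (\<open>cod_mon_ker\<close>), and morphisms
  \<open>coker X \<rightarrow> Y\<close> and \<open>X \<rightarrow> ker Y\<close> are both given by a monoid homomorphism in \<open>C\<close> from the target of \<open>X\<close> to the
  source of \<open>Y\<close> that satisfies the vanishing condition. The adjunction of arrows therefore lifts
  (\<open>right_adjoint_structured\<close>). Modules behave in the same way.

  What has to be constructed are the structure maps themselves. The one for cokernels exists because the
  tensor product of cokernels of \<open>f\<close> and \<open>g\<close> is a cokernel of \<open>f \<box> g\<close> (\<open>cokernel_pp\<close>); the associator and
  the unitors of the pushout product exist because tensoring with an object preserves pushouts and the
  initial object (\<open>pp_assoc_hom\<close>, \<open>pp_lunit_hom\<close>, \<open>pp_runit_hom\<close>). Both rest on closedness, by which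
  tensoring is a left adjoint; the pushouts and pullbacks come from bicompleteness.
\<close>

section \<open>Arrows and pushouts in a category\<close>

context category
begin

lemma hom_iff: "f \<in> hom C x y \<longleftrightarrow> f \<in> Arr C \<and> Dom C f = x \<and> Cod C f = y"
  by (auto simp: hom_def)

lemma obj_simps [simp]:
  "f \<in> Arr C \<Longrightarrow> Dom C f \<in> Obj C"
  "f \<in> Arr C \<Longrightarrow> Cod C f \<in> Obj C"
  by (auto intro: dom_closed cod_closed)

lemma Ide_simps [simp]:
  assumes "x \<in> Obj C"
  shows "Ide C x \<in> Arr C" "Dom C (Ide C x) = x" "Cod C (Ide C x) = x"
  using ide_hom[OF assms] by (auto simp: hom_iff)

lemma comp_simps [simp]:
  assumes "f \<in> Arr C" "g \<in> Arr C" "Dom C g = Cod C f"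
  shows "g \<bullet> f \<in> Arr C" "Dom C (g \<bullet> f) = Dom C f" "Cod C (g \<bullet> f) = Cod C g"
  using comp_hom[of f "Dom C f" "Cod C f" g "Cod C g"] assms by (auto simp: hom_iff)

lemma comp_Ide [simp]: "\<lbrakk>f \<in> Arr C; x = Dom C f\<rbrakk> \<Longrightarrow> f \<bullet> Ide C x = f"
  by (rule comp_ide) (auto simp: hom_iff)

lemma Ide_comp [simp]: "\<lbrakk>f \<in> Arr C; x = Cod C f\<rbrakk> \<Longrightarrow> Ide C x \<bullet> f = f"
  by (rule ide_comp) (auto simp: hom_iff)

lemma comp_assoc_right [simp]:
  "\<lbrakk>f \<in> Arr C; g \<in> Arr C; h \<in> Arr C; Dom C g = Cod C f; Dom C h = Cod C g\<rbrakk>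
    \<Longrightarrow> (h \<bullet> g) \<bullet> f = h \<bullet> (g \<bullet> f)"
  by (rule comp_assoc) (auto simp: hom_iff)

text \<open>
  Composites are normalised to the right, which hides the factor \<open>g f\<close> inside \<open>g (f k)\<close>; an equation for
  \<open>g f\<close> becomes applicable there only in this form.
\<close>

lemma comp_chain:
  "\<lbrakk>g \<bullet> f = h; f \<in> Arr C; g \<in> Arr C; k \<in> Arr C; Dom C g = Cod C f; Dom C f = Cod C k\<rbrakk>
    \<Longrightarrow> g \<bullet> (f \<bullet> k) = h \<bullet> k"
  using comp_assoc_right[of k f g] by simp

lemma initial_arr_eq:
  assumes "is_initial C z" "f \<in> Arr C" "g \<in> Arr C" "Dom C f = z" "Dom C g = z" "Cod C f = Cod C g"
  shows "f = g"
proof -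
  have "\<exists>!f. f \<in> hom C z (Cod C g)"
    using assms by (simp add: is_initial_def)
  then show ?thesis
    using assms by (auto simp: hom_iff)
qed

lemma terminal_arr_eq:
  assumes "is_terminal C z" "f \<in> Arr C" "g \<in> Arr C" "Cod C f = z" "Cod C g = z" "Dom C f = Dom C g"
  shows "f = g"
proof -
  have "\<exists>!f. f \<in> hom C (Dom C g) z"
    using assms by (simp add: is_terminal_def)
  then show ?thesis
    using assms by (auto simp: hom_iff)
qed

end

definition is_epi :: "('o, 'a, 'm) category_scheme \<Rightarrow> 'a \<Rightarrow> bool" where
  "is_epi C e \<longleftrightarrow> e \<in> Arr C \<and> (\<forall>a \<in> Arr C. \<forall>b \<in> Arr C. Dom C a = Cod C e \<longrightarrow> Dom C b = Cod C e \<longrightarrow>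
    a \<bullet>\<^bsub>C\<^esub> e = b \<bullet>\<^bsub>C\<^esub> e \<longrightarrow> a = b)"

definition is_mono :: "('o, 'a, 'm) category_scheme \<Rightarrow> 'a \<Rightarrow> bool" where
  "is_mono C k \<longleftrightarrow> k \<in> Arr C \<and> (\<forall>a \<in> Arr C. \<forall>b \<in> Arr C. Cod C a = Dom C k \<longrightarrow> Cod C b = Dom C k \<longrightarrow>
    k \<bullet>\<^bsub>C\<^esub> a = k \<bullet>\<^bsub>C\<^esub> b \<longrightarrow> a = b)"

lemma epiD: "\<lbrakk>is_epi C e; a \<bullet>\<^bsub>C\<^esub> e = b \<bullet>\<^bsub>C\<^esub> e; a \<in> Arr C; b \<in> Arr C; Dom C a = Cod C e; Dom C b = Cod C e\<rbrakk>
  \<Longrightarrow> a = b"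
  by (auto simp: is_epi_def)

lemma monoD: "\<lbrakk>is_mono C k; k \<bullet>\<^bsub>C\<^esub> a = k \<bullet>\<^bsub>C\<^esub> b; a \<in> Arr C; b \<in> Arr C; Cod C a = Dom C k; Cod C b = Dom C k\<rbrakk>
  \<Longrightarrow> a = b"
  by (auto simp: is_mono_def)

lemma (in category) epi_comp:
  assumes "is_epi C e" "is_epi C e'" "Dom C e' = Cod C e"
  shows "is_epi C (e' \<bullet> e)"
  unfolding is_epi_def
proof (intro conjI ballI impI)
  have e: "e \<in> Arr C" "e' \<in> Arr C"
    using assms by (auto simp: is_epi_def)
  then show "e' \<bullet> e \<in> Arr C"
    using assms by simp
  fix a b
  assume ab: "a \<in> Arr C" "b \<in> Arr C" "Dom C a = Cod C (e' \<bullet> e)" "Dom C b = Cod C (e' \<bullet> e)"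
    and eq: "a \<bullet> e' \<bullet> e = b \<bullet> e' \<bullet> e"
  have "(a \<bullet> e') \<bullet> e = (b \<bullet> e') \<bullet> e"
    using ab e eq assms(3) by simp
  then have "a \<bullet> e' = b \<bullet> e'"
    by (rule epiD[OF assms(1)]) (use ab e assms(3) in simp_all)
  then show "a = b"
    by (rule epiD[OF assms(2)]) (use ab e assms(3) in simp_all)
qed

lemma (in category) epi_Ide: "x \<in> Obj C \<Longrightarrow> is_epi C (Ide C x)"
  by (auto simp: is_epi_def)

lemma is_pushoutD:
  assumes "is_pushout C f g i k"
  shows "f \<in> Arr C" "g \<in> Arr C" "i \<in> Arr C" "k \<in> Arr C" "Dom C g = Dom C f"
    "Dom C i = Cod C f" "Dom C k = Cod C g" "Cod C k = Cod C i" "i \<bullet>\<^bsub>C\<^esub> f = k \<bullet>\<^bsub>C\<^esub> g"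
  using assms by (auto simp: is_pushout_def hom_def)

lemma (in category) is_pushoutI:
  assumes "f \<in> Arr C" "g \<in> Arr C" "i \<in> Arr C" "k \<in> Arr C" "Dom C g = Dom C f"
    and "Dom C i = Cod C f" "Dom C k = Cod C g" "Cod C k = Cod C i" "i \<bullet> f = k \<bullet> g"
    and ex: "\<And>a b. \<lbrakk>a \<in> Arr C; b \<in> Arr C; Dom C a = Cod C f; Dom C b = Cod C g; Cod C b = Cod C a; a \<bullet> f = b \<bullet> g\<rbrakk>
      \<Longrightarrow> \<exists>h \<in> Arr C. Dom C h = Cod C i \<and> h \<bullet> i = a \<and> h \<bullet> k = b"
    and eq: "\<And>h h'. \<lbrakk>h \<in> Arr C; h' \<in> Arr C; Dom C h = Cod C i; Dom C h' = Cod C i; h \<bullet> i = h' \<bullet> i; h \<bullet> k = h' \<bullet> k\<rbrakk>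
      \<Longrightarrow> h = h'"
  shows "is_pushout C f g i k"
  unfolding is_pushout_def
proof (intro conjI allI ballI impI)
  fix y a b
  assume a: "a \<in> hom C (Cod C f) y" and b: "b \<in> hom C (Cod C g) y" and ab: "a \<bullet> f = b \<bullet> g"
  obtain h where h: "h \<in> Arr C" "Dom C h = Cod C i" "h \<bullet> i = a" "h \<bullet> k = b"
    using ex[of a b] a b ab by (auto simp: hom_iff)
  show "\<exists>!h. h \<in> hom C (Cod C i) y \<and> h \<bullet> i = a \<and> h \<bullet> k = b"
  proof (rule ex1I[of _ h])
    show "h \<in> hom C (Cod C i) y \<and> h \<bullet> i = a \<and> h \<bullet> k = b"
      using h a assms(3,6) by (auto simp: hom_iff)
    show "h' = h" if "h' \<in> hom C (Cod C i) y \<and> h' \<bullet> i = a \<and> h' \<bullet> k = b" for h'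
      by (rule eq) (use that h in \<open>auto simp: hom_iff\<close>)
  qed
qed (use assms in \<open>auto simp: hom_iff\<close>)

lemma is_pushout_ex1:
  assumes "is_pushout C f g i k" "a \<in> Arr C" "b \<in> Arr C" "Dom C a = Cod C f" "Dom C b = Cod C g"
    "Cod C a = Cod C b" "a \<bullet>\<^bsub>C\<^esub> f = b \<bullet>\<^bsub>C\<^esub> g"
  shows "\<exists>!h. h \<in> hom C (Cod C i) (Cod C a) \<and> h \<bullet>\<^bsub>C\<^esub> i = a \<and> h \<bullet>\<^bsub>C\<^esub> k = b"
proof -
  have "a \<in> hom C (Cod C f) (Cod C a)" "b \<in> hom C (Cod C g) (Cod C a)"
    using assms by (auto simp: hom_def)
  then show ?thesis
    using assms(1,7) unfolding is_pushout_def by blast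
qed

lemma (in category) is_pushout_arr_eq:
  assumes po: "is_pushout C f g i k"
    and h: "h \<in> Arr C" "h' \<in> Arr C" "Dom C h = Cod C i" "Dom C h' = Cod C i"
    and eq: "h \<bullet> i = h' \<bullet> i" "h \<bullet> k = h' \<bullet> k"
  shows "h = h'"
proof -
  note d = is_pushoutD[OF po]
  have c: "Cod C (h \<bullet> i) = Cod C h" "Cod C (h' \<bullet> i) = Cod C h'"
    using h d by simp_all
  have "(h \<bullet> i) \<bullet> f = (h \<bullet> k) \<bullet> g"
    using h d by simp
  then have "\<exists>!u. u \<in> hom C (Cod C i) (Cod C (h \<bullet> i)) \<and> u \<bullet> i = h \<bullet> i \<and> u \<bullet> k = h \<bullet> k"
    using h d by (intro is_pushout_ex1[OF po]) simp_all
  moreover have "h \<in> hom C (Cod C i) (Cod C (h \<bullet> i)) \<and> h \<bullet> i = h \<bullet> i \<and> h \<bullet> k = h \<bullet> k"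
    using h c by (simp add: hom_iff)
  moreover have "h' \<in> hom C (Cod C i) (Cod C (h \<bullet> i)) \<and> h' \<bullet> i = h \<bullet> i \<and> h' \<bullet> k = h \<bullet> k"
    using h c eq by (simp add: hom_iff)
  ultimately show ?thesis
    by blast
qed

text \<open>
  This characterisation turns the preservation of pushouts into the preservation of epimorphisms.
\<close>

lemma (in category) is_pushout_epi:
  assumes "e \<in> Arr C"
  shows "is_pushout C e e (Ide C (Cod C e)) (Ide C (Cod C e)) \<longleftrightarrow> is_epi C e"
proof
  assume po: "is_pushout C e e (Ide C (Cod C e)) (Ide C (Cod C e))"
  show "is_epi C e"
    unfolding is_epi_def
  proof (intro conjI ballI impI assms)
    fix a b
    assume ab: "a \<in> Arr C" "b \<in> Arr C" "Dom C a = Cod C e" "Dom C b = Cod C e" "a \<bullet> e = b \<bullet> e"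
    then have "Cod C a = Cod C b"
      using assms by (metis comp_simps(3))
    then show "a = b"
      using is_pushout_ex1[OF po, of a b] ab assms by (auto simp: hom_iff)
  qed
next
  assume e: "is_epi C e"
  show "is_pushout C e e (Ide C (Cod C e)) (Ide C (Cod C e))"
  proof (rule is_pushoutI)
    show "\<exists>h\<in>Arr C. Dom C h = Cod C (Ide C (Cod C e)) \<and> h \<bullet> Ide C (Cod C e) = a \<and> h \<bullet> Ide C (Cod C e) = b"
      if "a \<in> Arr C" "b \<in> Arr C" "Dom C a = Cod C e" "Dom C b = Cod C e" "a \<bullet> e = b \<bullet> e" for a b
      using epiD[OF e that(5)] that assms by auto
  qed (use assms in auto)
qed

section \<open>Left adjoints\<close>

lemma right_adjoint_transpose:
  assumes "right_adjoint A B F G"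
  shows "\<exists>\<phi>. (\<forall>a \<in> Obj A. \<forall>b \<in> Obj B. bij_betw (\<phi> a b) (hom B (FO F a) b) (hom A a (FO G b))) \<and>
    (\<forall>a a'. \<forall>b \<in> Obj B. \<forall>h \<in> hom A a' a. \<forall>g \<in> hom B (FO F a) b. \<phi> a' b (g \<bullet>\<^bsub>B\<^esub> FA F h) = \<phi> a b g \<bullet>\<^bsub>A\<^esub> h)"
proof -
  interpret F: cat_functor A B F
    using assms by (simp add: right_adjoint_def)
  interpret G: cat_functor B A G
    using assms by (simp add: right_adjoint_def)
  obtain \<phi> where bij: "\<forall>a \<in> Obj A. \<forall>b \<in> Obj B. bij_betw (\<phi> a b) (hom B (FO F a) b) (hom A a (FO G b))"
    and nat: "\<forall>a \<in> Obj A. \<forall>a' \<in> Obj A. \<forall>b \<in> Obj B. \<forall>b' \<in> Obj B.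
        \<forall>h \<in> hom A a' a. \<forall>g \<in> hom B (FO F a) b. \<forall>k \<in> hom B b b'.
          \<phi> a' b' (k \<bullet>\<^bsub>B\<^esub> g \<bullet>\<^bsub>B\<^esub> FA F h) = FA G k \<bullet>\<^bsub>A\<^esub> \<phi> a b g \<bullet>\<^bsub>A\<^esub> h"
    using assms unfolding right_adjoint_def by blast
  show ?thesis
  proof (intro exI conjI ballI allI)
    show "bij_betw (\<phi> a b) (hom B (FO F a) b) (hom A a (FO G b))" if "a \<in> Obj A" "b \<in> Obj B" for a b
      using bij that by blast
    show "\<phi> a' b (g \<bullet>\<^bsub>B\<^esub> FA F h) = \<phi> a b g \<bullet>\<^bsub>A\<^esub> h"
      if b: "b \<in> Obj B" and h: "h \<in> hom A a' a" and g: "g \<in> hom B (FO F a) b" for a a' b h g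
    proof -
      have o: "a \<in> Obj A" "a' \<in> Obj A"
        using h by (auto simp: F.A.hom_iff)
      have \<phi>g: "\<phi> a b g \<in> hom A a (FO G b)"
        using bij o b g by (meson bij_betwE)
      have Fh: "FA F h \<in> hom B (FO F a') (FO F a)"
        using h by (rule F.FA_hom)
      have "\<phi> a' b (Ide B b \<bullet>\<^bsub>B\<^esub> g \<bullet>\<^bsub>B\<^esub> FA F h) = FA G (Ide B b) \<bullet>\<^bsub>A\<^esub> \<phi> a b g \<bullet>\<^bsub>A\<^esub> h"
        using nat o b h g F.B.ide_hom[OF b] by blast
      then show ?thesis
        using b h g \<phi>g Fh by (simp add: G.FA_ide F.A.hom_iff F.B.hom_iff G.FO_closed)
    qed
  qed
qed

lemma left_adjoint_initial:
  assumes adj: "right_adjoint A B F G" and z: "is_initial A z"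
  shows "is_initial B (FO F z)"
proof -
  interpret F: cat_functor A B F
    using adj by (simp add: right_adjoint_def)
  interpret G: cat_functor B A G
    using adj by (simp add: right_adjoint_def)
  obtain \<phi> where bij: "\<forall>a \<in> Obj A. \<forall>b \<in> Obj B. bij_betw (\<phi> a b) (hom B (FO F a) b) (hom A a (FO G b))"
    and nat: "\<forall>a a'. \<forall>b \<in> Obj B. \<forall>h \<in> hom A a' a. \<forall>g \<in> hom B (FO F a) b. \<phi> a' b (g \<bullet>\<^bsub>B\<^esub> FA F h) = \<phi> a b g \<bullet>\<^bsub>A\<^esub> h"
    using right_adjoint_transpose[OF adj] by blast
  have zo: "z \<in> Obj A"
    using z by (simp add: is_initial_def)
  have "\<exists>!f. f \<in> hom B (FO F z) x" if x: "x \<in> Obj B" for x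
  proof -
    have u: "\<exists>!f. f \<in> hom A z (FO G x)"
      using z x by (simp add: is_initial_def G.FO_closed)
    note b = bij[rule_format, OF zo x]
    obtain f where "f \<in> hom B (FO F z) x"
      using u b unfolding bij_betw_def by blast
    moreover have "f = g" if "f \<in> hom B (FO F z) x" "g \<in> hom B (FO F z) x" for f g
      using u b that unfolding bij_betw_def by (metis imageI inj_onD)
    ultimately show ?thesis
      by blast
  qed
  then show ?thesis
    using zo by (simp add: is_initial_def F.FO_closed)
qed

text \<open>
  Transposition is injective and natural, so a cocone under the image of the span is the transpose of a
  cocone under the span itself, and the factorisations of the two correspond to each other.
\<close>

lemma left_adjoint_pushout:
  assumes adj: "right_adjoint A B F G" and po: "is_pushout A f g i k"
  shows "is_pushout B (FA F f) (FA F g) (FA F i) (FA F k)"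
proof -
  interpret F: cat_functor A B F
    using adj by (simp add: right_adjoint_def)
  interpret G: cat_functor B A G
    using adj by (simp add: right_adjoint_def)
  obtain \<phi> where bij: "\<forall>a \<in> Obj A. \<forall>b \<in> Obj B. bij_betw (\<phi> a b) (hom B (FO F a) b) (hom A a (FO G b))"
    and nat: "\<forall>a a'. \<forall>b \<in> Obj B. \<forall>h \<in> hom A a' a. \<forall>g \<in> hom B (FO F a) b. \<phi> a' b (g \<bullet>\<^bsub>B\<^esub> FA F h) = \<phi> a b g \<bullet>\<^bsub>A\<^esub> h"
    using right_adjoint_transpose[OF adj] by blast
  note d = is_pushoutD[OF po]
  have F: "FA F h \<in> Arr B" "Dom B (FA F h) = FO F (Dom A h)" "Cod B (FA F h) = FO F (Cod A h)"
    if "h \<in> Arr A" for h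
    using F.FA_hom[of h "Dom A h" "Cod A h"] that by (auto simp: F.A.hom_iff F.B.hom_iff)
  have comm: "FA F i \<bullet>\<^bsub>B\<^esub> FA F f = FA F k \<bullet>\<^bsub>B\<^esub> FA F g"
  proof -
    have "FA F (i \<bullet>\<^bsub>A\<^esub> f) = FA F i \<bullet>\<^bsub>B\<^esub> FA F f"
      using d by (intro F.FA_comp) (auto simp: F.A.hom_iff)
    moreover have "FA F (k \<bullet>\<^bsub>A\<^esub> g) = FA F k \<bullet>\<^bsub>B\<^esub> FA F g"
      using d by (intro F.FA_comp) (auto simp: F.A.hom_iff)
    ultimately show ?thesis
      using d by simp
  qed
  have "\<exists>!h. h \<in> hom B (FO F (Cod A i)) y \<and> h \<bullet>\<^bsub>B\<^esub> FA F i = a \<and> h \<bullet>\<^bsub>B\<^esub> FA F k = b"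
    if a: "a \<in> hom B (FO F (Cod A f)) y" and b: "b \<in> hom B (FO F (Cod A g)) y"
      and ab: "a \<bullet>\<^bsub>B\<^esub> FA F f = b \<bullet>\<^bsub>B\<^esub> FA F g" for y a b
  proof -
    have y: "y \<in> Obj B"
      using a by (auto simp: F.B.hom_iff)
    define \<psi> where "\<psi> = (\<lambda>x. \<phi> x y)"
    have bij': "bij_betw (\<psi> x) (hom B (FO F x) y) (hom A x (FO G y))" if "x \<in> Obj A" for x
      using bij[rule_format, OF that y] by (simp add: \<psi>_def)
    have nat': "\<psi> (Dom A h) (u \<bullet>\<^bsub>B\<^esub> FA F h) = \<psi> (Cod A h) u \<bullet>\<^bsub>A\<^esub> h"
      if "h \<in> Arr A" "u \<in> hom B (FO F (Cod A h)) y" for h u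
      unfolding \<psi>_def by (rule nat[rule_format]) (use that y in \<open>auto simp: F.A.hom_iff\<close>)
    have inj: "u = v" if "\<psi> x u = \<psi> x v" "x \<in> Obj A" "u \<in> hom B (FO F x) y" "v \<in> hom B (FO F x) y" for x u v
      using bij'[of x] that by (auto simp: bij_betw_def dest: inj_onD)
    have \<psi>: "\<psi> x u \<in> hom A x (FO G y)" if "x \<in> Obj A" "u \<in> hom B (FO F x) y" for x u
      using bij'[of x] that by (meson bij_betwE)
    let ?P = "\<lambda>h. h \<in> hom A (Cod A i) (FO G y) \<and> h \<bullet>\<^bsub>A\<^esub> i = \<psi> (Cod A f) a \<and> h \<bullet>\<^bsub>A\<^esub> k = \<psi> (Cod A g) b"
    let ?Q = "\<lambda>h. h \<in> hom B (FO F (Cod A i)) y \<and> h \<bullet>\<^bsub>B\<^esub> FA F i = a \<and> h \<bullet>\<^bsub>B\<^esub> FA F k = b"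
    have "\<psi> (Cod A f) a \<bullet>\<^bsub>A\<^esub> f = \<psi> (Cod A g) b \<bullet>\<^bsub>A\<^esub> g"
      using nat'[of f a] nat'[of g b] a b d ab by simp
    moreover have "\<psi> (Cod A f) a \<in> hom A (Cod A f) (FO G y)" "\<psi> (Cod A g) b \<in> hom A (Cod A g) (FO G y)"
      using \<psi> a b d by auto
    ultimately have ex1: "\<exists>!h. ?P h"
      using po unfolding is_pushout_def by blast
    have PQ: "?P (\<psi> (Cod A i) h) \<longleftrightarrow> ?Q h" if h: "h \<in> hom B (FO F (Cod A i)) y" for h
    proof -
      have hi: "h \<bullet>\<^bsub>B\<^esub> FA F i \<in> hom B (FO F (Cod A f)) y" "h \<bullet>\<^bsub>B\<^esub> FA F k \<in> hom B (FO F (Cod A g)) y"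
        using h d F by (auto simp: F.B.hom_iff)
      have "\<psi> (Cod A f) (h \<bullet>\<^bsub>B\<^esub> FA F i) = \<psi> (Cod A i) h \<bullet>\<^bsub>A\<^esub> i"
        using nat'[of i h] h d by simp
      moreover have "\<psi> (Cod A g) (h \<bullet>\<^bsub>B\<^esub> FA F k) = \<psi> (Cod A i) h \<bullet>\<^bsub>A\<^esub> k"
        using nat'[of k h] h d by simp
      ultimately show ?thesis
        using inj[of "Cod A f" "h \<bullet>\<^bsub>B\<^esub> FA F i" a] inj[of "Cod A g" "h \<bullet>\<^bsub>B\<^esub> FA F k" b] hi a b h d
          \<psi>[of "Cod A i" h] by auto
    qed
    obtain h0 where h0: "?P h0"
      using ex1 by blast
    obtain h where h: "h \<in> hom B (FO F (Cod A i)) y" "h0 = \<psi> (Cod A i) h"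
      using bij'[of "Cod A i"] h0 d(3) unfolding bij_betw_def by (metis F.A.obj_simps(2) imageE)
    have "?Q h"
      using PQ[OF h(1)] h0 h(2) by simp
    moreover have "h' = h" if q: "?Q h'" for h'
    proof (rule inj[of "Cod A i"])
      show "\<psi> (Cod A i) h' = \<psi> (Cod A i) h"
        using ex1 PQ[of h'] q h0 h(2) by blast
    qed (use q h d in auto)
    ultimately show ?thesis
      by blast
  qed
  moreover have "FA F i \<in> hom B (FO F (Cod A f)) (FO F (Cod A i))" "FA F k \<in> hom B (FO F (Cod A g)) (FO F (Cod A i))"
    using d F by (simp_all add: F.B.hom_iff)
  ultimately show ?thesis
    unfolding is_pushout_def using d F comm by simp
qed

section \<open>Pushouts and pullbacks in a bicomplete category\<close>

text \<open>
  Five distinct elements \<open>a 0, \<dots>, a 4\<close> of the universe carry the shape \<open>1 \<leftarrow> 0 \<rightarrow> 2\<close>: the first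
  three are the objects and their own identities, the other two are the arrows out of \<open>a 0\<close>.
\<close>

definition span_shape :: "(nat \<Rightarrow> 'u) \<Rightarrow> ('u, 'u) category" where
  "span_shape a = \<lparr>Obj = {a 0, a 1, a 2}, Arr = {a 0, a 1, a 2, a 3, a 4},
    Dom = (\<lambda>u. if u = a 3 \<or> u = a 4 then a 0 else u),
    Cod = (\<lambda>u. if u = a 3 then a 1 else if u = a 4 then a 2 else u),
    Ide = (\<lambda>x. x),
    Comp = (\<lambda>v u. if v = a 3 \<or> v = a 4 then v else u)\<rparr>"

text \<open>
  For the span shape, reversing the arrows gives the cospan shape \<open>1 \<rightarrow> 0 \<leftarrow> 2\<close>, that of pullbacks.
\<close>

definition opposite :: "('o, 'a) category \<Rightarrow> ('o, 'a) category" where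
  "opposite J = \<lparr>Obj = Obj J, Arr = Arr J, Dom = Cod J, Cod = Dom J, Ide = Ide J, Comp = (\<lambda>g f. f \<bullet>\<^bsub>J\<^esub> g)\<rparr>"

text \<open>
  Both shapes have the same objects and arrows, so that one definition gives the diagrams of either: \<open>i0\<close>,
  \<open>i1\<close>, \<open>i2\<close> are meant to be the identities of \<open>x0\<close>, \<open>x1\<close>, \<open>x2\<close>.
\<close>

definition span_diagram :: "(nat \<Rightarrow> 'u) \<Rightarrow> 'a \<Rightarrow> 'a \<Rightarrow> 'a \<Rightarrow> 'a \<Rightarrow> 'a \<Rightarrow> 'o \<Rightarrow> 'o \<Rightarrow> 'o \<Rightarrow> ('u, 'u, 'o, 'a) func" where
  "span_diagram a i0 i1 i2 f g x0 x1 x2 =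
    \<lparr>FO = (\<lambda>x. if x = a 0 then x0 else if x = a 1 then x1 else x2),
     FA = (\<lambda>u. if u = a 0 then i0 else if u = a 1 then i1 else if u = a 2 then i2 else if u = a 3 then f else g)\<rparr>"

lemma span_shape_small:
  assumes "inj (a :: nat \<Rightarrow> 'u)"
  shows "small_category (span_shape a)" "small_category (opposite (span_shape a))"
proof -
  have d: "a i = a j \<longleftrightarrow> i = j" for i j
    using assms by (simp add: inj_eq)
  have inf: "infinite (UNIV :: 'u set)"
    using assms by (metis finite_imageD infinite_UNIV_nat finite_subset subset_UNIV)
  have "category (span_shape a)"
    by unfold_locales (auto simp: span_shape_def hom_def d split: if_splits)
  moreover have "category (opposite (span_shape a))"
    by unfold_locales (auto simp: opposite_def span_shape_def hom_def d split: if_splits)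
  moreover have "(card_of (Arr (span_shape a)), card_of (UNIV :: 'u set)) \<in> ordLess"
    by (rule finite_ordLess_infinite[OF card_of_Well_order card_of_Well_order])
      (simp_all add: Field_card_of span_shape_def inf)
  moreover have "(card_of (Arr (opposite (span_shape a))), card_of (UNIV :: 'u set)) \<in> ordLess"
    by (rule finite_ordLess_infinite[OF card_of_Well_order card_of_Well_order])
      (simp_all add: Field_card_of span_shape_def opposite_def inf)
  ultimately show "small_category (span_shape a)" "small_category (opposite (span_shape a))"
    by (auto simp: small_category_def)
qed

text \<open>
  A finite shape is small in the sense of any infinite universe, so the colimit of the diagram
  \<open>Cod f \<leftarrow> x \<rightarrow> Cod g\<close> exists. The coprojection of a cocone at \<open>a 0\<close> is determined by either of the
  other two, so cocones are the same as commuting squares.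
\<close>

lemma bicomplete_has_pushouts:
  fixes C :: "('o, 'a, 'm) category_scheme"
  assumes inf: "infinite (UNIV :: 'u set)" and cat: "category C" and bi: "bicomplete TYPE('u) C"
    and f: "f \<in> Arr C" and g: "g \<in> Arr C" and fg: "Dom C f = Dom C g"
  shows "\<exists>i k. is_pushout C f g i k"
proof -
  interpret category C
    by (fact cat)
  obtain a :: "nat \<Rightarrow> 'u" where a: "inj a"
    using inf infinite_countable_subset by blast
  then have d: "a i = a j \<longleftrightarrow> i = j" for i j
    by (simp add: inj_eq)
  let ?J = "span_shape a"
  let ?D = "span_diagram a (Ide C (Dom C f)) (Ide C (Cod C f)) (Ide C (Cod C g)) f g (Dom C f) (Cod C f) (Cod C g)"
  note defs = span_shape_def span_diagram_def
  have J: "small_category ?J"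
    by (rule span_shape_small[OF a])
  have "cat_functor ?J C ?D"
  proof (rule cat_functor.intro)
    show "category ?J"
      using J by (simp add: small_category_def)
    show "cat_functor_axioms ?J C ?D"
      by unfold_locales (use f g fg in \<open>auto simp: defs hom_def d split: if_splits\<close>)
  qed (fact cat)
  then obtain x \<iota> where l: "is_colimit ?J C ?D x \<iota>"
    using bi J unfolding bicomplete_def by blast
  then have "is_cocone ?J C ?D x \<iota>"
    by (simp add: is_colimit_def)
  then have \<iota>: "x \<in> Obj C" "\<iota> (a 0) \<in> hom C (Dom C f) x" "\<iota> (a 1) \<in> hom C (Cod C f) x" "\<iota> (a 2) \<in> hom C (Cod C g) x"
    "\<iota> (a 1) \<bullet>\<^bsub>C\<^esub> f = \<iota> (a 0)" "\<iota> (a 2) \<bullet>\<^bsub>C\<^esub> g = \<iota> (a 0)"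
    by (auto simp: is_cocone_def defs d)
  have "\<exists>!h. h \<in> hom C x y \<and> h \<bullet>\<^bsub>C\<^esub> \<iota> (a 1) = s \<and> h \<bullet>\<^bsub>C\<^esub> \<iota> (a 2) = t"
    if s: "s \<in> hom C (Cod C f) y" and t: "t \<in> hom C (Cod C g) y" and st: "s \<bullet>\<^bsub>C\<^esub> f = t \<bullet>\<^bsub>C\<^esub> g" for y s t
  proof -
    define \<rho> where "\<rho> u = (if u = a 0 then s \<bullet>\<^bsub>C\<^esub> f else if u = a 1 then s else t)" for u
    have "y \<in> Obj C"
      using s by (auto simp: hom_iff)
    then have "is_cocone ?J C ?D y \<rho>"
      using s t st f g fg by (auto simp: is_cocone_def defs d \<rho>_def hom_iff)
    then have "\<exists>!h. h \<in> hom C x y \<and> (\<forall>j\<in>Obj ?J. h \<bullet>\<^bsub>C\<^esub> \<iota> j = \<rho> j)"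
      using l by (simp add: is_colimit_def)
    moreover have "(h \<in> hom C x y \<and> (\<forall>j\<in>Obj ?J. h \<bullet>\<^bsub>C\<^esub> \<iota> j = \<rho> j)) \<longleftrightarrow>
      (h \<in> hom C x y \<and> h \<bullet>\<^bsub>C\<^esub> \<iota> (a 1) = s \<and> h \<bullet>\<^bsub>C\<^esub> \<iota> (a 2) = t)" for h
    proof -
      have "h \<bullet>\<^bsub>C\<^esub> \<iota> (a 0) = s \<bullet>\<^bsub>C\<^esub> f" if h: "h \<in> hom C x y" "h \<bullet>\<^bsub>C\<^esub> \<iota> (a 1) = s"
      proof -
        have "(h \<bullet>\<^bsub>C\<^esub> \<iota> (a 1)) \<bullet>\<^bsub>C\<^esub> f = h \<bullet>\<^bsub>C\<^esub> (\<iota> (a 1) \<bullet>\<^bsub>C\<^esub> f)"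
          by (rule comp_assoc) (use h \<iota> f in \<open>auto simp: hom_iff\<close>)
        then show ?thesis
          by (simp only: \<iota>(5) h(2))
      qed
      then show ?thesis
        by (auto simp: span_shape_def \<rho>_def d)
    qed
    ultimately show ?thesis
      by simp
  qed
  moreover have "Cod C (\<iota> (a 1)) = x"
    using \<iota> by (simp add: hom_iff)
  ultimately have "is_pushout C f g (\<iota> (a 1)) (\<iota> (a 2))"
    unfolding is_pushout_def using f g fg \<iota> by metis
  then show ?thesis
    by blast
qed

lemma bicomplete_has_pullbacks:
  fixes C :: "('o, 'a, 'm) category_scheme"
  assumes inf: "infinite (UNIV :: 'u set)" and cat: "category C" and bi: "bicomplete TYPE('u) C"
    and f: "f \<in> Arr C" and g: "g \<in> Arr C" and fg: "Cod C f = Cod C g"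
  shows "\<exists>i k. is_pullback C f g i k"
proof -
  interpret category C
    by (fact cat)
  obtain a :: "nat \<Rightarrow> 'u" where a: "inj a"
    using inf infinite_countable_subset by blast
  then have d: "a i = a j \<longleftrightarrow> i = j" for i j
    by (simp add: inj_eq)
  let ?J = "opposite (span_shape a)"
  let ?D = "span_diagram a (Ide C (Cod C f)) (Ide C (Dom C f)) (Ide C (Dom C g)) f g (Cod C f) (Dom C f) (Dom C g)"
  note defs = span_shape_def opposite_def span_diagram_def
  have J: "small_category ?J"
    by (rule span_shape_small[OF a])
  have "cat_functor ?J C ?D"
  proof (rule cat_functor.intro)
    show "category ?J"
      using J by (simp add: small_category_def)
    show "cat_functor_axioms ?J C ?D"
      by unfold_locales (use f g fg in \<open>auto simp: defs hom_def d split: if_splits\<close>)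
  qed (fact cat)
  then obtain x \<pi> where l: "is_limit ?J C ?D x \<pi>"
    using bi J unfolding bicomplete_def by blast
  then have "is_cone ?J C ?D x \<pi>"
    by (simp add: is_limit_def)
  then have \<pi>: "x \<in> Obj C" "\<pi> (a 0) \<in> hom C x (Cod C f)" "\<pi> (a 1) \<in> hom C x (Dom C f)" "\<pi> (a 2) \<in> hom C x (Dom C g)"
    "f \<bullet>\<^bsub>C\<^esub> \<pi> (a 1) = \<pi> (a 0)" "g \<bullet>\<^bsub>C\<^esub> \<pi> (a 2) = \<pi> (a 0)"
    by (auto simp: is_cone_def defs d)
  have "\<exists>!h. h \<in> hom C y x \<and> \<pi> (a 1) \<bullet>\<^bsub>C\<^esub> h = s \<and> \<pi> (a 2) \<bullet>\<^bsub>C\<^esub> h = t"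
    if s: "s \<in> hom C y (Dom C f)" and t: "t \<in> hom C y (Dom C g)" and st: "f \<bullet>\<^bsub>C\<^esub> s = g \<bullet>\<^bsub>C\<^esub> t" for y s t
  proof -
    define \<rho> where "\<rho> u = (if u = a 0 then f \<bullet>\<^bsub>C\<^esub> s else if u = a 1 then s else t)" for u
    have "y \<in> Obj C"
      using s by (auto simp: hom_iff)
    then have "is_cone ?J C ?D y \<rho>"
      using s t st f g fg by (auto simp: is_cone_def defs d \<rho>_def hom_iff)
    then have "\<exists>!h. h \<in> hom C y x \<and> (\<forall>j\<in>Obj ?J. \<pi> j \<bullet>\<^bsub>C\<^esub> h = \<rho> j)"
      using l by (simp add: is_limit_def)
    moreover have "(h \<in> hom C y x \<and> (\<forall>j\<in>Obj ?J. \<pi> j \<bullet>\<^bsub>C\<^esub> h = \<rho> j)) \<longleftrightarrow>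
      (h \<in> hom C y x \<and> \<pi> (a 1) \<bullet>\<^bsub>C\<^esub> h = s \<and> \<pi> (a 2) \<bullet>\<^bsub>C\<^esub> h = t)" for h
    proof -
      have "\<pi> (a 0) \<bullet>\<^bsub>C\<^esub> h = f \<bullet>\<^bsub>C\<^esub> s" if h: "h \<in> hom C y x" "\<pi> (a 1) \<bullet>\<^bsub>C\<^esub> h = s"
      proof -
        have "(f \<bullet>\<^bsub>C\<^esub> \<pi> (a 1)) \<bullet>\<^bsub>C\<^esub> h = f \<bullet>\<^bsub>C\<^esub> (\<pi> (a 1) \<bullet>\<^bsub>C\<^esub> h)"
          by (rule comp_assoc) (use h \<pi> f in \<open>auto simp: hom_iff\<close>)
        then show ?thesis
          by (simp only: \<pi>(5) h(2))
      qed
      then show ?thesis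
        by (auto simp: span_shape_def opposite_def \<rho>_def d)
    qed
    ultimately show ?thesis
      by simp
  qed
  moreover have "Dom C (\<pi> (a 1)) = x"
    using \<pi> by (simp add: hom_iff)
  ultimately have "is_pullback C f g (\<pi> (a 1)) (\<pi> (a 2))"
    unfolding is_pullback_def using f g fg \<pi> by metis
  then show ?thesis
    by blast
qed

section \<open>Categories with a tensor product bifunctor\<close>

text \<open>
  The functoriality of the product is what makes monoids and modules, with their morphisms, into
  categories: composites and identities of structure-preserving arrows preserve the structure.
\<close>

locale tensor_category = category C
  for C :: "('o, 'a, 'm) monoidal_scheme" (structure) +
  assumes tensor_obj: "\<lbrakk>x \<in> Obj C; y \<in> Obj C\<rbrakk> \<Longrightarrow> x \<otimes> y \<in> Obj C"
    and tensor_hom: "\<lbrakk>f \<in> hom C x y; g \<in> hom C x' y'\<rbrakk> \<Longrightarrow> f \<star> g \<in> hom C (x \<otimes> x') (y \<otimes> y')"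
    and tensor_Ide: "\<lbrakk>x \<in> Obj C; y \<in> Obj C\<rbrakk> \<Longrightarrow> Ide C x \<star> Ide C y = Ide C (x \<otimes> y)"
    and tensor_comp: "\<lbrakk>f \<in> hom C x y; g \<in> hom C y z; f' \<in> hom C x' y'; g' \<in> hom C y' z'\<rbrakk>
      \<Longrightarrow> (g \<bullet> f) \<star> (g' \<bullet> f') = (g \<star> g') \<bullet> (f \<star> f')"
begin

lemma tensor_simps [simp]:
  "\<lbrakk>x \<in> Obj C; y \<in> Obj C\<rbrakk> \<Longrightarrow> x \<otimes> y \<in> Obj C"
  "\<lbrakk>f \<in> Arr C; g \<in> Arr C\<rbrakk> \<Longrightarrow> f \<star> g \<in> Arr C"
  "\<lbrakk>f \<in> Arr C; g \<in> Arr C\<rbrakk> \<Longrightarrow> Dom C (f \<star> g) = Dom C f \<otimes> Dom C g"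
  "\<lbrakk>f \<in> Arr C; g \<in> Arr C\<rbrakk> \<Longrightarrow> Cod C (f \<star> g) = Cod C f \<otimes> Cod C g"
  "\<lbrakk>x \<in> Obj C; y \<in> Obj C\<rbrakk> \<Longrightarrow> Ide C x \<star> Ide C y = Ide C (x \<otimes> y)"
  using tensor_hom[of f "Dom C f" "Cod C f" g "Dom C g" "Cod C g"]
  by (auto simp: hom_iff tensor_obj tensor_Ide)

lemma interchange [simp]:
  "\<lbrakk>f \<in> Arr C; g \<in> Arr C; f' \<in> Arr C; g' \<in> Arr C; Dom C g = Cod C f; Dom C g' = Cod C f'\<rbrakk>
    \<Longrightarrow> (g \<star> g') \<bullet> (f \<star> f') = (g \<bullet> f) \<star> (g' \<bullet> f')"
  by (rule tensor_comp[symmetric]) (auto simp: hom_iff)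

lemma interchange_chain [simp]:
  "\<lbrakk>f \<in> Arr C; g \<in> Arr C; f' \<in> Arr C; g' \<in> Arr C; Dom C g = Cod C f; Dom C g' = Cod C f';
    k \<in> Arr C; Cod C k = Dom C f \<otimes> Dom C f'\<rbrakk>
    \<Longrightarrow> (g \<star> g') \<bullet> ((f \<star> f') \<bullet> k) = ((g \<bullet> f) \<star> (g' \<bullet> f')) \<bullet> k"
  using comp_assoc_right[of k "f \<star> f'" "g \<star> g'"] by simp

lemma category_Mon: "category (Mon C)"
proof unfold_locales
  fix x
  assume "x \<in> Obj (Mon C)"
  then show "Ide (Mon C) x \<in> hom (Mon C) x x"
    by (auto simp: Mon_def hom_def is_monoid_hom_def is_monoid_def hom_iff[unfolded hom_def])
next
  fix f g x y z
  assume "f \<in> hom (Mon C) x y" "g \<in> hom (Mon C) y z"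
  then obtain s t where f: "f = Mor x y s" "is_monoid_hom C x y s" and g: "g = Mor y z t" "is_monoid_hom C y z t"
    by (auto simp: Mon_def hom_def)
  have st: "s \<in> Arr C" "Dom C s = mon_ob x" "Cod C s = mon_ob y" "t \<in> Arr C" "Dom C t = mon_ob y" "Cod C t = mon_ob z"
    and x: "mult x \<in> Arr C" "Dom C (mult x) = mon_ob x \<otimes> mon_ob x" "Cod C (mult x) = mon_ob x"
      "unit x \<in> Arr C" "Cod C (unit x) = mon_ob x" "is_monoid C x"
    and y: "mult y \<in> Arr C" "Dom C (mult y) = mon_ob y \<otimes> mon_ob y" "Cod C (mult y) = mon_ob y"
    and z: "mult z \<in> Arr C" "Dom C (mult z) = mon_ob z \<otimes> mon_ob z" "is_monoid C z"
    and eq: "s \<bullet> mult x = mult y \<bullet> (s \<star> s)" "t \<bullet> mult y = mult z \<bullet> (t \<star> t)" "s \<bullet> unit x = unit y" "t \<bullet> unit y = unit z"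
    using f(2) g(2) by (auto simp: is_monoid_hom_def is_monoid_def hom_iff)
  have "(t \<bullet> s) \<bullet> mult x = (t \<bullet> mult y) \<bullet> (s \<star> s)"
    using st x y eq(1) by simp
  also have "\<dots> = mult z \<bullet> ((t \<bullet> s) \<star> (t \<bullet> s))"
    unfolding eq(2) using st z by simp
  finally have "is_monoid_hom C x z (t \<bullet> s)"
    using st x y z eq by (simp add: is_monoid_hom_def hom_iff)
  then show "g \<bullet>\<^bsub>Mon C\<^esub> f \<in> hom (Mon C) x z"
    by (auto simp: Mon_def hom_def f g)
next
  fix w x y z f g h
  assume "f \<in> hom (Mon C) w x" "g \<in> hom (Mon C) x y" "h \<in> hom (Mon C) y z"
  then show "(h \<bullet>\<^bsub>Mon C\<^esub> g) \<bullet>\<^bsub>Mon C\<^esub> f = h \<bullet>\<^bsub>Mon C\<^esub> g \<bullet>\<^bsub>Mon C\<^esub> f"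
    by (auto simp: Mon_def hom_def is_monoid_hom_def)
qed (auto simp: Mon_def hom_def is_monoid_hom_def)

lemma category_Mod:
  assumes A: "mon_ob A \<in> Obj C"
  shows "category (Mod C A)"
proof unfold_locales
  fix x
  assume "x \<in> Obj (Mod C A)"
  then show "Ide (Mod C A) x \<in> hom (Mod C A) x x"
    using A by (auto simp: Mod_def hom_def is_module_hom_def is_module_def hom_iff[unfolded hom_def])
next
  fix f g x y z
  assume "f \<in> hom (Mod C A) x y" "g \<in> hom (Mod C A) y z"
  then obtain s t where f: "f = Mor x y s" "is_module_hom C A x y s" and g: "g = Mor y z t" "is_module_hom C A y z t"
    by (auto simp: Mod_def hom_def)
  have st: "s \<in> Arr C" "Dom C s = mod_ob x" "Cod C s = mod_ob y" "t \<in> Arr C" "Dom C t = mod_ob y" "Cod C t = mod_ob z"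
    and x: "act x \<in> Arr C" "Dom C (act x) = mon_ob A \<otimes> mod_ob x" "Cod C (act x) = mod_ob x" "is_module C A x"
    and y: "act y \<in> Arr C" "Dom C (act y) = mon_ob A \<otimes> mod_ob y" "Cod C (act y) = mod_ob y"
    and z: "act z \<in> Arr C" "Dom C (act z) = mon_ob A \<otimes> mod_ob z" "is_module C A z"
    and eq: "s \<bullet> act x = act y \<bullet> (Ide C (mon_ob A) \<star> s)" "t \<bullet> act y = act z \<bullet> (Ide C (mon_ob A) \<star> t)"
    using f(2) g(2) by (auto simp: is_module_hom_def is_module_def hom_iff)
  have "(t \<bullet> s) \<bullet> act x = (t \<bullet> act y) \<bullet> (Ide C (mon_ob A) \<star> s)"
    using st x y A eq(1) by simp
  also have "\<dots> = act z \<bullet> (Ide C (mon_ob A) \<star> (t \<bullet> s))"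
    unfolding eq(2) using st z A by simp
  finally have "is_module_hom C A x z (t \<bullet> s)"
    using st x z by (simp add: is_module_hom_def hom_iff)
  then show "g \<bullet>\<^bsub>Mod C A\<^esub> f \<in> hom (Mod C A) x z"
    by (auto simp: Mod_def hom_def f g)
next
  fix w x y z f g h
  assume "f \<in> hom (Mod C A) w x" "g \<in> hom (Mod C A) x y" "h \<in> hom (Mod C A) y z"
  then show "(h \<bullet>\<^bsub>Mod C A\<^esub> g) \<bullet>\<^bsub>Mod C A\<^esub> f = h \<bullet>\<^bsub>Mod C A\<^esub> g \<bullet>\<^bsub>Mod C A\<^esub> f"
    by (auto simp: Mod_def hom_def is_module_hom_def)
qed (auto simp: Mod_def hom_def is_module_hom_def)

end

sublocale monoidal_category \<subseteq> tensor_category C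
  by unfold_locales (fact tensO_closed tensA_hom tens_ide tens_comp)+

context monoidal_category
begin

lemma unit_simps [simp]: "unit_ob C \<in> Obj C"
  by (rule unit_closed)

lemma assoc_simps [simp]:
  assumes "x \<in> Obj C" "y \<in> Obj C" "z \<in> Obj C"
  shows "assoc C x y z \<in> Arr C" "Dom C (assoc C x y z) = (x \<otimes> y) \<otimes> z" "Cod C (assoc C x y z) = x \<otimes> (y \<otimes> z)"
  using assoc_hom[OF assms] by (auto simp: hom_iff)

lemma lunit_simps [simp]:
  assumes "x \<in> Obj C"
  shows "lunit C x \<in> Arr C" "Dom C (lunit C x) = unit_ob C \<otimes> x" "Cod C (lunit C x) = x"
  using lunit_hom[OF assms] by (auto simp: hom_iff)

lemma runit_simps [simp]:
  assumes "x \<in> Obj C"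
  shows "runit C x \<in> Arr C" "Dom C (runit C x) = x \<otimes> unit_ob C" "Cod C (runit C x) = x"
  using runit_hom[OF assms] by (auto simp: hom_iff)

lemma assoc_nat:
  assumes "f \<in> Arr C" "g \<in> Arr C" "h \<in> Arr C"
  shows "assoc C (Cod C f) (Cod C g) (Cod C h) \<bullet> ((f \<star> g) \<star> h) = (f \<star> (g \<star> h)) \<bullet> assoc C (Dom C f) (Dom C g) (Dom C h)"
  by (rule assoc_natural) (use assms in \<open>auto simp: hom_iff\<close>)

end

section \<open>Zero maps, cokernels and kernels\<close>

locale pointed_category = category C
  for C :: "('o, 'a, 'm) category_scheme" (structure) +
  assumes pointed: "pointed C"
    and pushouts: "\<lbrakk>f \<in> Arr C; g \<in> Arr C; Dom C f = Dom C g\<rbrakk> \<Longrightarrow> \<exists>i k. is_pushout C f g i k"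
    and pullbacks: "\<lbrakk>f \<in> Arr C; g \<in> Arr C; Cod C f = Cod C g\<rbrakk> \<Longrightarrow> \<exists>i k. is_pullback C f g i k"
begin

lemma zero_initial: "is_initial C (zero_ob C)"
  using pointed unfolding pointed_def zero_ob_def by (metis someI_ex)

text \<open>
  Some object is both initial and terminal, and the chosen initial object is isomorphic to it.
\<close>

lemma zero_terminal: "is_terminal C (zero_ob C)"
proof -
  obtain z where z: "is_initial C z" "is_terminal C z"
    using pointed by (auto simp: pointed_def)
  have o: "z \<in> Obj C" "zero_ob C \<in> Obj C"
    using z zero_initial by (auto simp: is_initial_def)
  obtain u where u: "u \<in> Arr C" "Dom C u = zero_ob C" "Cod C u = z"
    using zero_initial o unfolding is_initial_def hom_iff by metis
  obtain v where v: "v \<in> Arr C" "Dom C v = z" "Cod C v = zero_ob C"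
    using z o unfolding is_initial_def hom_iff by metis
  have vu: "v \<bullet> u = Ide C (zero_ob C)"
    by (rule initial_arr_eq[OF zero_initial]) (use u v o in auto)
  have "\<exists>!f. f \<in> hom C x (zero_ob C)" if x: "x \<in> Obj C" for x
  proof -
    obtain t where t: "t \<in> Arr C" "Dom C t = x" "Cod C t = z"
      using z x unfolding is_terminal_def hom_iff by metis
    have "f = g" if "f \<in> hom C x (zero_ob C)" "g \<in> hom C x (zero_ob C)" for f g
    proof -
      have "u \<bullet> f = u \<bullet> g"
        by (rule terminal_arr_eq[OF z(2)]) (use that u in \<open>auto simp: hom_iff\<close>)
      then have "(v \<bullet> u) \<bullet> f = (v \<bullet> u) \<bullet> g"
        using that u v by (simp add: hom_iff)
      then show ?thesis
        unfolding vu using that by (auto simp: hom_iff)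
    qed
    moreover have "v \<bullet> t \<in> hom C x (zero_ob C)"
      using t v by (simp add: hom_iff)
    ultimately show ?thesis
      by blast
  qed
  then show ?thesis
    using o by (simp add: is_terminal_def)
qed

lemma zero_obj [simp]: "zero_ob C \<in> Obj C"
  using zero_initial by (simp add: is_initial_def)

lemma from_zero_simps [simp]:
  assumes "x \<in> Obj C"
  shows "from_zero C x \<in> Arr C" "Dom C (from_zero C x) = zero_ob C" "Cod C (from_zero C x) = x"
proof -
  have "\<exists>!f. f \<in> hom C (zero_ob C) x"
    using zero_initial assms by (simp add: is_initial_def)
  then have "from_zero C x \<in> hom C (zero_ob C) x"
    unfolding from_zero_def by (rule theI')
  then show "from_zero C x \<in> Arr C" "Dom C (from_zero C x) = zero_ob C" "Cod C (from_zero C x) = x"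
    by (auto simp: hom_iff)
qed

lemma to_zero_simps [simp]:
  assumes "x \<in> Obj C"
  shows "to_zero C x \<in> Arr C" "Dom C (to_zero C x) = x" "Cod C (to_zero C x) = zero_ob C"
proof -
  have "\<exists>!f. f \<in> hom C x (zero_ob C)"
    using zero_terminal assms by (simp add: is_terminal_def)
  then have "to_zero C x \<in> hom C x (zero_ob C)"
    unfolding to_zero_def by (rule theI')
  then show "to_zero C x \<in> Arr C" "Dom C (to_zero C x) = x" "Cod C (to_zero C x) = zero_ob C"
    by (auto simp: hom_iff)
qed

lemmas from_zero_eq = initial_arr_eq[OF zero_initial]
lemmas to_zero_eq = terminal_arr_eq[OF zero_terminal]

definition zero_map :: "'o \<Rightarrow> 'o \<Rightarrow> 'a" where
  "zero_map x y = from_zero C y \<bullet> to_zero C x"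

lemma zero_map_simps [simp]:
  assumes "x \<in> Obj C" "y \<in> Obj C"
  shows "zero_map x y \<in> Arr C" "Dom C (zero_map x y) = x" "Cod C (zero_map x y) = y"
  using assms by (auto simp: zero_map_def)

lemma comp_from_zero: "\<lbrakk>f \<in> Arr C; y = Dom C f\<rbrakk> \<Longrightarrow> f \<bullet> from_zero C y = from_zero C (Cod C f)"
  by (rule from_zero_eq) auto

lemma to_zero_comp: "\<lbrakk>f \<in> Arr C; y = Cod C f\<rbrakk> \<Longrightarrow> to_zero C y \<bullet> f = to_zero C (Dom C f)"
  by (rule to_zero_eq) auto

lemma comp_zero [simp]:
  assumes "f \<in> Arr C" "x \<in> Obj C" "y = Dom C f"
  shows "f \<bullet> zero_map x y = zero_map x (Cod C f)"
proof -
  have "f \<bullet> (from_zero C y \<bullet> to_zero C x) = (f \<bullet> from_zero C y) \<bullet> to_zero C x"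
    by (rule comp_assoc_right[symmetric]) (use assms in auto)
  then show ?thesis
    using assms by (simp only: zero_map_def comp_from_zero)
qed

lemma zero_comp [simp]:
  assumes "f \<in> Arr C" "y \<in> Obj C" "x = Cod C f"
  shows "zero_map x y \<bullet> f = zero_map (Dom C f) y"
  using assms by (simp add: zero_map_def to_zero_comp)

definition is_cokernel :: "'a \<Rightarrow> 'a \<Rightarrow> bool" where
  "is_cokernel f q \<longleftrightarrow> is_pushout C (to_zero C (Dom C f)) f (from_zero C (Cod C q)) q"

lemma is_cokernelD:
  assumes "is_cokernel f q"
  shows "f \<in> Arr C" "q \<in> Arr C" "Dom C q = Cod C f" "q \<bullet> f = zero_map (Dom C f) (Cod C q)"
  using is_pushoutD[OF assms[unfolded is_cokernel_def]] by (auto simp: zero_map_def)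

text \<open>
  The component of a cocone at the zero object carries no information, so a map out of the cokernel is
  determined by its composite with \<open>q\<close>.
\<close>

lemma cokernel_epi:
  assumes "is_cokernel f q"
  shows "is_epi C q"
  unfolding is_epi_def
proof (intro conjI ballI impI)
  note d = is_cokernelD[OF assms]
  show "q \<in> Arr C"
    by (fact d)
  fix a b
  assume ab: "a \<in> Arr C" "b \<in> Arr C" "Dom C a = Cod C q" "Dom C b = Cod C q" "a \<bullet> q = b \<bullet> q"
  then have "Cod C a = Cod C b"
    using d by (metis comp_simps(3))
  show "a = b"
    by (rule is_pushout_arr_eq[OF assms[unfolded is_cokernel_def]]) (use \<open>Cod C a = Cod C b\<close> ab d in \<open>auto simp: comp_from_zero\<close>)
qed

lemma lift_coker_simps:
  assumes q: "is_cokernel f q" and a: "a \<in> Arr C" "Dom C a = Cod C f" "a \<bullet> f = zero_map (Dom C f) (Cod C a)"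
  shows "lift_coker C q a \<in> Arr C" "Dom C (lift_coker C q a) = Cod C q" "Cod C (lift_coker C q a) = Cod C a"
    "lift_coker C q a \<bullet> q = a"
proof -
  note d = is_cokernelD[OF q]
  have "\<exists>!h. h \<in> hom C (Cod C (from_zero C (Cod C q))) (Cod C (from_zero C (Cod C a)))
      \<and> h \<bullet> from_zero C (Cod C q) = from_zero C (Cod C a) \<and> h \<bullet> q = a"
    by (rule is_pushout_ex1[OF q[unfolded is_cokernel_def]]) (use a d in \<open>auto simp: zero_map_def\<close>)
  then obtain w where w: "w \<in> hom C (Cod C q) (Cod C a)" "w \<bullet> q = a"
    using a d by auto
  have "\<exists>!w. w \<in> hom C (Cod C q) (Cod C a) \<and> w \<bullet> q = a"
    using w epiD[OF cokernel_epi[OF q]] by (intro ex1I[of _ w]) (auto simp: hom_iff)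
  then have "lift_coker C q a \<in> hom C (Cod C q) (Cod C a) \<and> lift_coker C q a \<bullet> q = a"
    unfolding lift_coker_def by (rule theI')
  then show "lift_coker C q a \<in> Arr C" "Dom C (lift_coker C q a) = Cod C q" "Cod C (lift_coker C q a) = Cod C a"
    "lift_coker C q a \<bullet> q = a"
    by (auto simp: hom_iff)
qed

lemma is_cokernelI:
  assumes "f \<in> Arr C" "is_epi C q" "Dom C q = Cod C f" "q \<bullet> f = zero_map (Dom C f) (Cod C q)"
    and ex: "\<And>a. \<lbrakk>a \<in> Arr C; Dom C a = Cod C f; a \<bullet> f = zero_map (Dom C f) (Cod C a)\<rbrakk>
      \<Longrightarrow> \<exists>w \<in> Arr C. Dom C w = Cod C q \<and> w \<bullet> q = a"
  shows "is_cokernel f q"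
  unfolding is_cokernel_def
proof (rule is_pushoutI)
  have q: "q \<in> Arr C"
    using assms(2) by (simp add: is_epi_def)
  fix a b
  assume ab: "a \<in> Arr C" "b \<in> Arr C" "Dom C a = Cod C (to_zero C (Dom C f))" "Dom C b = Cod C f"
    "Cod C b = Cod C a" "a \<bullet> to_zero C (Dom C f) = b \<bullet> f"
  have "a = from_zero C (Cod C b)"
    by (rule from_zero_eq) (use ab assms(1) in auto)
  then have "b \<bullet> f = zero_map (Dom C f) (Cod C b)"
    using ab by (simp add: zero_map_def)
  then obtain w where w: "w \<in> Arr C" "Dom C w = Cod C q" "w \<bullet> q = b"
    using ex[of b] ab by auto
  moreover have "w \<bullet> from_zero C (Cod C q) = a"
    by (rule from_zero_eq) (use w q ab assms(1) in auto)
  ultimately show "\<exists>h\<in>Arr C. Dom C h = Cod C (from_zero C (Cod C q)) \<and> h \<bullet> from_zero C (Cod C q) = a \<and> h \<bullet> q = b"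
    using q by auto
next
  fix h h'
  assume h: "h \<in> Arr C" "h' \<in> Arr C" "Dom C h = Cod C (from_zero C (Cod C q))" "Dom C h' = Cod C (from_zero C (Cod C q))"
    "h \<bullet> q = h' \<bullet> q"
  show "h = h'"
    by (rule epiD[OF assms(2)]) (use h assms(2) in \<open>auto simp: is_epi_def\<close>)
qed (use assms in \<open>auto simp: is_epi_def zero_map_def\<close>)

lemma coker_cokernel:
  assumes "f \<in> Arr C"
  shows "is_cokernel f (coker C f)"
proof -
  let ?t = "to_zero C (Dom C f)"
  have "\<exists>i k. is_pushout C ?t f i k"
    using assms by (intro pushouts) auto
  then have "\<exists>p. case p of (i, k) \<Rightarrow> is_pushout C ?t f i k"
    by auto
  then have "case pushout C ?t f of (i, k) \<Rightarrow> is_pushout C ?t f i k"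
    unfolding pushout_def by (rule someI_ex)
  then have po: "is_pushout C ?t f (fst (pushout C ?t f)) (coker C f)"
    by (auto simp: coker_def split: prod.splits)
  note d = is_pushoutD[OF po]
  have "fst (pushout C ?t f) = from_zero C (Cod C (coker C f))"
    by (rule from_zero_eq) (use d assms in auto)
  then show ?thesis
    using po by (simp add: is_cokernel_def)
qed

lemmas coker_epi = cokernel_epi[OF coker_cokernel]

lemma coker_simps [simp]:
  assumes "f \<in> Arr C"
  shows "coker C f \<in> Arr C" "Dom C (coker C f) = Cod C f" "coker C f \<bullet> f = zero_map (Dom C f) (Cod C (coker C f))"
  using is_cokernelD[OF coker_cokernel[OF assms]] by auto

lemma is_pullbackD:
  assumes "is_pullback C f g i k"
  shows "f \<in> Arr C" "g \<in> Arr C" "i \<in> Arr C" "k \<in> Arr C" "Cod C g = Cod C f"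
    "Cod C i = Dom C f" "Cod C k = Dom C g" "Dom C k = Dom C i" "f \<bullet> i = g \<bullet> k"
  using assms by (auto simp: is_pullback_def hom_def)

lemma is_pullback_ex1:
  assumes "is_pullback C f g i k" "a \<in> Arr C" "b \<in> Arr C" "Cod C a = Dom C f" "Cod C b = Dom C g"
    "Dom C a = Dom C b" "f \<bullet> a = g \<bullet> b"
  shows "\<exists>!h. h \<in> hom C (Dom C b) (Dom C i) \<and> i \<bullet> h = a \<and> k \<bullet> h = b"
proof -
  have "a \<in> hom C (Dom C b) (Dom C f)" "b \<in> hom C (Dom C b) (Dom C g)"
    using assms by (auto simp: hom_def)
  then show ?thesis
    using assms(1,7) unfolding is_pullback_def by blast
qed

lemma ker_pullback:
  assumes "p \<in> Arr C"
  shows "is_pullback C (from_zero C (Cod C p)) p (to_zero C (Dom C (ker C p))) (ker C p)"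
proof -
  let ?t = "from_zero C (Cod C p)"
  have "\<exists>i k. is_pullback C ?t p i k"
    using assms by (intro pullbacks) auto
  then have "\<exists>x. case x of (i, k) \<Rightarrow> is_pullback C ?t p i k"
    by auto
  then have "case pullback C ?t p of (i, k) \<Rightarrow> is_pullback C ?t p i k"
    unfolding pullback_def by (rule someI_ex)
  then have pb: "is_pullback C ?t p (fst (pullback C ?t p)) (ker C p)"
    by (auto simp: ker_def split: prod.splits)
  note d = is_pullbackD[OF pb]
  have "fst (pullback C ?t p) = to_zero C (Dom C (ker C p))"
    by (rule to_zero_eq) (use d assms in auto)
  then show ?thesis
    using pb by simp
qed

lemma ker_simps [simp]:
  assumes "p \<in> Arr C"
  shows "ker C p \<in> Arr C" "Cod C (ker C p) = Dom C p" "p \<bullet> ker C p = zero_map (Dom C (ker C p)) (Cod C p)"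
  using is_pullbackD[OF ker_pullback[OF assms]] by (auto simp: zero_map_def)

lemma ker_ex1:
  assumes p: "p \<in> Arr C" and a: "a \<in> Arr C" "Cod C a = Dom C p" "p \<bullet> a = zero_map (Dom C a) (Cod C p)"
  shows "\<exists>!w. w \<in> hom C (Dom C a) (Dom C (ker C p)) \<and> ker C p \<bullet> w = a"
proof -
  have "\<exists>!h. h \<in> hom C (Dom C a) (Dom C (to_zero C (Dom C (ker C p)))) \<and>
      to_zero C (Dom C (ker C p)) \<bullet> h = to_zero C (Dom C a) \<and> ker C p \<bullet> h = a"
    by (rule is_pullback_ex1[OF ker_pullback[OF p]]) (use a p in \<open>auto simp: zero_map_def\<close>)
  moreover have "to_zero C (Dom C (ker C p)) \<bullet> h = to_zero C (Dom C a)" if "h \<in> hom C (Dom C a) (Dom C (ker C p))" for h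
    using that p a by (auto simp: hom_iff to_zero_comp)
  moreover have "Dom C (to_zero C (Dom C (ker C p))) = Dom C (ker C p)"
    using p by simp
  ultimately show ?thesis
    by metis
qed

lemma ker_mono:
  assumes p: "p \<in> Arr C"
  shows "is_mono C (ker C p)"
  unfolding is_mono_def
proof (intro conjI ballI impI)
  show "ker C p \<in> Arr C"
    using p by simp
  fix a b
  assume ab: "a \<in> Arr C" "b \<in> Arr C" "Cod C a = Dom C (ker C p)" "Cod C b = Dom C (ker C p)"
    "ker C p \<bullet> a = ker C p \<bullet> b"
  have "Dom C (ker C p \<bullet> a) = Dom C a" "Dom C (ker C p \<bullet> b) = Dom C b"
    using ab(1-4) p by simp_all
  then have dd: "Dom C a = Dom C b"
    using ab(5) by simp
  have "p \<bullet> (ker C p \<bullet> a) = zero_map (Dom C a) (Cod C p)"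
    using ab(1-4) p comp_chain[OF ker_simps(3)[OF p], of a] by simp
  then have "\<exists>!w. w \<in> hom C (Dom C (ker C p \<bullet> a)) (Dom C (ker C p)) \<and> ker C p \<bullet> w = ker C p \<bullet> a"
    using ab(1-4) p by (intro ker_ex1) simp_all
  then show "a = b"
    using ab dd p by (auto simp: hom_iff)
qed

lemma lift_ker_simps:
  assumes p: "p \<in> Arr C" and a: "a \<in> Arr C" "Cod C a = Dom C p" "p \<bullet> a = zero_map (Dom C a) (Cod C p)"
  shows "lift_ker C (ker C p) a \<in> Arr C" "Dom C (lift_ker C (ker C p) a) = Dom C a"
    "Cod C (lift_ker C (ker C p) a) = Dom C (ker C p)" "ker C p \<bullet> lift_ker C (ker C p) a = a"
  using theI'[OF ker_ex1[OF assms]] unfolding lift_ker_def by (auto simp: hom_iff)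

end

section \<open>Cokernels of pushout products\<close>

locale pointed_closed_monoidal = symmetric_monoidal_category C + pointed_category C
  for C :: "('o, 'a, 'm) sym_monoidal_scheme" (structure) +
  assumes closed: "monoidal_closed C"
begin

lemma braid_simps [simp]:
  assumes "x \<in> Obj C" "y \<in> Obj C"
  shows "braid C x y \<in> Arr C" "Dom C (braid C x y) = x \<otimes> y" "Cod C (braid C x y) = y \<otimes> x"
    "braid C y x \<bullet> braid C x y = Ide C (x \<otimes> y)"
  using braid_hom[OF assms] braid_inv[OF assms] by (auto simp: hom_iff)

lemma braid_nat:
  assumes "f \<in> Arr C" "g \<in> Arr C"
  shows "braid C (Cod C f) (Cod C g) \<bullet> (f \<star> g) = (g \<star> f) \<bullet> braid C (Dom C f) (Dom C g)"
  by (rule braid_natural) (use assms in \<open>auto simp: hom_iff\<close>)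

lemma braid_cancel:
  assumes "a \<in> Arr C" "b \<in> Arr C" "x \<in> Obj C" "y \<in> Obj C" "Dom C a = y \<otimes> x" "Dom C b = y \<otimes> x"
    "a \<bullet> braid C x y = b \<bullet> braid C x y"
  shows "a = b"
proof -
  have "(a \<bullet> braid C x y) \<bullet> braid C y x = (b \<bullet> braid C x y) \<bullet> braid C y x"
    using assms(7) by simp
  then show ?thesis
    using assms(1-6) by simp
qed

text \<open>
  By closedness, tensoring on the right is a left adjoint.
\<close>

lemma tensor_pushout:
  assumes po: "is_pushout C f g i k" and y: "y \<in> Obj C"
  shows "is_pushout C (f \<star> Ide C y) (g \<star> Ide C y) (i \<star> Ide C y) (k \<star> Ide C y)"
proof -
  obtain H where "right_adjoint C C (tensor_right C y) H"
    using closed y by (auto simp: monoidal_closed_def)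
  from left_adjoint_pushout[OF this po] show ?thesis
    by (simp add: tensor_right_def)
qed

lemma tensor_initial:
  assumes "y \<in> Obj C"
  shows "is_initial C (zero_ob C \<otimes> y)"
proof -
  obtain H where "right_adjoint C C (tensor_right C y) H"
    using closed assms by (auto simp: monoidal_closed_def)
  from left_adjoint_initial[OF this zero_initial] show ?thesis
    by (simp add: tensor_right_def)
qed

lemmas zero_tensor_eq = initial_arr_eq[OF tensor_initial]

text \<open>
  The object \<open>y \<otimes> 0\<close> is initial because the braiding identifies it with \<open>0 \<otimes> y\<close>.
\<close>

lemma tensor_zero_eq:
  assumes y: "y \<in> Obj C" and ab: "a \<in> Arr C" "b \<in> Arr C" "Dom C a = y \<otimes> zero_ob C" "Dom C b = y \<otimes> zero_ob C"
    "Cod C a = Cod C b"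
  shows "a = b"
proof (rule braid_cancel)
  show "a \<bullet> braid C (zero_ob C) y = b \<bullet> braid C (zero_ob C) y"
    by (rule zero_tensor_eq[OF y]) (use ab y in auto)
qed (use y ab in auto)

lemma zero_map_tensor:
  assumes "x \<in> Obj C" "y \<in> Obj C" "h \<in> Arr C"
  shows "zero_map x y \<star> h = zero_map (x \<otimes> Dom C h) (y \<otimes> Cod C h)"
proof -
  have "from_zero C y \<star> h = zero_map (zero_ob C \<otimes> Dom C h) (y \<otimes> Cod C h)"
    by (rule zero_tensor_eq[of "Dom C h"]) (use assms in auto)
  then have "(from_zero C y \<star> h) \<bullet> (to_zero C x \<star> Ide C (Dom C h)) = zero_map (x \<otimes> Dom C h) (y \<otimes> Cod C h)"
    using assms by simp
  then show ?thesis
    using assms by (simp add: zero_map_def)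
qed

lemma tensor_zero_map:
  assumes "x \<in> Obj C" "y \<in> Obj C" "h \<in> Arr C"
  shows "h \<star> zero_map x y = zero_map (Dom C h \<otimes> x) (Cod C h \<otimes> y)"
proof -
  have "h \<star> from_zero C y = zero_map (Dom C h \<otimes> zero_ob C) (Cod C h \<otimes> y)"
    by (rule tensor_zero_eq[of "Dom C h"]) (use assms in auto)
  then have "(h \<star> from_zero C y) \<bullet> (Ide C (Dom C h) \<star> to_zero C x) = zero_map (Dom C h \<otimes> x) (Cod C h \<otimes> y)"
    using assms by simp
  then show ?thesis
    using assms by (simp add: zero_map_def)
qed

lemma epi_tensor_right:
  assumes "is_epi C e" "y \<in> Obj C"
  shows "is_epi C (e \<star> Ide C y)"
proof -
  have e: "e \<in> Arr C"
    using assms by (simp add: is_epi_def)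
  have "is_pushout C e e (Ide C (Cod C e)) (Ide C (Cod C e))"
    using assms e is_pushout_epi by blast
  from tensor_pushout[OF this assms(2)] show ?thesis
    using e assms(2) is_pushout_epi[of "e \<star> Ide C y"] by simp
qed

lemma epi_tensor_left:
  assumes "is_epi C e" "y \<in> Obj C"
  shows "is_epi C (Ide C y \<star> e)"
  unfolding is_epi_def
proof (intro conjI ballI impI)
  have e: "e \<in> Arr C"
    using assms by (simp add: is_epi_def)
  then show "Ide C y \<star> e \<in> Arr C"
    using assms by simp
  fix a b
  assume ab: "a \<in> Arr C" "b \<in> Arr C" "Dom C a = Cod C (Ide C y \<star> e)" "Dom C b = Cod C (Ide C y \<star> e)"
    and eq: "a \<bullet> (Ide C y \<star> e) = b \<bullet> (Ide C y \<star> e)"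
  have *: "(c \<bullet> braid C (Cod C e) y) \<bullet> (e \<star> Ide C y) = (c \<bullet> (Ide C y \<star> e)) \<bullet> braid C (Dom C e) y"
    if "c \<in> Arr C" "Dom C c = Cod C (Ide C y \<star> e)" for c
    using that e assms(2) braid_nat[of e "Ide C y"] by simp
  have "a \<bullet> braid C (Cod C e) y = b \<bullet> braid C (Cod C e) y"
  proof (rule epiD[OF epi_tensor_right[OF assms]])
    show "(a \<bullet> braid C (Cod C e) y) \<bullet> (e \<star> Ide C y) = (b \<bullet> braid C (Cod C e) y) \<bullet> (e \<star> Ide C y)"
      using ab by (simp only: * eq)
  qed (use ab e assms(2) in auto)
  then show "a = b"
    by (rule braid_cancel[rotated -1]) (use ab e assms(2) in auto)
qed

lemma epi_tensor:
  assumes "is_epi C e" "is_epi C e'"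
  shows "is_epi C (e \<star> e')"
proof -
  have e: "e \<in> Arr C" "e' \<in> Arr C"
    using assms by (auto simp: is_epi_def)
  have "is_epi C ((e \<star> Ide C (Cod C e')) \<bullet> (Ide C (Dom C e) \<star> e'))"
    using assms e by (intro epi_comp epi_tensor_left epi_tensor_right) auto
  then show ?thesis
    using e by simp
qed

text \<open>
  The pushout that defines the cokernel is preserved. Its image has \<open>0 \<otimes> y\<close> in place of \<open>0\<close>, which is
  initial again, so that the image exhibits a cokernel.
\<close>

lemma cokernel_tensor_right:
  assumes q: "is_cokernel f q" and y: "y \<in> Obj C"
  shows "is_cokernel (f \<star> Ide C y) (q \<star> Ide C y)"
proof (rule is_cokernelI)
  note d = is_cokernelD[OF q]
  note po = tensor_pushout[OF q[unfolded is_cokernel_def] y]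
  show "is_epi C (q \<star> Ide C y)"
    using q y by (intro epi_tensor_right cokernel_epi)
  show "(q \<star> Ide C y) \<bullet> (f \<star> Ide C y) = zero_map (Dom C (f \<star> Ide C y)) (Cod C (q \<star> Ide C y))"
  proof -
    have "from_zero C (Cod C q) \<star> Ide C y = from_zero C (Cod C q \<otimes> y) \<bullet> to_zero C (zero_ob C \<otimes> y)"
      by (rule zero_tensor_eq[OF y]) (use d y in auto)
    moreover have "(q \<star> Ide C y) \<bullet> (f \<star> Ide C y) = (from_zero C (Cod C q) \<star> Ide C y) \<bullet> (to_zero C (Dom C f) \<star> Ide C y)"
      using d y by (simp add: zero_map_def)
    ultimately show ?thesis
      using d y by (simp add: zero_map_def to_zero_comp)
  qed
  show "\<exists>w\<in>Arr C. Dom C w = Cod C (q \<star> Ide C y) \<and> w \<bullet> (q \<star> Ide C y) = a"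
    if a: "a \<in> Arr C" "Dom C a = Cod C (f \<star> Ide C y)"
      "a \<bullet> (f \<star> Ide C y) = zero_map (Dom C (f \<star> Ide C y)) (Cod C a)" for a
  proof -
    let ?z = "zero_map (zero_ob C \<otimes> y) (Cod C a)"
    have "\<exists>!h. h \<in> hom C (Cod C (from_zero C (Cod C q) \<star> Ide C y)) (Cod C ?z) \<and>
      h \<bullet> (from_zero C (Cod C q) \<star> Ide C y) = ?z \<and> h \<bullet> (q \<star> Ide C y) = a"
      by (rule is_pushout_ex1[OF po]) (use a d y in auto)
    then show ?thesis
      using d y by (auto simp: hom_iff)
  qed
qed (use is_cokernelD[OF q] y in auto)

lemma cokernel_tensor_left:
  assumes q: "is_cokernel f q" and y: "y \<in> Obj C"
  shows "is_cokernel (Ide C y \<star> f) (Ide C y \<star> q)"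
proof (rule is_cokernelI)
  note d = is_cokernelD[OF q]
  note d' = is_cokernelD[OF cokernel_tensor_right[OF q y]]
  show "is_epi C (Ide C y \<star> q)"
    using q y by (intro epi_tensor_left cokernel_epi)
  have nat: "(Ide C y \<star> h) = braid C (Cod C h) y \<bullet> (h \<star> Ide C y) \<bullet> braid C y (Dom C h)" if "h \<in> Arr C" for h
    using that y braid_nat[of "Ide C y" h] comp_chain[OF braid_simps(4)[of y "Cod C h"], of "Ide C y \<star> h"] by simp
  have "(Ide C y \<star> q) \<bullet> (Ide C y \<star> f) = Ide C y \<star> (q \<bullet> f)"
    using d y by simp
  also have "\<dots> = braid C (Cod C q) y \<bullet> ((q \<star> Ide C y) \<bullet> (f \<star> Ide C y)) \<bullet> braid C y (Dom C f)"
    using nat[of "q \<bullet> f"] d(1-3) y by simp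
  also have "\<dots> = zero_map (y \<otimes> Dom C f) (y \<otimes> Cod C q)"
    unfolding d'(4) using d y by simp
  finally show "(Ide C y \<star> q) \<bullet> (Ide C y \<star> f) = zero_map (Dom C (Ide C y \<star> f)) (Cod C (Ide C y \<star> q))"
    using d y by simp
  show "\<exists>w\<in>Arr C. Dom C w = Cod C (Ide C y \<star> q) \<and> w \<bullet> (Ide C y \<star> q) = a"
    if a: "a \<in> Arr C" "Dom C a = Cod C (Ide C y \<star> f)"
      "a \<bullet> (Ide C y \<star> f) = zero_map (Dom C (Ide C y \<star> f)) (Cod C a)" for a
  proof -
    let ?a = "a \<bullet> braid C (Cod C f) y"
    have "?a \<bullet> (f \<star> Ide C y) = (a \<bullet> (Ide C y \<star> f)) \<bullet> braid C (Dom C f) y"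
      using a(1,2) d y braid_nat[of f "Ide C y"] by simp
    also have "\<dots> = zero_map (Dom C f \<otimes> y) (Cod C a)"
      unfolding a(3) using a(1) d y by simp
    finally have "?a \<bullet> (f \<star> Ide C y) = zero_map (Dom C (f \<star> Ide C y)) (Cod C ?a)"
      using a(1,2) d y by simp
    from lift_coker_simps[OF cokernel_tensor_right[OF q y] _ _ this]
    obtain w where w: "w \<in> Arr C" "Dom C w = Cod C q \<otimes> y" "w \<bullet> (q \<star> Ide C y) = ?a"
      using a(1,2) d y by auto
    have "(w \<bullet> braid C y (Cod C q)) \<bullet> (Ide C y \<star> q) = (w \<bullet> (q \<star> Ide C y)) \<bullet> braid C y (Cod C f)"
      using w(1,2) d y braid_nat[of "Ide C y" q] by simp
    also have "\<dots> = a"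
      unfolding w(3) using a(1,2) d y by simp
    finally show ?thesis
      using w(1,2) d y by (intro bexI[of _ "w \<bullet> braid C y (Cod C q)"]) auto
  qed
qed (use is_cokernelD[OF q] y in auto)

section \<open>The pushout product\<close>

section \<open>The pushout product\<close>

lemma pp_pushout:
  assumes "f \<in> Arr C" "g \<in> Arr C"
  shows "is_pushout C (Ide C (Dom C f) \<star> g) (f \<star> Ide C (Dom C g)) (pp_in1 C f g) (pp_in2 C f g)"
proof -
  let ?a = "Ide C (Dom C f) \<star> g" and ?b = "f \<star> Ide C (Dom C g)"
  have "\<exists>i k. is_pushout C ?a ?b i k"
    using assms by (intro pushouts) auto
  then have "\<exists>p. case p of (i, k) \<Rightarrow> is_pushout C ?a ?b i k"
    by auto
  then have "case pushout C ?a ?b of (i, k) \<Rightarrow> is_pushout C ?a ?b i k"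
    unfolding pushout_def by (rule someI_ex)
  then show ?thesis
    by (auto simp: pp_in1_def pp_in2_def split: prod.splits)
qed

lemma pp_eqI:
  assumes "f \<in> Arr C" "g \<in> Arr C" "h \<in> Arr C" "h' \<in> Arr C"
    "Dom C h = Cod C (pp_in1 C f g)" "Dom C h' = Cod C (pp_in1 C f g)"
    "h \<bullet> pp_in1 C f g = h' \<bullet> pp_in1 C f g" "h \<bullet> pp_in2 C f g = h' \<bullet> pp_in2 C f g"
  shows "h = h'"
  by (rule is_pushout_arr_eq[OF pp_pushout[OF assms(1,2)]]) (fact assms)+

lemma pp_in_simps0:
  assumes "f \<in> Arr C" "g \<in> Arr C"
  shows "pp_in1 C f g \<in> Arr C" "pp_in2 C f g \<in> Arr C"
    "Dom C (pp_in1 C f g) = Dom C f \<otimes> Cod C g" "Dom C (pp_in2 C f g) = Cod C f \<otimes> Dom C g"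
    "Cod C (pp_in2 C f g) = Cod C (pp_in1 C f g)"
    "pp_in1 C f g \<bullet> (Ide C (Dom C f) \<star> g) = pp_in2 C f g \<bullet> (f \<star> Ide C (Dom C g))"
  using is_pushoutD[OF pp_pushout[OF assms]] assms by auto

lemma pp_cotuple_simps0:
  assumes fg: "f \<in> Arr C" "g \<in> Arr C" and a: "a \<in> Arr C" "Dom C a = Dom C f \<otimes> Cod C g"
    and b: "b \<in> Arr C" "Dom C b = Cod C f \<otimes> Dom C g" "Cod C b = Cod C a"
    and ab: "a \<bullet> (Ide C (Dom C f) \<star> g) = b \<bullet> (f \<star> Ide C (Dom C g))"
  shows "pp_cotuple C f g a b \<in> Arr C" "Dom C (pp_cotuple C f g a b) = Cod C (pp_in1 C f g)"
    "Cod C (pp_cotuple C f g a b) = Cod C a"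
    "pp_cotuple C f g a b \<bullet> pp_in1 C f g = a" "pp_cotuple C f g a b \<bullet> pp_in2 C f g = b"
proof -
  have "\<exists>!h. h \<in> hom C (Cod C (pp_in1 C f g)) (Cod C a) \<and> h \<bullet> pp_in1 C f g = a \<and> h \<bullet> pp_in2 C f g = b"
    by (rule is_pushout_ex1[OF pp_pushout[OF fg]]) (use assms in auto)
  from theI'[OF this, folded pp_cotuple_def]
  show "pp_cotuple C f g a b \<in> Arr C" "Dom C (pp_cotuple C f g a b) = Cod C (pp_in1 C f g)"
    "Cod C (pp_cotuple C f g a b) = Cod C a"
    "pp_cotuple C f g a b \<bullet> pp_in1 C f g = a" "pp_cotuple C f g a b \<bullet> pp_in2 C f g = b"
    by (auto simp: hom_iff)
qed

lemma pp_simps [simp]: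
  assumes "f \<in> Arr C" "g \<in> Arr C"
  shows "pp C f g \<in> Arr C" "Cod C (pp C f g) = Cod C f \<otimes> Cod C g"
    "pp C f g \<bullet> pp_in1 C f g = f \<star> Ide C (Cod C g)" "pp C f g \<bullet> pp_in2 C f g = Ide C (Cod C f) \<star> g"
  unfolding pp_def
  using pp_cotuple_simps0[OF assms, of "f \<star> Ide C (Cod C g)" "Ide C (Cod C f) \<star> g"] assms by simp_all

lemma pp_in_simps [simp]:
  assumes "f \<in> Arr C" "g \<in> Arr C"
  shows "pp_in1 C f g \<in> Arr C" "pp_in2 C f g \<in> Arr C"
    "Dom C (pp_in1 C f g) = Dom C f \<otimes> Cod C g" "Dom C (pp_in2 C f g) = Cod C f \<otimes> Dom C g"
    "Cod C (pp_in1 C f g) = Dom C (pp C f g)" "Cod C (pp_in2 C f g) = Dom C (pp C f g)"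
proof -
  show 1: "Cod C (pp_in1 C f g) = Dom C (pp C f g)"
    unfolding pp_def
    using pp_cotuple_simps0[OF assms, of "f \<star> Ide C (Cod C g)" "Ide C (Cod C f) \<star> g"] assms by simp
  show "pp_in1 C f g \<in> Arr C" "pp_in2 C f g \<in> Arr C"
    "Dom C (pp_in1 C f g) = Dom C f \<otimes> Cod C g" "Dom C (pp_in2 C f g) = Cod C f \<otimes> Dom C g"
    "Cod C (pp_in2 C f g) = Dom C (pp C f g)"
    using pp_in_simps0[OF assms] 1 by auto
qed

lemma pp_arr_eq:
  assumes "f \<in> Arr C" "g \<in> Arr C" "h \<in> Arr C" "h' \<in> Arr C" "Dom C h = Dom C (pp C f g)" "Dom C h' = Dom C (pp C f g)"
    "h \<bullet> pp_in1 C f g = h' \<bullet> pp_in1 C f g" "h \<bullet> pp_in2 C f g = h' \<bullet> pp_in2 C f g"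
  shows "h = h'"
  by (rule pp_eqI[of f g]) (use assms in auto)

lemma pp_cotuple_simps:
  assumes "f \<in> Arr C" "g \<in> Arr C" and "a \<in> Arr C" "Dom C a = Dom C f \<otimes> Cod C g"
    and "b \<in> Arr C" "Dom C b = Cod C f \<otimes> Dom C g" "Cod C b = Cod C a"
    and "a \<bullet> (Ide C (Dom C f) \<star> g) = b \<bullet> (f \<star> Ide C (Dom C g))"
  shows "pp_cotuple C f g a b \<in> Arr C" "Dom C (pp_cotuple C f g a b) = Dom C (pp C f g)"
    "Cod C (pp_cotuple C f g a b) = Cod C a"
    "pp_cotuple C f g a b \<bullet> pp_in1 C f g = a" "pp_cotuple C f g a b \<bullet> pp_in2 C f g = b"
  using pp_cotuple_simps0[OF assms] assms by auto

text \<open>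
  The two coprojections agree on \<open>X0 \<otimes> Y0\<close>: a factor \<open>g\<close> on the right of the first one may be traded
  for a factor \<open>f\<close> on the left of the second one.
\<close>

lemma pp_glue:
  assumes "f \<in> Arr C" "g \<in> Arr C" "a \<in> Arr C" "b \<in> Arr C" "Cod C a = Dom C f" "Cod C b = Dom C g"
  shows "pp_in1 C f g \<bullet> (a \<star> (g \<bullet> b)) = pp_in2 C f g \<bullet> ((f \<bullet> a) \<star> b)"
proof -
  have "(pp_in1 C f g \<bullet> (Ide C (Dom C f) \<star> g)) \<bullet> (a \<star> b) = (pp_in2 C f g \<bullet> (f \<star> Ide C (Dom C g))) \<bullet> (a \<star> b)"
    using pp_in_simps0(6)[OF assms(1,2)] by simp
  then show ?thesis
    using assms by simp
qed

text \<open>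
  The pushout product restricts to \<open>f \<otimes> 1\<close> and \<open>1 \<otimes> g\<close> on the two summands of its domain. So a map kills
  it if and only if it kills both, and then it factors first through \<open>q \<otimes> 1\<close> and, what remains, through
  \<open>1 \<otimes> r\<close>. This is why the cokernel turns pushout products into tensor products of arrows.
\<close>

lemma cokernel_pp:
  assumes q: "is_cokernel f q" and r: "is_cokernel g r"
  shows "is_cokernel (pp C f g) (q \<star> r)"
proof (rule is_cokernelI)
  note d = is_cokernelD[OF q] and e = is_cokernelD[OF r]
  show "pp C f g \<in> Arr C" "Dom C (q \<star> r) = Cod C (pp C f g)"
    using d e by auto
  show "is_epi C (q \<star> r)"
    using q r by (intro epi_tensor cokernel_epi)
  show "(q \<star> r) \<bullet> pp C f g = zero_map (Dom C (pp C f g)) (Cod C (q \<star> r))"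
    by (rule pp_arr_eq[of f g]) (use d e in \<open>auto simp: zero_map_tensor tensor_zero_map\<close>)
  show "\<exists>w\<in>Arr C. Dom C w = Cod C (q \<star> r) \<and> w \<bullet> (q \<star> r) = a"
    if a: "a \<in> Arr C" "Dom C a = Cod C (pp C f g)" "a \<bullet> pp C f g = zero_map (Dom C (pp C f g)) (Cod C a)" for a
  proof -
    have "(a \<bullet> pp C f g) \<bullet> pp_in1 C f g = zero_map (Dom C f \<otimes> Cod C g) (Cod C a)"
      "(a \<bullet> pp C f g) \<bullet> pp_in2 C f g = zero_map (Cod C f \<otimes> Dom C g) (Cod C a)"
      unfolding a(3) using a(1,2) d e by simp_all
    then have af: "a \<bullet> (f \<star> Ide C (Cod C g)) = zero_map (Dom C f \<otimes> Cod C g) (Cod C a)"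
      and ag: "a \<bullet> (Ide C (Cod C f) \<star> g) = zero_map (Cod C f \<otimes> Dom C g) (Cod C a)"
      using a(1,2) d e by simp_all
    from lift_coker_simps[OF cokernel_tensor_right[OF q, of "Cod C g"], of a] af
    obtain u where u: "u \<in> Arr C" "Dom C u = Cod C q \<otimes> Cod C g" "Cod C u = Cod C a" "u \<bullet> (q \<star> Ide C (Cod C g)) = a"
      using a(1,2) d e by auto
    \<comment> \<open>The factorisation of \<open>a\<close> through \<open>q \<otimes> 1\<close> still kills \<open>1 \<otimes> g\<close>,
      because this can be tested after the epimorphism \<open>q \<otimes> 1\<close>.\<close>
    have "u \<bullet> (Ide C (Cod C q) \<star> g) = zero_map (Cod C q \<otimes> Dom C g) (Cod C a)"
    proof (rule epiD[OF epi_tensor_right[OF cokernel_epi[OF q]]])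
      have "(u \<bullet> (Ide C (Cod C q) \<star> g)) \<bullet> (q \<star> Ide C (Dom C g)) = (u \<bullet> (q \<star> Ide C (Cod C g))) \<bullet> (Ide C (Cod C f) \<star> g)"
        using u(1,2) d e by simp
      also have "\<dots> = zero_map (Cod C q \<otimes> Dom C g) (Cod C a) \<bullet> (q \<star> Ide C (Dom C g))"
        unfolding u(4) ag using a(1) d e by simp
      finally show "(u \<bullet> (Ide C (Cod C q) \<star> g)) \<bullet> (q \<star> Ide C (Dom C g)) =
        zero_map (Cod C q \<otimes> Dom C g) (Cod C a) \<bullet> (q \<star> Ide C (Dom C g))" .
    qed (use u a(1) d e in auto)
    from lift_coker_simps[OF cokernel_tensor_left[OF r, of "Cod C q"], of u] this
    obtain w where w: "w \<in> Arr C" "Dom C w = Cod C q \<otimes> Cod C r" "w \<bullet> (Ide C (Cod C q) \<star> r) = u"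
      using u(1-3) d e by auto
    have "w \<bullet> (q \<star> r) = (w \<bullet> (Ide C (Cod C q) \<star> r)) \<bullet> (q \<star> Ide C (Cod C g))"
      using w(1,2) d e by simp
    also have "\<dots> = a"
      by (simp only: w(3) u(4))
    finally show ?thesis
      using w(1,2) d e by auto
  qed
qed

end

section \<open>The arrow category\<close>

lemma arrow_category_simps [simp]:
  "Obj (arrow_category C) = Arr C"
  "Dom (arrow_category C) = src"
  "Cod (arrow_category C) = tgt"
  "Ide (arrow_category C) f = Mor f f (Ide C (Dom C f), Ide C (Cod C f))"
  "t \<bullet>\<^bsub>arrow_category C\<^esub> s = Mor (src s) (tgt t) (dom_part t \<bullet>\<^bsub>C\<^esub> dom_part s, cod_part t \<bullet>\<^bsub>C\<^esub> cod_part s)"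
  by (simp_all add: arrow_category_def)

lemma square_eqI:
  "\<lbrakk>src s = src t; tgt s = tgt t; dom_part s = dom_part t; cod_part s = cod_part t\<rbrakk> \<Longrightarrow> s = t"
  by (cases s; cases t) (auto simp: prod_eq_iff)

context category
begin

lemma square_iff:
  "s \<in> hom (arrow_category C) f g \<longleftrightarrow> src s = f \<and> tgt s = g \<and> f \<in> Arr C \<and> g \<in> Arr C \<and>
    dom_part s \<in> Arr C \<and> Dom C (dom_part s) = Dom C f \<and> Cod C (dom_part s) = Dom C g \<and>
    cod_part s \<in> Arr C \<and> Dom C (cod_part s) = Cod C f \<and> Cod C (cod_part s) = Cod C g \<and>
    g \<bullet> dom_part s = cod_part s \<bullet> f"
proof -
  obtain a b where s: "s = Mor (src s) (tgt s) (a, b)"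
    by (metis mor.exhaust_sel prod.exhaust_sel)
  show ?thesis
    by (subst (1 2 3 4 5 6 7 8 9 10 11) s) (auto simp: arrow_category_def hom_def)
qed

lemma category_arrow_category: "category (arrow_category C)"
proof unfold_locales
  fix f
  assume "f \<in> Arr (arrow_category C)"
  then show "Dom (arrow_category C) f \<in> Obj (arrow_category C)" "Cod (arrow_category C) f \<in> Obj (arrow_category C)"
    by (auto simp: arrow_category_def)
next
  fix x y z s t
  assume "s \<in> hom (arrow_category C) x y" "t \<in> hom (arrow_category C) y z"
  then show "t \<bullet>\<^bsub>arrow_category C\<^esub> s \<in> hom (arrow_category C) x z"
    using comp_chain[of z "dom_part t" "cod_part t \<bullet> y" "dom_part s"] by (simp add: square_iff)
qed (auto simp: square_iff intro!: square_eqI)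

text \<open>
  In a square into a monomorphism \<open>k\<close> the composite of the map of domains with \<open>k\<close> is prescribed by the
  map of codomains.
\<close>

lemma square_eq_mono:
  assumes "is_mono C k" "s \<in> hom (arrow_category C) f k" "t \<in> hom (arrow_category C) f k" "cod_part s = cod_part t"
  shows "s = t"
proof (rule square_eqI)
  show "dom_part s = dom_part t"
    by (rule monoD[OF assms(1)]) (use assms in \<open>auto simp: square_iff\<close>)
qed (use assms in \<open>auto simp: square_iff\<close>)

lemma square_eq_epi:
  assumes "is_epi C e" "s \<in> hom (arrow_category C) e g" "t \<in> hom (arrow_category C) e g" "dom_part s = dom_part t"
  shows "s = t"
proof (rule square_eqI)
  have st: "g \<bullet> dom_part s = cod_part s \<bullet> e" "g \<bullet> dom_part t = cod_part t \<bullet> e"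
    using assms by (simp_all add: square_iff)
  show "cod_part s = cod_part t"
    by (rule epiD[OF assms(1)]) (use assms st in \<open>auto simp: square_iff\<close>)
qed (use assms in \<open>auto simp: square_iff\<close>)

end

section \<open>The adjunction between cokernels and kernels of arrows\<close>

text \<open>
  This is the family of bijections whose existence an adjunction asserts. It is named because the adjunctions
  between monoids and between modules come from the bijections for the underlying arrows.
\<close>

definition adjunction_bijection ::
    "('o1, 'a1, 'm1) category_scheme \<Rightarrow> ('o2, 'a2, 'm2) category_scheme
      \<Rightarrow> ('o1, 'a1, 'o2, 'a2) func \<Rightarrow> ('o2, 'a2, 'o1, 'a1) func \<Rightarrow> ('o1 \<Rightarrow> 'o2 \<Rightarrow> 'a2 \<Rightarrow> 'a1) \<Rightarrow> bool" where
  "adjunction_bijection A B F G \<phi> \<longleftrightarrow>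
    (\<forall>a \<in> Obj A. \<forall>b \<in> Obj B. bij_betw (\<phi> a b) (hom B (FO F a) b) (hom A a (FO G b))) \<and>
    (\<forall>a \<in> Obj A. \<forall>a' \<in> Obj A. \<forall>b \<in> Obj B. \<forall>b' \<in> Obj B.
      \<forall>h \<in> hom A a' a. \<forall>g \<in> hom B (FO F a) b. \<forall>k \<in> hom B b b'.
        \<phi> a' b' (k \<bullet>\<^bsub>B\<^esub> g \<bullet>\<^bsub>B\<^esub> FA F h) = FA G k \<bullet>\<^bsub>A\<^esub> \<phi> a b g \<bullet>\<^bsub>A\<^esub> h)"

lemma right_adjoint_iff:
  "right_adjoint A B F G \<longleftrightarrow> cat_functor A B F \<and> cat_functor B A G \<and> (\<exists>\<phi>. adjunction_bijection A B F G \<phi>)"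
  by (simp add: right_adjoint_def adjunction_bijection_def)

context pointed_category
begin

abbreviation K where "K \<equiv> arrow_category C"

lemma Coker_hom:
  assumes s: "s \<in> hom K f g"
  shows "FA (Coker C) s \<in> hom K (coker C f) (coker C g)"
proof -
  have d: "src s = f" "tgt s = g" "f \<in> Arr C" "g \<in> Arr C" "cod_part s \<in> Arr C" "dom_part s \<in> Arr C"
    "Dom C (cod_part s) = Cod C f" "Cod C (cod_part s) = Cod C g" "g \<bullet> dom_part s = cod_part s \<bullet> f"
    "Dom C (dom_part s) = Dom C f" "Cod C (dom_part s) = Dom C g"
    using s by (auto simp: square_iff)
  have "coker C g \<bullet> (cod_part s \<bullet> f) = (coker C g \<bullet> g) \<bullet> dom_part s"
    using d(3-8,10,11) by (simp flip: d(9) del: coker_simps(3))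
  then have "(coker C g \<bullet> cod_part s) \<bullet> f = zero_map (Dom C f) (Cod C (coker C g \<bullet> cod_part s))"
    using d(3-8,10,11) by simp
  from lift_coker_simps[OF coker_cokernel _ _ this] show ?thesis
    using d by (simp add: Coker_def square_iff)
qed

lemma Ker_hom:
  assumes s: "s \<in> hom K f g"
  shows "FA (Ker C) s \<in> hom K (ker C f) (ker C g)"
proof -
  have d: "src s = f" "tgt s = g" "f \<in> Arr C" "g \<in> Arr C" "cod_part s \<in> Arr C" "dom_part s \<in> Arr C"
    "Dom C (cod_part s) = Cod C f" "Cod C (cod_part s) = Cod C g" "g \<bullet> dom_part s = cod_part s \<bullet> f"
    "Dom C (dom_part s) = Dom C f" "Cod C (dom_part s) = Dom C g"
    using s by (auto simp: square_iff)
  have "g \<bullet> (dom_part s \<bullet> ker C f) = zero_map (Dom C (dom_part s \<bullet> ker C f)) (Cod C g)"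
    using d comp_chain[OF d(9), of "ker C f"] by simp
  from lift_ker_simps[OF _ _ _ this] show ?thesis
    using d by (simp add: Ker_def square_iff)
qed

lemma Coker_parts [simp]: "FO (Coker C) f = coker C f" "dom_part (FA (Coker C) s) = cod_part s"
  by (simp_all add: Coker_def)

lemma Ker_parts [simp]: "FO (Ker C) f = ker C f" "cod_part (FA (Ker C) s) = dom_part s"
  by (simp_all add: Ker_def)

lemma functor_Coker: "cat_functor K K (Coker C)"
proof -
  interpret K: category K
    by (rule category_arrow_category)
  show ?thesis
  proof unfold_locales
    fix f
    assume f: "f \<in> Obj K"
    then show "FO (Coker C) f \<in> Obj K"
      by simp
    show "FA (Coker C) (Ide K f) = Ide K (FO (Coker C) f)"
    proof (rule square_eq_epi)
      show "FA (Coker C) (Ide K f) \<in> hom K (coker C f) (coker C f)"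
        using f by (intro Coker_hom K.ide_hom)
      show "Ide K (FO (Coker C) f) \<in> hom K (coker C f) (coker C f)"
        using f K.ide_hom[of "coker C f"] by simp
    qed (use f in \<open>auto simp: coker_epi\<close>)
  next
    fix s f g
    assume "s \<in> hom K f g"
    then show "FA (Coker C) s \<in> hom K (FO (Coker C) f) (FO (Coker C) g)"
      using Coker_hom by simp
  next
    fix s t f g h
    assume st: "s \<in> hom K f g" "t \<in> hom K g h"
    show "FA (Coker C) (t \<bullet>\<^bsub>K\<^esub> s) = FA (Coker C) t \<bullet>\<^bsub>K\<^esub> FA (Coker C) s"
    proof (rule square_eq_epi)
      show "FA (Coker C) (t \<bullet>\<^bsub>K\<^esub> s) \<in> hom K (coker C f) (coker C h)"
        using st by (intro Coker_hom K.comp_hom)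
      show "FA (Coker C) t \<bullet>\<^bsub>K\<^esub> FA (Coker C) s \<in> hom K (coker C f) (coker C h)"
        by (rule K.comp_hom[OF Coker_hom[OF st(1)] Coker_hom[OF st(2)]])
    qed (use st in \<open>auto simp: coker_epi square_iff\<close>)
  qed
qed

lemma functor_Ker: "cat_functor K K (Ker C)"
proof -
  interpret K: category K
    by (rule category_arrow_category)
  show ?thesis
  proof unfold_locales
    fix f
    assume f: "f \<in> Obj K"
    then show "FO (Ker C) f \<in> Obj K"
      by simp
    show "FA (Ker C) (Ide K f) = Ide K (FO (Ker C) f)"
    proof (rule square_eq_mono)
      show "FA (Ker C) (Ide K f) \<in> hom K (ker C f) (ker C f)"
        using f by (intro Ker_hom K.ide_hom)
      show "Ide K (FO (Ker C) f) \<in> hom K (ker C f) (ker C f)"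
        using f K.ide_hom[of "ker C f"] by simp
    qed (use f in \<open>auto simp: ker_mono\<close>)
  next
    fix s f g
    assume "s \<in> hom K f g"
    then show "FA (Ker C) s \<in> hom K (FO (Ker C) f) (FO (Ker C) g)"
      using Ker_hom by simp
  next
    fix s t f g h
    assume st: "s \<in> hom K f g" "t \<in> hom K g h"
    show "FA (Ker C) (t \<bullet>\<^bsub>K\<^esub> s) = FA (Ker C) t \<bullet>\<^bsub>K\<^esub> FA (Ker C) s"
    proof (rule square_eq_mono)
      show "FA (Ker C) (t \<bullet>\<^bsub>K\<^esub> s) \<in> hom K (ker C f) (ker C h)"
        using st by (intro Ker_hom K.comp_hom)
      show "FA (Ker C) t \<bullet>\<^bsub>K\<^esub> FA (Ker C) s \<in> hom K (ker C f) (ker C h)"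
        by (rule K.comp_hom[OF Ker_hom[OF st(1)] Ker_hom[OF st(2)]])
    qed (use st in \<open>auto simp: ker_mono square_iff\<close>)
  qed
qed

text \<open>
  A square \<open>coker f \<rightarrow> p\<close> and a square \<open>f \<rightarrow> ker p\<close> are each determined by one map
  \<open>a : Cod f \<rightarrow> Dom p\<close>, which has to satisfy \<open>p a f = 0\<close>. It is the map of domains in the first
  square and the map of codomains in the second.
\<close>

definition ker_transpose :: "'a \<Rightarrow> 'a \<Rightarrow> 'a square \<Rightarrow> 'a square" where
  "ker_transpose f p s = Mor f (ker C p) (lift_ker C (ker C p) (dom_part s \<bullet> f), dom_part s)"

lemma ker_transpose_parts [simp]: "cod_part (ker_transpose f p s) = dom_part s"
  by (simp add: ker_transpose_def)

lemma ker_transpose_hom: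
  assumes f: "f \<in> Arr C" and s: "s \<in> hom K (coker C f) p"
  shows "ker_transpose f p s \<in> hom K f (ker C p)"
proof -
  have d: "p \<in> Arr C" "cod_part s \<in> Arr C" "dom_part s \<in> Arr C"
    "Dom C (cod_part s) = Cod C (coker C f)" "Cod C (cod_part s) = Cod C p" "p \<bullet> dom_part s = cod_part s \<bullet> coker C f"
    "Dom C (dom_part s) = Cod C f" "Cod C (dom_part s) = Dom C p"
    using s f by (auto simp: square_iff)
  have "p \<bullet> (dom_part s \<bullet> f) = zero_map (Dom C (dom_part s \<bullet> f)) (Cod C p)"
    using d f comp_chain[OF d(6), of f] by simp
  from lift_ker_simps[OF _ _ _ this] show ?thesis
    using d f by (simp add: ker_transpose_def square_iff)
qed

text \<open>
  Every equation of squares that occurs here has a cokernel as its source or a kernel as its target, so one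
  component of it suffices.
\<close>

lemma Coker_Ker_adjunction: "adjunction_bijection K K (Coker C) (Ker C) ker_transpose"
  unfolding adjunction_bijection_def
proof (intro conjI ballI)
  fix f p
  assume "f \<in> Obj K" "p \<in> Obj K"
  then have fp: "f \<in> Arr C" "p \<in> Arr C"
    by auto
  define untranspose where "untranspose t = Mor (coker C f) p (cod_part t, lift_coker C (coker C f) (p \<bullet> cod_part t))" for t :: "'a square"
  have untranspose_hom: "untranspose t \<in> hom K (coker C f) p" if t: "t \<in> hom K f (ker C p)" for t
  proof -
    have d: "cod_part t \<in> Arr C" "dom_part t \<in> Arr C" "Dom C (cod_part t) = Cod C f" "Cod C (cod_part t) = Dom C p"
      "ker C p \<bullet> dom_part t = cod_part t \<bullet> f" "Dom C (dom_part t) = Dom C f" "Cod C (dom_part t) = Dom C (ker C p)"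
      using t fp by (auto simp: square_iff)
    have "p \<bullet> (cod_part t \<bullet> f) = zero_map (Dom C f) (Cod C p)"
      using d(1-4,6,7) fp comp_chain[OF ker_simps(3)[of p], of "dom_part t"] by (simp flip: d(5))
    then have "(p \<bullet> cod_part t) \<bullet> f = zero_map (Dom C f) (Cod C (p \<bullet> cod_part t))"
      using d fp by simp
    from lift_coker_simps[OF coker_cokernel _ _ this] show ?thesis
      using d fp by (simp add: untranspose_def square_iff)
  qed
  have "bij_betw (ker_transpose f p) (hom K (coker C f) p) (hom K f (ker C p))"
  proof (rule bij_betw_byWitness[where f' = untranspose])
    show "\<forall>s\<in>hom K (coker C f) p. untranspose (ker_transpose f p s) = s"
    proof
      fix s
      assume s: "s \<in> hom K (coker C f) p"
      show "untranspose (ker_transpose f p s) = s"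
        by (rule square_eq_epi[OF coker_epi[OF fp(1)] untranspose_hom[OF ker_transpose_hom[OF fp(1) s]] s]) (simp add: untranspose_def)
    qed
    show "\<forall>t\<in>hom K f (ker C p). ker_transpose f p (untranspose t) = t"
    proof
      fix t
      assume t: "t \<in> hom K f (ker C p)"
      show "ker_transpose f p (untranspose t) = t"
        by (rule square_eq_mono[OF ker_mono[OF fp(2)] ker_transpose_hom[OF fp(1) untranspose_hom[OF t]] t]) (simp add: untranspose_def)
    qed
  qed (use untranspose_hom ker_transpose_hom fp in auto)
  then show "bij_betw (ker_transpose f p) (hom K (FO (Coker C) f) p) (hom K f (FO (Ker C) p))"
    by simp
next
  interpret K: category K
    by (rule category_arrow_category)
  fix f f' p p' h s k
  assume o: "f \<in> Obj K" "f' \<in> Obj K" "p \<in> Obj K" "p' \<in> Obj K"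
    and h: "h \<in> hom K f' f" and s: "s \<in> hom K (FO (Coker C) f) p" and k: "k \<in> hom K p p'"
  show "ker_transpose f' p' (k \<bullet>\<^bsub>K\<^esub> s \<bullet>\<^bsub>K\<^esub> FA (Coker C) h) = FA (Ker C) k \<bullet>\<^bsub>K\<^esub> ker_transpose f p s \<bullet>\<^bsub>K\<^esub> h"
  proof (rule square_eq_mono)
    show "is_mono C (ker C p')"
      using o by (auto intro: ker_mono)
    have s': "s \<in> hom K (coker C f) p"
      using s by simp
    have "k \<bullet>\<^bsub>K\<^esub> s \<bullet>\<^bsub>K\<^esub> FA (Coker C) h \<in> hom K (coker C f') p'"
      by (rule K.comp_hom[OF K.comp_hom[OF Coker_hom[OF h] s'] k])
    then show "ker_transpose f' p' (k \<bullet>\<^bsub>K\<^esub> s \<bullet>\<^bsub>K\<^esub> FA (Coker C) h) \<in> hom K f' (ker C p')"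
      using o by (intro ker_transpose_hom) auto
    show "FA (Ker C) k \<bullet>\<^bsub>K\<^esub> ker_transpose f p s \<bullet>\<^bsub>K\<^esub> h \<in> hom K f' (ker C p')"
      by (rule K.comp_hom[OF K.comp_hom[OF h ker_transpose_hom[OF _ s']] Ker_hom[OF k]]) (use o in auto)
  qed simp
qed

end

section \<open>The two monoidal structures on arrows\<close>

lemma arr_tensor_simps [simp]:
  "Obj (arr_tensor C) = Arr C"
  "Arr (arr_tensor C) = Arr (arrow_category C)"
  "Dom (arr_tensor C) = src"
  "Cod (arr_tensor C) = tgt"
  "Ide (arr_tensor C) f = Mor f f (Ide C (Dom C f), Ide C (Cod C f))"
  "t \<bullet>\<^bsub>arr_tensor C\<^esub> s = Mor (src s) (tgt t) (dom_part t \<bullet>\<^bsub>C\<^esub> dom_part s, cod_part t \<bullet>\<^bsub>C\<^esub> cod_part s)"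
  "hom (arr_tensor C) = hom (arrow_category C)"
  "f \<otimes>\<^bsub>arr_tensor C\<^esub> g = f \<star>\<^bsub>C\<^esub> g"
  "s \<star>\<^bsub>arr_tensor C\<^esub> t = Mor (src s \<star>\<^bsub>C\<^esub> src t) (tgt s \<star>\<^bsub>C\<^esub> tgt t)
       (dom_part s \<star>\<^bsub>C\<^esub> dom_part t, cod_part s \<star>\<^bsub>C\<^esub> cod_part t)"
  "unit_ob (arr_tensor C) = Ide C (unit_ob C)"
  "assoc (arr_tensor C) f g h = Mor ((f \<star>\<^bsub>C\<^esub> g) \<star>\<^bsub>C\<^esub> h) (f \<star>\<^bsub>C\<^esub> (g \<star>\<^bsub>C\<^esub> h))
       (assoc C (Dom C f) (Dom C g) (Dom C h), assoc C (Cod C f) (Cod C g) (Cod C h))"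
  "lunit (arr_tensor C) f = Mor (Ide C (unit_ob C) \<star>\<^bsub>C\<^esub> f) f (lunit C (Dom C f), lunit C (Cod C f))"
  "runit (arr_tensor C) f = Mor (f \<star>\<^bsub>C\<^esub> Ide C (unit_ob C)) f (runit C (Dom C f), runit C (Cod C f))"
  by (simp_all add: arr_tensor_def category.extend_def arrow_category_def hom_def[abs_def])

lemma arr_pushout_simps [simp]:
  "Obj (arr_pushout C) = Arr C"
  "Arr (arr_pushout C) = Arr (arrow_category C)"
  "Dom (arr_pushout C) = src"
  "Cod (arr_pushout C) = tgt"
  "Ide (arr_pushout C) f = Mor f f (Ide C (Dom C f), Ide C (Cod C f))"
  "t \<bullet>\<^bsub>arr_pushout C\<^esub> s = Mor (src s) (tgt t) (dom_part t \<bullet>\<^bsub>C\<^esub> dom_part s, cod_part t \<bullet>\<^bsub>C\<^esub> cod_part s)"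
  "hom (arr_pushout C) = hom (arrow_category C)"
  "f \<otimes>\<^bsub>arr_pushout C\<^esub> g = pp C f g"
  "s \<star>\<^bsub>arr_pushout C\<^esub> t = pp_map C s t"
  "unit_ob (arr_pushout C) = pp_unit C"
  "assoc (arr_pushout C) = pp_assoc C"
  "lunit (arr_pushout C) = pp_lunit C"
  "runit (arr_pushout C) = pp_runit C"
  by (simp_all add: arr_pushout_def category.extend_def arrow_category_def hom_def[abs_def])

context monoidal_category
begin

lemma arr_tensor_assoc_hom:
  "\<lbrakk>f \<in> Arr C; g \<in> Arr C; h \<in> Arr C\<rbrakk>
    \<Longrightarrow> assoc (arr_tensor C) f g h \<in> hom (arrow_category C) ((f \<star> g) \<star> h) (f \<star> (g \<star> h))"
  by (simp add: square_iff assoc_nat)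

lemma arr_tensor_lunit_hom:
  "f \<in> Arr C \<Longrightarrow> lunit (arr_tensor C) f \<in> hom (arrow_category C) (Ide C (unit_ob C) \<star> f) f"
  using lunit_natural[of f "Dom C f" "Cod C f"] by (simp add: square_iff hom_iff)

lemma arr_tensor_runit_hom:
  "f \<in> Arr C \<Longrightarrow> runit (arr_tensor C) f \<in> hom (arrow_category C) (f \<star> Ide C (unit_ob C)) f"
  using runit_natural[of f "Dom C f" "Cod C f"] by (simp add: square_iff hom_iff)

lemma tensor_category_arr_tensor: "tensor_category (arr_tensor C)"
proof -
  interpret K: category "arrow_category C"
    by (rule category_arrow_category)
  show ?thesis
  proof unfold_locales
    fix x y z s t
    assume "s \<in> hom (arr_tensor C) x y" "t \<in> hom (arr_tensor C) y z"
    then show "t \<bullet>\<^bsub>arr_tensor C\<^esub> s \<in> hom (arr_tensor C) x z"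
      using K.comp_hom[of s x y t z] by simp
  qed (auto simp: square_iff intro!: square_eqI K.dom_closed K.cod_closed
      dest: K.dom_closed K.cod_closed)
qed

end

context pointed_closed_monoidal
begin

lemma pp_map_parts [simp]:
  "src (pp_map C s t) = pp C (src s) (src t)"
  "tgt (pp_map C s t) = pp C (tgt s) (tgt t)"
  "cod_part (pp_map C s t) = cod_part s \<star> cod_part t"
  by (simp_all add: pp_map_def)

lemma pp_map_dom:
  assumes s: "s \<in> hom K f f'" and t: "t \<in> hom K g g'"
  defines "u \<equiv> dom_part (pp_map C s t)"
  shows "u \<in> Arr C" "Dom C u = Dom C (pp C f g)" "Cod C u = Dom C (pp C f' g')"
    "u \<bullet> pp_in1 C f g = pp_in1 C f' g' \<bullet> (dom_part s \<star> cod_part t)"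
    "u \<bullet> pp_in2 C f g = pp_in2 C f' g' \<bullet> (cod_part s \<star> dom_part t)"
proof -
  have d: "src s = f" "tgt s = f'" "src t = g" "tgt t = g'" "f \<in> Arr C" "f' \<in> Arr C" "g \<in> Arr C" "g' \<in> Arr C"
    "dom_part s \<in> Arr C" "Dom C (dom_part s) = Dom C f" "Cod C (dom_part s) = Dom C f'"
    "cod_part s \<in> Arr C" "Dom C (cod_part s) = Cod C f" "Cod C (cod_part s) = Cod C f'"
    "dom_part t \<in> Arr C" "Dom C (dom_part t) = Dom C g" "Cod C (dom_part t) = Dom C g'"
    "cod_part t \<in> Arr C" "Dom C (cod_part t) = Cod C g" "Cod C (cod_part t) = Cod C g'"
    and sq: "f' \<bullet> dom_part s = cod_part s \<bullet> f" "g' \<bullet> dom_part t = cod_part t \<bullet> g"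
    using s t by (auto simp: square_iff)
  have "pp_in1 C f' g' \<bullet> (dom_part s \<star> (cod_part t \<bullet> g)) = pp_in2 C f' g' \<bullet> ((cod_part s \<bullet> f) \<star> dom_part t)"
    using pp_glue[of f' g' "dom_part s" "dom_part t"] d sq by simp
  then have "(pp_in1 C f' g' \<bullet> (dom_part s \<star> cod_part t)) \<bullet> (Ide C (Dom C f) \<star> g) =
      (pp_in2 C f' g' \<bullet> (cod_part s \<star> dom_part t)) \<bullet> (f \<star> Ide C (Dom C g))"
    using d by simp
  note c = pp_cotuple_simps[OF _ _ _ _ _ _ _ this]
  show "u \<in> Arr C" "Dom C u = Dom C (pp C f g)" "Cod C u = Dom C (pp C f' g')"
    "u \<bullet> pp_in1 C f g = pp_in1 C f' g' \<bullet> (dom_part s \<star> cod_part t)"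
    "u \<bullet> pp_in2 C f g = pp_in2 C f' g' \<bullet> (cod_part s \<star> dom_part t)"
    using c d by (simp_all add: u_def pp_map_def)
qed

lemma pp_map_hom:
  assumes s: "s \<in> hom K f f'" and t: "t \<in> hom K g g'"
  shows "pp_map C s t \<in> hom K (pp C f g) (pp C f' g')"
proof -
  have d: "src s = f" "tgt s = f'" "src t = g" "tgt t = g'" "f \<in> Arr C" "f' \<in> Arr C" "g \<in> Arr C" "g' \<in> Arr C"
    "dom_part s \<in> Arr C" "Dom C (dom_part s) = Dom C f" "Cod C (dom_part s) = Dom C f'"
    "cod_part s \<in> Arr C" "Dom C (cod_part s) = Cod C f" "Cod C (cod_part s) = Cod C f'"
    "dom_part t \<in> Arr C" "Dom C (dom_part t) = Dom C g" "Cod C (dom_part t) = Dom C g'"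
    "cod_part t \<in> Arr C" "Dom C (cod_part t) = Cod C g" "Cod C (cod_part t) = Cod C g'"
    and sq: "f' \<bullet> dom_part s = cod_part s \<bullet> f" "g' \<bullet> dom_part t = cod_part t \<bullet> g"
    using s t by (auto simp: square_iff)
  note u = pp_map_dom[OF s t]
  have "pp C f' g' \<bullet> dom_part (pp_map C s t) = (cod_part s \<star> cod_part t) \<bullet> pp C f g"
  proof (rule pp_arr_eq[of f g])
    show "(pp C f' g' \<bullet> dom_part (pp_map C s t)) \<bullet> pp_in1 C f g = ((cod_part s \<star> cod_part t) \<bullet> pp C f g) \<bullet> pp_in1 C f g"
      using u d sq comp_chain[OF pp_simps(3)[of f' g'], of "dom_part s \<star> cod_part t"] by simp
    show "(pp C f' g' \<bullet> dom_part (pp_map C s t)) \<bullet> pp_in2 C f g = ((cod_part s \<star> cod_part t) \<bullet> pp C f g) \<bullet> pp_in2 C f g"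
      using u d sq comp_chain[OF pp_simps(4)[of f' g'], of "cod_part s \<star> dom_part t"] by simp
  qed (use u d in auto)
  then show ?thesis
    using u d by (simp add: square_iff)
qed

text \<open>
  The equations between maps out of the pushout are checked on its two summands; on codomains they hold by
  functoriality of the tensor product of \<open>C\<close>.
\<close>

lemma tensor_category_arr_pushout: "tensor_category (arr_pushout C)"
proof -
  interpret K: category K
    by (rule category_arrow_category)
  show ?thesis
  proof unfold_locales
    fix x y z s t
    assume "s \<in> hom (arr_pushout C) x y" "t \<in> hom (arr_pushout C) y z"
    then show "t \<bullet>\<^bsub>arr_pushout C\<^esub> s \<in> hom (arr_pushout C) x z"
      using K.comp_hom[of s x y t z] by simp
  next
    fix f g
    assume "f \<in> Obj (arr_pushout C)" "g \<in> Obj (arr_pushout C)"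
    then have fg: "f \<in> Arr C" "g \<in> Arr C"
      by auto
    then have i: "Ide K f \<in> hom K f f" "Ide K g \<in> hom K g g"
      by (auto intro!: K.ide_hom simp del: arrow_category_simps(4))
    note u = pp_map_dom[OF i]
    have "dom_part (pp_map C (Ide K f) (Ide K g)) = Ide C (Dom C (pp C f g))"
      by (rule pp_arr_eq[of f g]) (use u fg in auto)
    then show "Ide (arr_pushout C) f \<star>\<^bsub>arr_pushout C\<^esub> Ide (arr_pushout C) g
        = Ide (arr_pushout C) (f \<otimes>\<^bsub>arr_pushout C\<^esub> g)"
      using fg by (intro square_eqI) auto
  next
    fix f f' f'' g g' g'' s s' t t'
    assume "s \<in> hom (arr_pushout C) f f'" "s' \<in> hom (arr_pushout C) f' f''"
      "t \<in> hom (arr_pushout C) g g'" "t' \<in> hom (arr_pushout C) g' g''"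
    then have h: "s \<in> hom K f f'" "s' \<in> hom K f' f''" "t \<in> hom K g g'" "t' \<in> hom K g' g''"
      by auto
    note u = pp_map_dom[OF h(1,3)] and u' = pp_map_dom[OF h(2,4)]
      and u'' = pp_map_dom[OF K.comp_hom[OF h(1,2)] K.comp_hom[OF h(3,4)]]
    have d: "src s = f" "src t = g" "tgt s' = f''" "tgt t' = g''" "tgt s = f'" "tgt t = g'" "src s' = f'" "src t' = g'"
      "f \<in> Arr C" "f' \<in> Arr C" "g \<in> Arr C" "g' \<in> Arr C" "f'' \<in> Arr C" "g'' \<in> Arr C"
      "dom_part s \<in> Arr C" "Dom C (dom_part s) = Dom C f" "Cod C (dom_part s) = Dom C f'"
      "cod_part s \<in> Arr C" "Dom C (cod_part s) = Cod C f" "Cod C (cod_part s) = Cod C f'"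
      "dom_part t \<in> Arr C" "Dom C (dom_part t) = Dom C g" "Cod C (dom_part t) = Dom C g'"
      "cod_part t \<in> Arr C" "Dom C (cod_part t) = Cod C g" "Cod C (cod_part t) = Cod C g'"
      "dom_part s' \<in> Arr C" "Dom C (dom_part s') = Dom C f'" "Cod C (dom_part s') = Dom C f''"
      "cod_part s' \<in> Arr C" "Dom C (cod_part s') = Cod C f'" "Cod C (cod_part s') = Cod C f''"
      "dom_part t' \<in> Arr C" "Dom C (dom_part t') = Dom C g'" "Cod C (dom_part t') = Dom C g''"
      "cod_part t' \<in> Arr C" "Dom C (cod_part t') = Cod C g'" "Cod C (cod_part t') = Cod C g''"
      using h by (auto simp: square_iff)
    have "dom_part (pp_map C (s' \<bullet>\<^bsub>K\<^esub> s) (t' \<bullet>\<^bsub>K\<^esub> t)) = dom_part (pp_map C s' t') \<bullet> dom_part (pp_map C s t)"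
    proof (rule pp_arr_eq[of f g])
      show "dom_part (pp_map C (s' \<bullet>\<^bsub>K\<^esub> s) (t' \<bullet>\<^bsub>K\<^esub> t)) \<bullet> pp_in1 C f g
          = (dom_part (pp_map C s' t') \<bullet> dom_part (pp_map C s t)) \<bullet> pp_in1 C f g"
        using d u u' u''(4) comp_chain[OF u'(4), of "dom_part s \<star> cod_part t"] by simp
      show "dom_part (pp_map C (s' \<bullet>\<^bsub>K\<^esub> s) (t' \<bullet>\<^bsub>K\<^esub> t)) \<bullet> pp_in2 C f g
          = (dom_part (pp_map C s' t') \<bullet> dom_part (pp_map C s t)) \<bullet> pp_in2 C f g"
        using d u u' u''(5) comp_chain[OF u'(5), of "cod_part s \<star> dom_part t"] by simp
    qed (use d u u' u'' in auto)
    then show "(s' \<bullet>\<^bsub>arr_pushout C\<^esub> s) \<star>\<^bsub>arr_pushout C\<^esub> (t' \<bullet>\<^bsub>arr_pushout C\<^esub> t)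
        = (s' \<star>\<^bsub>arr_pushout C\<^esub> t') \<bullet>\<^bsub>arr_pushout C\<^esub> (s \<star>\<^bsub>arr_pushout C\<^esub> t)"
      using d by (intro square_eqI) auto
  qed (auto simp: square_iff pp_map_hom[unfolded square_iff] intro!: square_eqI
      dest: K.dom_closed K.cod_closed)
qed

lemma pp_unit_simps [simp]:
  "pp_unit C \<in> Arr C" "Dom C (pp_unit C) = zero_ob C" "Cod C (pp_unit C) = unit_ob C"
  by (simp_all add: pp_unit_def)

text \<open>
  The summand \<open>0 \<otimes> X1\<close> of the domain is initial, so a map out of the domain is determined on \<open>S \<otimes> X0\<close>,
  and any map on \<open>S \<otimes> X0\<close> extends.
\<close>

lemma pp_lunit_hom:
  assumes f: "f \<in> Arr C"
  shows "pp_lunit C f \<in> hom K (pp C (pp_unit C) f) f"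
proof -
  let ?P = "\<lambda>u. u \<in> hom C (Dom C (pp C (pp_unit C) f)) (Dom C f) \<and> u \<bullet> pp_in2 C (pp_unit C) f = lunit C (Dom C f)"
  have eq: "a = b" if "a \<in> Arr C" "b \<in> Arr C" "Dom C a = Dom C (pp C (pp_unit C) f)" "Dom C b = Dom C (pp C (pp_unit C) f)"
    "Cod C a = Cod C b" "a \<bullet> pp_in2 C (pp_unit C) f = b \<bullet> pp_in2 C (pp_unit C) f" for a b
  proof (rule pp_arr_eq[of "pp_unit C" f])
    show "a \<bullet> pp_in1 C (pp_unit C) f = b \<bullet> pp_in1 C (pp_unit C) f"
      by (rule zero_tensor_eq[of "Cod C f"]) (use that f in auto)
  qed (use that f in auto)
  let ?z = "zero_map (zero_ob C \<otimes> Cod C f) (Dom C f)"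
  have "?z \<bullet> (Ide C (zero_ob C) \<star> f) = lunit C (Dom C f) \<bullet> (pp_unit C \<star> Ide C (Dom C f))"
    by (rule zero_tensor_eq[of "Dom C f"]) (use f in auto)
  with f pp_cotuple_simps[of "pp_unit C" f ?z "lunit C (Dom C f)"]
  have Pu: "?P (pp_cotuple C (pp_unit C) f ?z (lunit C (Dom C f)))"
    by (simp add: hom_iff)
  define u where "u = pp_cotuple C (pp_unit C) f ?z (lunit C (Dom C f))"
  have the: "(THE u. ?P u) = u"
    unfolding u_def by (rule the_equality[of ?P, OF Pu]) (rule eq, use f Pu in \<open>auto simp: hom_iff\<close>)
  have u: "u \<in> Arr C" "Dom C u = Dom C (pp C (pp_unit C) f)" "Cod C u = Dom C f"
    "u \<bullet> pp_in2 C (pp_unit C) f = lunit C (Dom C f)"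
    using Pu unfolding u_def by (auto simp: hom_iff)
  have "f \<bullet> u = lunit C (Cod C f) \<bullet> pp C (pp_unit C) f"
    by (rule eq) (use u f lunit_natural[of f "Dom C f" "Cod C f"] in \<open>auto simp: hom_iff\<close>)
  then show ?thesis
    using u f by (simp add: pp_lunit_def square_iff the)
qed

lemma pp_runit_hom:
  assumes f: "f \<in> Arr C"
  shows "pp_runit C f \<in> hom K (pp C f (pp_unit C)) f"
proof -
  let ?P = "\<lambda>u. u \<in> hom C (Dom C (pp C f (pp_unit C))) (Dom C f) \<and> u \<bullet> pp_in1 C f (pp_unit C) = runit C (Dom C f)"
  have eq: "a = b" if "a \<in> Arr C" "b \<in> Arr C" "Dom C a = Dom C (pp C f (pp_unit C))" "Dom C b = Dom C (pp C f (pp_unit C))"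
    "Cod C a = Cod C b" "a \<bullet> pp_in1 C f (pp_unit C) = b \<bullet> pp_in1 C f (pp_unit C)" for a b
  proof (rule pp_arr_eq[of f "pp_unit C"])
    show "a \<bullet> pp_in2 C f (pp_unit C) = b \<bullet> pp_in2 C f (pp_unit C)"
      by (rule tensor_zero_eq[of "Cod C f"]) (use that f in auto)
  qed (use that f in auto)
  let ?z = "zero_map (Cod C f \<otimes> zero_ob C) (Dom C f)"
  have "runit C (Dom C f) \<bullet> (Ide C (Dom C f) \<star> pp_unit C) = ?z \<bullet> (f \<star> Ide C (zero_ob C))"
    by (rule tensor_zero_eq[of "Dom C f"]) (use f in auto)
  with f pp_cotuple_simps[of f "pp_unit C" "runit C (Dom C f)" ?z]
  have Pu: "?P (pp_cotuple C f (pp_unit C) (runit C (Dom C f)) ?z)"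
    by (simp add: hom_iff)
  define u where "u = pp_cotuple C f (pp_unit C) (runit C (Dom C f)) ?z"
  have the: "(THE u. ?P u) = u"
    unfolding u_def by (rule the_equality[of ?P, OF Pu]) (rule eq, use f Pu in \<open>auto simp: hom_iff\<close>)
  have u: "u \<in> Arr C" "Dom C u = Dom C (pp C f (pp_unit C))" "Cod C u = Dom C f"
    "u \<bullet> pp_in1 C f (pp_unit C) = runit C (Dom C f)"
    using Pu unfolding u_def by (auto simp: hom_iff)
  have "f \<bullet> u = runit C (Cod C f) \<bullet> pp C f (pp_unit C)"
    by (rule eq) (use u f runit_natural[of f "Dom C f" "Cod C f"] in \<open>auto simp: hom_iff\<close>)
  then show ?thesis
    using u f by (simp add: pp_runit_def square_iff the)
qed

text \<open>
  The pushout in the domain of a pushout product stays a pushout after tensoring.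
\<close>

lemma pp_tensor_arr_eq:
  assumes fg: "f \<in> Arr C" "g \<in> Arr C" and z: "z \<in> Obj C"
    and ab: "a \<in> Arr C" "b \<in> Arr C" "Dom C a = Dom C (pp C f g) \<otimes> z" "Dom C b = Dom C (pp C f g) \<otimes> z"
    and eq: "a \<bullet> (pp_in1 C f g \<star> Ide C z) = b \<bullet> (pp_in1 C f g \<star> Ide C z)"
      "a \<bullet> (pp_in2 C f g \<star> Ide C z) = b \<bullet> (pp_in2 C f g \<star> Ide C z)"
  shows "a = b"
  by (rule is_pushout_arr_eq[OF tensor_pushout[OF pp_pushout[OF fg] z]]) (use assms in auto)

text \<open>
  The pushout in the domain of \<open>f \<box> g\<close> is preserved by \<open>- \<otimes> Z1\<close>. So a map out of the domain of
  \<open>(f \<box> g) \<box> h\<close> is given by its restrictions to \<open>(X0 \<otimes> Y1) \<otimes> Z1\<close>, \<open>(X1 \<otimes> Y0) \<otimes> Z1\<close> and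
  \<open>(X1 \<otimes> Y1) \<otimes> Z0\<close>, which have to agree pairwise on the overlaps. The restrictions \<open>a1\<close>, \<open>a2\<close>, \<open>a3\<close>
  that define the associator agree by naturality of the associator of \<open>C\<close> and by the gluing in the domain
  of \<open>f \<box> (g \<box> h)\<close>.
\<close>

lemma pp_assoc_hom:
  assumes f: "f \<in> Arr C" and g: "g \<in> Arr C" and h: "h \<in> Arr C"
  shows "pp_assoc C f g h \<in> hom K (pp C (pp C f g) h) (pp C f (pp C g h))"
proof -
  note fgh [simp] = f g h
  let ?X = "Dom C (pp C (pp C f g) h)" and ?Y = "Dom C (pp C f (pp C g h))"
  let ?z1 = "Ide C (Cod C h)" and ?z0 = "Ide C (Dom C h)" and ?x0 = "Ide C (Dom C f)" and ?x1 = "Ide C (Cod C f)"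
  define a1 where "a1 = pp_in1 C f (pp C g h) \<bullet> assoc C (Dom C f) (Cod C g) (Cod C h)"
  define a2 where "a2 = pp_in2 C f (pp C g h) \<bullet> (?x1 \<star> pp_in1 C g h) \<bullet> assoc C (Cod C f) (Dom C g) (Cod C h)"
  define a3 where "a3 = pp_in2 C f (pp C g h) \<bullet> (?x1 \<star> pp_in2 C g h) \<bullet> assoc C (Cod C f) (Cod C g) (Dom C h)"
  have a [simp]: "a1 \<in> Arr C" "Dom C a1 = (Dom C f \<otimes> Cod C g) \<otimes> Cod C h" "Cod C a1 = ?Y"
    "a2 \<in> Arr C" "Dom C a2 = (Cod C f \<otimes> Dom C g) \<otimes> Cod C h" "Cod C a2 = ?Y"
    "a3 \<in> Arr C" "Dom C a3 = (Cod C f \<otimes> Cod C g) \<otimes> Dom C h" "Cod C a3 = ?Y"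
    by (auto simp: a1_def a2_def a3_def)
  have glue: "pp_in1 C f (pp C g h) \<bullet> (?x0 \<star> (pp C g h \<bullet> k)) = pp_in2 C f (pp C g h) \<bullet> (f \<star> k)"
    if "k \<in> Arr C" "Cod C k = Dom C (pp C g h)" for k
    using pp_glue[of f "pp C g h" ?x0 k] that by simp
  \<comment> \<open>Agreement on \<open>(X0 \<otimes> Y0) \<otimes> Z1\<close>, and then on the other two overlaps.\<close>
  have a12: "a1 \<bullet> ((?x0 \<star> g) \<star> ?z1) = a2 \<bullet> ((f \<star> Ide C (Dom C g)) \<star> ?z1)"
  proof -
    have "a1 \<bullet> ((?x0 \<star> g) \<star> ?z1) = (pp_in1 C f (pp C g h) \<bullet> (?x0 \<star> (g \<star> ?z1))) \<bullet> assoc C (Dom C f) (Dom C g) (Cod C h)"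
      using assoc_nat[of ?x0 g ?z1] by (simp add: a1_def)
    also have "\<dots> = (pp_in2 C f (pp C g h) \<bullet> (f \<star> pp_in1 C g h)) \<bullet> assoc C (Dom C f) (Dom C g) (Cod C h)"
      using glue[of "pp_in1 C g h"] by simp
    also have "\<dots> = a2 \<bullet> ((f \<star> Ide C (Dom C g)) \<star> ?z1)"
      using assoc_nat[of f "Ide C (Dom C g)" ?z1] by (simp add: a2_def)
    finally show ?thesis .
  qed
  have a13: "a1 \<bullet> (Ide C (Dom C f \<otimes> Cod C g) \<star> h) = a3 \<bullet> ((f \<star> Ide C (Cod C g)) \<star> ?z0)"
  proof -
    have "a1 \<bullet> (Ide C (Dom C f \<otimes> Cod C g) \<star> h)
        = (pp_in1 C f (pp C g h) \<bullet> (?x0 \<star> (Ide C (Cod C g) \<star> h))) \<bullet> assoc C (Dom C f) (Cod C g) (Dom C h)"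
      using assoc_nat[of ?x0 "Ide C (Cod C g)" h] by (simp add: a1_def)
    also have "\<dots> = (pp_in2 C f (pp C g h) \<bullet> (f \<star> pp_in2 C g h)) \<bullet> assoc C (Dom C f) (Cod C g) (Dom C h)"
      using glue[of "pp_in2 C g h"] by simp
    also have "\<dots> = a3 \<bullet> ((f \<star> Ide C (Cod C g)) \<star> ?z0)"
      using assoc_nat[of f "Ide C (Cod C g)" ?z0] by (simp add: a3_def)
    finally show ?thesis .
  qed
  have a23: "a2 \<bullet> (Ide C (Cod C f \<otimes> Dom C g) \<star> h) = a3 \<bullet> ((?x1 \<star> g) \<star> ?z0)"
  proof -
    have "a2 \<bullet> (Ide C (Cod C f \<otimes> Dom C g) \<star> h)
        = pp_in2 C f (pp C g h) \<bullet> (?x1 \<star> (pp_in1 C g h \<bullet> (Ide C (Dom C g) \<star> h))) \<bullet> assoc C (Cod C f) (Dom C g) (Dom C h)"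
      using assoc_nat[of ?x1 "Ide C (Dom C g)" h] by (simp add: a2_def)
    also have "\<dots> = pp_in2 C f (pp C g h) \<bullet> (?x1 \<star> (pp_in2 C g h \<bullet> (g \<star> ?z0))) \<bullet> assoc C (Cod C f) (Dom C g) (Dom C h)"
      using pp_glue[of g h "Ide C (Dom C g)" ?z0] by simp
    also have "\<dots> = a3 \<bullet> ((?x1 \<star> g) \<star> ?z0)"
      using assoc_nat[of ?x1 g ?z0] by (simp add: a3_def)
    finally show ?thesis .
  qed
  have "\<exists>!u. u \<in> hom C (Cod C (pp_in1 C f g \<star> ?z1)) (Cod C a1) \<and>
      u \<bullet> (pp_in1 C f g \<star> ?z1) = a1 \<and> u \<bullet> (pp_in2 C f g \<star> ?z1) = a2"
    by (rule is_pushout_ex1[OF tensor_pushout[OF pp_pushout]]) (use a12 in auto)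
  then obtain v where v: "v \<in> Arr C" "Dom C v = Dom C (pp C f g) \<otimes> Cod C h" "Cod C v = ?Y"
    "v \<bullet> (pp_in1 C f g \<star> ?z1) = a1" "v \<bullet> (pp_in2 C f g \<star> ?z1) = a2"
    by (auto simp: hom_iff)
  \<comment> \<open>The map \<open>v\<close> glued from \<open>a1\<close> and \<open>a2\<close> agrees with \<open>a3\<close> on \<open>Dom (f \<box> g) \<otimes> Z0\<close>: this object
    is itself glued from the two overlaps with the third summand.\<close>
  have va: "v \<bullet> (Ide C (Dom C (pp C f g)) \<star> h) = a3 \<bullet> (pp C f g \<star> ?z0)"
  proof (rule pp_tensor_arr_eq[OF f g])
    have "(v \<bullet> (Ide C (Dom C (pp C f g)) \<star> h)) \<bullet> (pp_in1 C f g \<star> ?z0)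
        = (v \<bullet> (pp_in1 C f g \<star> ?z1)) \<bullet> (Ide C (Dom C f \<otimes> Cod C g) \<star> h)"
      using v(1-3) by simp
    then show "(v \<bullet> (Ide C (Dom C (pp C f g)) \<star> h)) \<bullet> (pp_in1 C f g \<star> ?z0) = (a3 \<bullet> (pp C f g \<star> ?z0)) \<bullet> (pp_in1 C f g \<star> ?z0)"
      by (simp add: v(4) a13)
    have "(v \<bullet> (Ide C (Dom C (pp C f g)) \<star> h)) \<bullet> (pp_in2 C f g \<star> ?z0)
        = (v \<bullet> (pp_in2 C f g \<star> ?z1)) \<bullet> (Ide C (Cod C f \<otimes> Dom C g) \<star> h)"
      using v(1-3) by simp
    then show "(v \<bullet> (Ide C (Dom C (pp C f g)) \<star> h)) \<bullet> (pp_in2 C f g \<star> ?z0) = (a3 \<bullet> (pp C f g \<star> ?z0)) \<bullet> (pp_in2 C f g \<star> ?z0)"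
      by (simp add: v(5) a23)
  qed (use v in auto)
  let ?P = "\<lambda>u. u \<in> hom C ?X ?Y \<and> u \<bullet> pp_in1 C (pp C f g) h \<bullet> (pp_in1 C f g \<star> ?z1) = a1 \<and>
    u \<bullet> pp_in1 C (pp C f g) h \<bullet> (pp_in2 C f g \<star> ?z1) = a2 \<and> u \<bullet> pp_in2 C (pp C f g) h = a3"
  have eq: "u = w" if "u \<in> Arr C" "w \<in> Arr C" "Dom C u = ?X" "Dom C w = ?X"
    "u \<bullet> pp_in1 C (pp C f g) h \<bullet> (pp_in1 C f g \<star> ?z1) = w \<bullet> pp_in1 C (pp C f g) h \<bullet> (pp_in1 C f g \<star> ?z1)"
    "u \<bullet> pp_in1 C (pp C f g) h \<bullet> (pp_in2 C f g \<star> ?z1) = w \<bullet> pp_in1 C (pp C f g) h \<bullet> (pp_in2 C f g \<star> ?z1)"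
    "u \<bullet> pp_in2 C (pp C f g) h = w \<bullet> pp_in2 C (pp C f g) h" for u w
  proof (rule pp_arr_eq[of "pp C f g" h])
    show "u \<bullet> pp_in1 C (pp C f g) h = w \<bullet> pp_in1 C (pp C f g) h"
      by (rule pp_tensor_arr_eq[OF f g, of "Cod C h"]) (use that in auto)
  qed (use that in auto)
  define u where "u = pp_cotuple C (pp C f g) h v a3"
  have u: "u \<in> Arr C" "Dom C u = ?X" "Cod C u = ?Y" "u \<bullet> pp_in1 C (pp C f g) h = v" "u \<bullet> pp_in2 C (pp C f g) h = a3"
    unfolding u_def using pp_cotuple_simps[of "pp C f g" h v a3] v(1-3) va by auto
  have u1: "u \<bullet> pp_in1 C (pp C f g) h \<bullet> (k \<star> ?z1) = v \<bullet> (k \<star> ?z1)" if "k \<in> Arr C" "Cod C k = Dom C (pp C f g)" for k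
    using comp_chain[OF u(4)] u that by simp
  have Pu: "?P u"
    using u u1[of "pp_in1 C f g"] u1[of "pp_in2 C f g"] v(4,5) by (simp add: hom_iff)
  have "(THE u. ?P u) = u"
    by (rule the_equality[of ?P, OF Pu]) (rule eq, use Pu in \<open>auto simp: hom_iff\<close>)
  then have dom: "dom_part (pp_assoc C f g h) = u"
    by (simp add: pp_assoc_def a1_def a2_def a3_def)
  have "pp C f (pp C g h) \<bullet> u = assoc C (Cod C f) (Cod C g) (Cod C h) \<bullet> pp C (pp C f g) h"
  proof (rule eq)
    have c1: "pp C f (pp C g h) \<bullet> (pp_in1 C f (pp C g h) \<bullet> k) = (f \<star> Ide C (Cod C g \<otimes> Cod C h)) \<bullet> k"
      if "k \<in> Arr C" "Cod C k = Dom C f \<otimes> (Cod C g \<otimes> Cod C h)" for k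
      using comp_chain[OF pp_simps(3)[of f "pp C g h"], of k] that by simp
    have c2: "pp C f (pp C g h) \<bullet> (pp_in2 C f (pp C g h) \<bullet> k) = (?x1 \<star> pp C g h) \<bullet> k"
      if "k \<in> Arr C" "Cod C k = Cod C f \<otimes> Dom C (pp C g h)" for k
      using comp_chain[OF pp_simps(4)[of f "pp C g h"], of k] that by simp
    have d1: "pp C (pp C f g) h \<bullet> (pp_in1 C (pp C f g) h \<bullet> k) = (pp C f g \<star> ?z1) \<bullet> k"
      if "k \<in> Arr C" "Cod C k = Dom C (pp C f g) \<otimes> Cod C h" for k
      using comp_chain[OF pp_simps(3)[of "pp C f g" h], of k] that by simp
    show "(pp C f (pp C g h) \<bullet> u) \<bullet> pp_in1 C (pp C f g) h \<bullet> (pp_in1 C f g \<star> ?z1)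
        = (assoc C (Cod C f) (Cod C g) (Cod C h) \<bullet> pp C (pp C f g) h) \<bullet> pp_in1 C (pp C f g) h \<bullet> (pp_in1 C f g \<star> ?z1)"
      using u(1-3) u1[of "pp_in1 C f g"] v(4) assoc_nat[of f "Ide C (Cod C g)" ?z1] by (simp add: a1_def c1 d1)
    show "(pp C f (pp C g h) \<bullet> u) \<bullet> pp_in1 C (pp C f g) h \<bullet> (pp_in2 C f g \<star> ?z1)
        = (assoc C (Cod C f) (Cod C g) (Cod C h) \<bullet> pp C (pp C f g) h) \<bullet> pp_in1 C (pp C f g) h \<bullet> (pp_in2 C f g \<star> ?z1)"
      using u(1-3) u1[of "pp_in2 C f g"] v(5) assoc_nat[of ?x1 g ?z1] by (simp add: a2_def c2 d1)
    show "(pp C f (pp C g h) \<bullet> u) \<bullet> pp_in2 C (pp C f g) h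
        = (assoc C (Cod C f) (Cod C g) (Cod C h) \<bullet> pp C (pp C f g) h) \<bullet> pp_in2 C (pp C f g) h"
      using u(1-3,5) assoc_nat[of ?x1 "Ide C (Cod C g)" h] by (simp add: a3_def c2)
  qed (use u in auto)
  then show ?thesis
    using u dom by (simp add: square_iff) (simp add: pp_assoc_def)
qed

end

section \<open>Lifting an adjunction to structured objects\<close>

text \<open>
  Monoids, and modules over a fixed monoid, are both of this kind: objects \<open>X \<in> S\<close> with an underlying object
  \<open>U X\<close> of \<open>A\<close>, and as morphisms those arrows of \<open>A\<close> that satisfy a condition \<open>H\<close>.
\<close>

definition structured_category :: "('o, 'a, 'm) category_scheme \<Rightarrow> 'x set \<Rightarrow> ('x \<Rightarrow> 'o)
    \<Rightarrow> ('x \<Rightarrow> 'x \<Rightarrow> 'a \<Rightarrow> bool) \<Rightarrow> ('x, ('x, 'a) mor) category" where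
  "structured_category A S U H = \<lparr>Obj = S,
    Arr = {Mor X Y s | X Y s. X \<in> S \<and> Y \<in> S \<and> s \<in> hom A (U X) (U Y) \<and> H X Y s},
    Dom = src, Cod = tgt,
    Ide = (\<lambda>X. Mor X X (Ide A (U X))),
    Comp = (\<lambda>g f. Mor (src f) (tgt g) (the_map g \<bullet>\<^bsub>A\<^esub> the_map f))\<rparr>"

definition structured_functor :: "('x \<Rightarrow> 'y) \<Rightarrow> ('o1, 'a1, 'o2, 'a2) func
    \<Rightarrow> ('x, ('x, 'a1) mor, 'y, ('y, 'a2) mor) func" where
  "structured_functor F0 F = \<lparr>FO = F0, FA = (\<lambda>h. Mor (F0 (src h)) (F0 (tgt h)) (FA F (the_map h)))\<rparr>"

lemma structured_simps:
  "Obj (structured_category A S U H) = S"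
  "Ide (structured_category A S U H) X = Mor X X (Ide A (U X))"
  "g \<bullet>\<^bsub>structured_category A S U H\<^esub> f = Mor (src f) (tgt g) (the_map g \<bullet>\<^bsub>A\<^esub> the_map f)"
  "h \<in> hom (structured_category A S U H) X Y \<longleftrightarrow> src h = X \<and> tgt h = Y \<and> X \<in> S \<and> Y \<in> S \<and>
    the_map h \<in> hom A (U X) (U Y) \<and> H X Y (the_map h)"
  by (auto simp: structured_category_def hom_def) (metis mor.collapse)

lemma structured_functor_simps:
  "FO (structured_functor F0 F) X = F0 X"
  "FA (structured_functor F0 F) h = Mor (F0 (src h)) (F0 (tgt h)) (FA F (the_map h))"
  by (simp_all add: structured_functor_def)

lemma cat_functor_structured:
  assumes F: "cat_functor A B F"
    and cats: "category (structured_category A S U H)" "category (structured_category B S' U' H')"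
    and F0: "\<And>X. X \<in> S \<Longrightarrow> U X \<in> Obj A \<and> F0 X \<in> S' \<and> U' (F0 X) = FO F (U X)"
    and FH: "\<And>X Y s. \<lbrakk>X \<in> S; Y \<in> S; s \<in> hom A (U X) (U Y); H X Y s\<rbrakk> \<Longrightarrow> H' (F0 X) (F0 Y) (FA F s)"
  shows "cat_functor (structured_category A S U H) (structured_category B S' U' H') (structured_functor F0 F)"
proof -
  interpret F: cat_functor A B F
    by (fact F)
  show ?thesis
  proof (rule cat_functor.intro[OF cats], unfold_locales)
    fix h X Y
    assume "h \<in> hom (structured_category A S U H) X Y"
    then show "FA (structured_functor F0 F) h
        \<in> hom (structured_category B S' U' H') (FO (structured_functor F0 F) X) (FO (structured_functor F0 F) Y)"
      using F0[of X] F0[of Y] FH[of X Y "the_map h"] F.FA_hom[of "the_map h" "U X" "U Y"]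
      by (simp add: structured_simps structured_functor_simps)
  next
    fix h k X Y Z
    assume "h \<in> hom (structured_category A S U H) X Y" "k \<in> hom (structured_category A S U H) Y Z"
    then show "FA (structured_functor F0 F) (k \<bullet>\<^bsub>structured_category A S U H\<^esub> h)
        = FA (structured_functor F0 F) k \<bullet>\<^bsub>structured_category B S' U' H'\<^esub> FA (structured_functor F0 F) h"
      using F.FA_comp[of "the_map h" "U X" "U Y" "the_map k" "U Z"]
      by (simp add: structured_simps structured_functor_simps)
  qed (use F0 F.FA_ide in \<open>auto simp: structured_simps structured_functor_simps\<close>)
qed

text \<open>
  If the functors of an adjunction lift to structured objects, and an arrow is structure-preserving exactly
  when its transpose is, then the lifted functors are adjoint by restriction of the same bijection.
\<close>

lemma right_adjoint_structured:
  fixes A :: "('o1, 'a1, 'm1) category_scheme" and B :: "('o2, 'a2, 'm2) category_scheme"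
    and S :: "'x set" and S' :: "'y set"
  assumes F: "cat_functor A B F" and G: "cat_functor B A G" and \<phi>: "adjunction_bijection A B F G \<phi>"
    and cats: "category (structured_category A S U H)" "category (structured_category B S' U' H')"
    and F0: "\<And>X. X \<in> S \<Longrightarrow> U X \<in> Obj A \<and> F0 X \<in> S' \<and> U' (F0 X) = FO F (U X)"
    and G0: "\<And>Y. Y \<in> S' \<Longrightarrow> U' Y \<in> Obj B \<and> G0 Y \<in> S \<and> U (G0 Y) = FO G (U' Y)"
    and FH: "\<And>X Y s. \<lbrakk>X \<in> S; Y \<in> S; s \<in> hom A (U X) (U Y); H X Y s\<rbrakk> \<Longrightarrow> H' (F0 X) (F0 Y) (FA F s)"
    and GH: "\<And>X Y s. \<lbrakk>X \<in> S'; Y \<in> S'; s \<in> hom B (U' X) (U' Y); H' X Y s\<rbrakk> \<Longrightarrow> H (G0 X) (G0 Y) (FA G s)"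
    and \<phi>H: "\<And>X Y s. \<lbrakk>X \<in> S; Y \<in> S'; s \<in> hom B (FO F (U X)) (U' Y)\<rbrakk>
      \<Longrightarrow> H' (F0 X) Y s \<longleftrightarrow> H X (G0 Y) (\<phi> (U X) (U' Y) s)"
  shows "right_adjoint (structured_category A S U H) (structured_category B S' U' H')
    (structured_functor F0 F) (structured_functor G0 G)"
proof -
  let ?A = "structured_category A S U H" and ?B = "structured_category B S' U' H'"
  let ?F = "structured_functor F0 F" and ?G = "structured_functor G0 G"
  define \<psi> where "\<psi> X Y h = Mor X (G0 Y) (\<phi> (U X) (U' Y) (the_map h))" for X Y and h :: "('y, 'a2) mor"
  have bij: "bij_betw (\<phi> a b) (hom B (FO F a) b) (hom A a (FO G b))" if "a \<in> Obj A" "b \<in> Obj B" for a b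
    using \<phi> that by (simp add: adjunction_bijection_def)
  have "adjunction_bijection ?A ?B ?F ?G \<psi>"
    unfolding adjunction_bijection_def
  proof (intro conjI ballI)
    fix X Y
    assume "X \<in> Obj ?A" "Y \<in> Obj ?B"
    then have XY: "X \<in> S" "Y \<in> S'"
      by (auto simp: structured_simps)
    note X = F0[OF XY(1)] and Y = G0[OF XY(2)]
    note b = bij[of "U X" "U' Y"]
    show "bij_betw (\<psi> X Y) (hom ?B (FO ?F X) Y) (hom ?A X (FO ?G Y))"
      unfolding bij_betw_def
    proof
      show "inj_on (\<psi> X Y) (hom ?B (FO ?F X) Y)"
      proof (rule inj_onI)
        fix h k
        assume h: "h \<in> hom ?B (FO ?F X) Y" and k: "k \<in> hom ?B (FO ?F X) Y" and eq: "\<psi> X Y h = \<psi> X Y k"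
        have "the_map h = the_map k"
          by (rule inj_onD[OF bij_betw_imp_inj_on[OF b]])
            (use h k eq X Y in \<open>auto simp: structured_simps structured_functor_simps \<psi>_def\<close>)
        then show "h = k"
          using h k by (auto simp: structured_simps structured_functor_simps intro: mor.expand)
      qed
      show "\<psi> X Y ` hom ?B (FO ?F X) Y = hom ?A X (FO ?G Y)"
      proof
        show "\<psi> X Y ` hom ?B (FO ?F X) Y \<subseteq> hom ?A X (FO ?G Y)"
        proof (rule image_subsetI)
          fix h
          assume "h \<in> hom ?B (FO ?F X) Y"
          then show "\<psi> X Y h \<in> hom ?A X (FO ?G Y)"
            using X Y XY \<phi>H[of X Y "the_map h"] bij_betwE[OF b]
            by (simp add: structured_simps structured_functor_simps \<psi>_def)
        qed
        show "hom ?A X (FO ?G Y) \<subseteq> \<psi> X Y ` hom ?B (FO ?F X) Y"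
        proof
          fix k
          assume k: "k \<in> hom ?A X (FO ?G Y)"
          then have "the_map k \<in> \<phi> (U X) (U' Y) ` hom B (FO F (U X)) (U' Y)"
            using X Y bij_betw_imp_surj_on[OF b] by (simp add: structured_simps structured_functor_simps)
          then obtain s where s: "s \<in> hom B (FO F (U X)) (U' Y)" "the_map k = \<phi> (U X) (U' Y) s"
            by blast
          have "k = \<psi> X Y (Mor (F0 X) Y s)"
            using k s by (intro mor.expand) (simp add: structured_simps structured_functor_simps \<psi>_def)
          moreover have "Mor (F0 X) Y s \<in> hom ?B (FO ?F X) Y"
            using k s X Y XY \<phi>H[of X Y s] by (simp add: structured_simps structured_functor_simps)
          ultimately show "k \<in> \<psi> X Y ` hom ?B (FO ?F X) Y"
            by blast
        qed
      qed
    qed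
  next
    fix X X' Y Y' h g k
    assume XY: "X \<in> Obj ?A" "X' \<in> Obj ?A" "Y \<in> Obj ?B" "Y' \<in> Obj ?B"
      and h: "h \<in> hom ?A X' X" and g: "g \<in> hom ?B (FO ?F X) Y" and k: "k \<in> hom ?B Y Y'"
    have o: "U X \<in> Obj A" "U X' \<in> Obj A" "U' Y \<in> Obj B" "U' Y' \<in> Obj B"
      using XY F0 G0 by (auto simp: structured_simps)
    have m: "the_map h \<in> hom A (U X') (U X)" "the_map g \<in> hom B (FO F (U X)) (U' Y)" "the_map k \<in> hom B (U' Y) (U' Y')"
      using h g k XY F0 by (auto simp: structured_simps structured_functor_simps)
    have "\<phi> (U X') (U' Y') (the_map k \<bullet>\<^bsub>B\<^esub> the_map g \<bullet>\<^bsub>B\<^esub> FA F (the_map h))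
        = FA G (the_map k) \<bullet>\<^bsub>A\<^esub> \<phi> (U X) (U' Y) (the_map g) \<bullet>\<^bsub>A\<^esub> the_map h"
      using \<phi> o m unfolding adjunction_bijection_def by blast
    then show "\<psi> X' Y' (k \<bullet>\<^bsub>?B\<^esub> g \<bullet>\<^bsub>?B\<^esub> FA ?F h) = FA ?G k \<bullet>\<^bsub>?A\<^esub> \<psi> X Y g \<bullet>\<^bsub>?A\<^esub> h"
      using h k by (simp add: structured_simps structured_functor_simps \<psi>_def)
  qed
  moreover have "cat_functor ?A ?B ?F"
    using F cats F0 FH by (rule cat_functor_structured)
  moreover have "cat_functor ?B ?A ?G"
    using G cats(2,1) G0 GH by (rule cat_functor_structured)
  ultimately show ?thesis
    by (auto simp: right_adjoint_iff)
qed

section \<open>Monoids and modules in the arrow category\<close>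

definition dom_module :: "('o, 'a, 'm) category_scheme \<Rightarrow> ('a, 'a square) module \<Rightarrow> ('o, 'a) module" where
  "dom_module C X = \<lparr>mod_ob = Dom C (mod_ob X), act = dom_part (act X)\<rparr>"

definition cod_module :: "('o, 'a, 'm) category_scheme \<Rightarrow> ('a, 'a square) module \<Rightarrow> ('o, 'a) module" where
  "cod_module C X = \<lparr>mod_ob = Cod C (mod_ob X), act = cod_part (act X)\<rparr>"

lemma dom_cod_simps [simp]:
  "mon_ob (dom_mon C A) = Dom C (mon_ob A)" "mult (dom_mon C A) = dom_part (mult A)" "unit (dom_mon C A) = dom_part (unit A)"
  "mon_ob (cod_mon C A) = Cod C (mon_ob A)" "mult (cod_mon C A) = cod_part (mult A)" "unit (cod_mon C A) = cod_part (unit A)"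
  "mod_ob (dom_module C X) = Dom C (mod_ob X)" "act (dom_module C X) = dom_part (act X)"
  "mod_ob (cod_module C X) = Cod C (mod_ob X)" "act (cod_module C X) = cod_part (act X)"
  by (simp_all add: dom_mon_def cod_mon_def dom_module_def cod_module_def)

context pointed_closed_monoidal
begin

abbreviation P where "P \<equiv> arr_pushout C"
abbreviation T where "T \<equiv> arr_tensor C"

lemma pp_constraint_parts [simp]:
  "src (pp_assoc C f g h) = pp C (pp C f g) h" "tgt (pp_assoc C f g h) = pp C f (pp C g h)"
  "cod_part (pp_assoc C f g h) = assoc C (Cod C f) (Cod C g) (Cod C h)"
  "cod_part (pp_lunit C f) = lunit C (Cod C f)" "cod_part (pp_runit C f) = runit C (Cod C f)"
  by (simp_all add: pp_assoc_def pp_lunit_def pp_runit_def)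

text \<open>
  Taking codomains is strictly monoidal for the pushout product, so the target of a Smith ideal is a monoid;
  for the tensor product of arrows both sources and targets are.
\<close>

lemma is_monoid_cod_pushout:
  assumes "is_monoid P A"
  shows "is_monoid C (cod_mon C A)"
proof -
  have "cod_part (mult A \<bullet>\<^bsub>P\<^esub> (mult A \<star>\<^bsub>P\<^esub> Ide P (mon_ob A)))
      = cod_part (mult A \<bullet>\<^bsub>P\<^esub> (Ide P (mon_ob A) \<star>\<^bsub>P\<^esub> mult A) \<bullet>\<^bsub>P\<^esub> assoc P (mon_ob A) (mon_ob A) (mon_ob A))"
    "cod_part (mult A \<bullet>\<^bsub>P\<^esub> (unit A \<star>\<^bsub>P\<^esub> Ide P (mon_ob A))) = cod_part (lunit P (mon_ob A))"
    "cod_part (mult A \<bullet>\<^bsub>P\<^esub> (Ide P (mon_ob A) \<star>\<^bsub>P\<^esub> unit A)) = cod_part (runit P (mon_ob A))"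
    using assms by (simp_all only: is_monoid_def)
  then show ?thesis
    using assms by (simp add: is_monoid_def square_iff hom_iff)
qed

lemma is_monoid_cod_tensor:
  assumes "is_monoid T A"
  shows "is_monoid C (cod_mon C A)"
  using assms by (simp add: is_monoid_def square_iff hom_iff)

lemma is_monoid_dom_tensor:
  assumes "is_monoid T A"
  shows "is_monoid C (dom_mon C A)"
  using assms by (simp add: is_monoid_def square_iff hom_iff)

lemma is_module_cod_pushout:
  assumes "is_module P A X" "is_monoid P A"
  shows "is_module C (cod_mon C A) (cod_module C X)"
proof -
  have "cod_part (act X \<bullet>\<^bsub>P\<^esub> (mult A \<star>\<^bsub>P\<^esub> Ide P (mod_ob X)))
      = cod_part (act X \<bullet>\<^bsub>P\<^esub> (Ide P (mon_ob A) \<star>\<^bsub>P\<^esub> act X) \<bullet>\<^bsub>P\<^esub> assoc P (mon_ob A) (mon_ob A) (mod_ob X))"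
    "cod_part (act X \<bullet>\<^bsub>P\<^esub> (unit A \<star>\<^bsub>P\<^esub> Ide P (mod_ob X))) = cod_part (lunit P (mod_ob X))"
    using assms(1) by (simp_all only: is_module_def)
  then show ?thesis
    using assms by (simp add: is_module_def is_monoid_def square_iff hom_iff)
qed

lemma is_module_dom_tensor:
  assumes "is_module T A X" "is_monoid T A"
  shows "is_module C (dom_mon C A) (dom_module C X)"
  using assms by (simp add: is_module_def is_monoid_def square_iff hom_iff)

lemma P_square_eq: "\<lbrakk>is_mono C k; s \<in> hom P f k; t \<in> hom P f k; cod_part s = cod_part t\<rbrakk> \<Longrightarrow> s = t"
  by (rule square_eq_mono) auto

lemma T_square_eq: "\<lbrakk>is_epi C e; s \<in> hom T e g; t \<in> hom T e g; dom_part s = dom_part t\<rbrakk> \<Longrightarrow> s = t"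
  by (rule square_eq_epi) auto

lemma P_hom:
  "f \<in> Arr C \<Longrightarrow> Ide P f \<in> hom P f f"
  "\<lbrakk>f \<in> Arr C; g \<in> Arr C; h \<in> Arr C\<rbrakk> \<Longrightarrow> assoc P f g h \<in> hom P ((f \<otimes>\<^bsub>P\<^esub> g) \<otimes>\<^bsub>P\<^esub> h) (f \<otimes>\<^bsub>P\<^esub> (g \<otimes>\<^bsub>P\<^esub> h))"
  "f \<in> Arr C \<Longrightarrow> lunit P f \<in> hom P (unit_ob P \<otimes>\<^bsub>P\<^esub> f) f"
  "f \<in> Arr C \<Longrightarrow> runit P f \<in> hom P (f \<otimes>\<^bsub>P\<^esub> unit_ob P) f"
  using pp_assoc_hom[of f g h] pp_lunit_hom[of f] pp_runit_hom[of f] by (auto simp: square_iff)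

lemma T_hom:
  "f \<in> Arr C \<Longrightarrow> Ide T f \<in> hom T f f"
  "\<lbrakk>f \<in> Arr C; g \<in> Arr C; h \<in> Arr C\<rbrakk> \<Longrightarrow> assoc T f g h \<in> hom T ((f \<otimes>\<^bsub>T\<^esub> g) \<otimes>\<^bsub>T\<^esub> h) (f \<otimes>\<^bsub>T\<^esub> (g \<otimes>\<^bsub>T\<^esub> h))"
  "f \<in> Arr C \<Longrightarrow> lunit T f \<in> hom T (unit_ob T \<otimes>\<^bsub>T\<^esub> f) f"
  "f \<in> Arr C \<Longrightarrow> runit T f \<in> hom T (f \<otimes>\<^bsub>T\<^esub> unit_ob T) f"
  using arr_tensor_assoc_hom[of f g h] arr_tensor_lunit_hom[of f] arr_tensor_runit_hom[of f] by (auto simp: square_iff)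

text \<open>
  The monoid axioms are equations of squares into \<open>mon_ob A\<close>. If this arrow is monic, they can be checked
  on codomains, where they are the monoid axioms in \<open>C\<close>.
\<close>

lemma is_monoid_pushoutI:
  assumes m: "is_mono C (mon_ob A)" and mult: "mult A \<in> hom P (mon_ob A \<otimes>\<^bsub>P\<^esub> mon_ob A) (mon_ob A)"
    and unit: "unit A \<in> hom P (unit_ob P) (mon_ob A)" and cod: "is_monoid C (cod_mon C A)"
  shows "is_monoid P A"
proof -
  interpret P: tensor_category P
    by (rule tensor_category_arr_pushout)
  let ?j = "mon_ob A"
  have j: "?j \<in> Arr C"
    using m by (simp add: is_mono_def)
  note i = P_hom(1)[OF j]
  have c: "src (mult A) = pp C ?j ?j" "tgt (mult A) = ?j" "src (unit A) = pp_unit C" "tgt (unit A) = ?j"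
    using mult unit by (auto simp: square_iff)
  show ?thesis
    unfolding is_monoid_def
  proof (intro conjI)
    show "mult A \<bullet>\<^bsub>P\<^esub> (mult A \<star>\<^bsub>P\<^esub> Ide P ?j) = mult A \<bullet>\<^bsub>P\<^esub> (Ide P ?j \<star>\<^bsub>P\<^esub> mult A) \<bullet>\<^bsub>P\<^esub> assoc P ?j ?j ?j"
      by (rule P_square_eq[OF m P.comp_hom[OF P.tensor_hom[OF mult i] mult]
            P.comp_hom[OF P.comp_hom[OF P_hom(2)[OF j j j] P.tensor_hom[OF i mult]] mult]])
        (use cod in \<open>simp add: is_monoid_def\<close>)
    show "mult A \<bullet>\<^bsub>P\<^esub> (unit A \<star>\<^bsub>P\<^esub> Ide P ?j) = lunit P ?j"
      by (rule P_square_eq[OF m P.comp_hom[OF P.tensor_hom[OF unit i] mult] P_hom(3)[OF j]])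
        (use cod in \<open>simp add: is_monoid_def\<close>)
    show "mult A \<bullet>\<^bsub>P\<^esub> (Ide P ?j \<star>\<^bsub>P\<^esub> unit A) = runit P ?j"
      by (rule P_square_eq[OF m P.comp_hom[OF P.tensor_hom[OF i unit] mult] P_hom(4)[OF j]])
        (use cod in \<open>simp add: is_monoid_def\<close>)
  qed (use mult unit j in auto)
qed

text \<open>
  Here the axioms are equations of squares out of tensor products of \<open>mon_ob A\<close> with itself and with the
  unit, which are epimorphisms along with \<open>mon_ob A\<close>; so they can be checked on domains.
\<close>

lemma is_monoid_tensorI:
  assumes e: "is_epi C (mon_ob A)" and mult: "mult A \<in> hom T (mon_ob A \<otimes>\<^bsub>T\<^esub> mon_ob A) (mon_ob A)"
    and unit: "unit A \<in> hom T (unit_ob T) (mon_ob A)" and dom: "is_monoid C (dom_mon C A)"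
  shows "is_monoid T A"
proof -
  interpret T: tensor_category T
    by (rule tensor_category_arr_tensor)
  let ?j = "mon_ob A"
  have j: "?j \<in> Arr C"
    using e by (simp add: is_epi_def)
  note i = T_hom(1)[OF j]
  have e3: "is_epi C ((?j \<otimes>\<^bsub>T\<^esub> ?j) \<otimes>\<^bsub>T\<^esub> ?j)" and eu: "is_epi C (unit_ob T \<otimes>\<^bsub>T\<^esub> ?j)" "is_epi C (?j \<otimes>\<^bsub>T\<^esub> unit_ob T)"
    using e by (auto intro!: epi_tensor epi_Ide)
  show ?thesis
    unfolding is_monoid_def
  proof (intro conjI)
    show "mult A \<bullet>\<^bsub>T\<^esub> (mult A \<star>\<^bsub>T\<^esub> Ide T ?j) = mult A \<bullet>\<^bsub>T\<^esub> (Ide T ?j \<star>\<^bsub>T\<^esub> mult A) \<bullet>\<^bsub>T\<^esub> assoc T ?j ?j ?j"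
      by (rule T_square_eq[OF e3 T.comp_hom[OF T.tensor_hom[OF mult i] mult]
            T.comp_hom[OF T.comp_hom[OF T_hom(2)[OF j j j] T.tensor_hom[OF i mult]] mult]])
        (use dom in \<open>simp add: is_monoid_def\<close>)
    show "mult A \<bullet>\<^bsub>T\<^esub> (unit A \<star>\<^bsub>T\<^esub> Ide T ?j) = lunit T ?j"
      by (rule T_square_eq[OF eu(1) T.comp_hom[OF T.tensor_hom[OF unit i] mult] T_hom(3)[OF j]])
        (use dom in \<open>simp add: is_monoid_def\<close>)
    show "mult A \<bullet>\<^bsub>T\<^esub> (Ide T ?j \<star>\<^bsub>T\<^esub> unit A) = runit T ?j"
      by (rule T_square_eq[OF eu(2) T.comp_hom[OF T.tensor_hom[OF i unit] mult] T_hom(4)[OF j]])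
        (use dom in \<open>simp add: is_monoid_def\<close>)
  qed (use mult unit j in auto)
qed

lemma is_module_pushoutI:
  assumes A: "is_monoid P A" and m: "is_mono C (mod_ob X)" and act: "act X \<in> hom P (mon_ob A \<otimes>\<^bsub>P\<^esub> mod_ob X) (mod_ob X)"
    and cod: "is_module C (cod_mon C A) (cod_module C X)"
  shows "is_module P A X"
proof -
  interpret P: tensor_category P
    by (rule tensor_category_arr_pushout)
  let ?j = "mon_ob A" and ?x = "mod_ob X"
  have j: "?j \<in> Arr C" and mult: "mult A \<in> hom P (?j \<otimes>\<^bsub>P\<^esub> ?j) ?j" and unit: "unit A \<in> hom P (unit_ob P) ?j"
    using A by (auto simp: is_monoid_def)
  have x: "?x \<in> Arr C"
    using m by (simp add: is_mono_def)
  note i = P_hom(1)[OF x] and k = P_hom(1)[OF j]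
  show ?thesis
    unfolding is_module_def
  proof (intro conjI)
    show "act X \<bullet>\<^bsub>P\<^esub> (mult A \<star>\<^bsub>P\<^esub> Ide P ?x) = act X \<bullet>\<^bsub>P\<^esub> (Ide P ?j \<star>\<^bsub>P\<^esub> act X) \<bullet>\<^bsub>P\<^esub> assoc P ?j ?j ?x"
      by (rule P_square_eq[OF m P.comp_hom[OF P.tensor_hom[OF mult i] act]
            P.comp_hom[OF P.comp_hom[OF P_hom(2)[OF j j x] P.tensor_hom[OF k act]] act]])
        (use cod in \<open>simp add: is_module_def\<close>)
    show "act X \<bullet>\<^bsub>P\<^esub> (unit A \<star>\<^bsub>P\<^esub> Ide P ?x) = lunit P ?x"
      by (rule P_square_eq[OF m P.comp_hom[OF P.tensor_hom[OF unit i] act] P_hom(3)[OF x]])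
        (use cod in \<open>simp add: is_module_def\<close>)
  qed (use act x in auto)
qed

lemma is_module_tensorI:
  assumes A: "is_monoid T A" and e: "is_epi C (mon_ob A)" "is_epi C (mod_ob X)"
    and act: "act X \<in> hom T (mon_ob A \<otimes>\<^bsub>T\<^esub> mod_ob X) (mod_ob X)"
    and dom: "is_module C (dom_mon C A) (dom_module C X)"
  shows "is_module T A X"
proof -
  interpret T: tensor_category T
    by (rule tensor_category_arr_tensor)
  let ?j = "mon_ob A" and ?x = "mod_ob X"
  have j: "?j \<in> Arr C" and mult: "mult A \<in> hom T (?j \<otimes>\<^bsub>T\<^esub> ?j) ?j" and unit: "unit A \<in> hom T (unit_ob T) ?j"
    using A by (auto simp: is_monoid_def)
  have x: "?x \<in> Arr C"
    using e by (simp add: is_epi_def)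
  note i = T_hom(1)[OF x] and k = T_hom(1)[OF j]
  have e3: "is_epi C ((?j \<otimes>\<^bsub>T\<^esub> ?j) \<otimes>\<^bsub>T\<^esub> ?x)" and eu: "is_epi C (unit_ob T \<otimes>\<^bsub>T\<^esub> ?x)"
    using e by (auto intro!: epi_tensor epi_Ide)
  show ?thesis
    unfolding is_module_def
  proof (intro conjI)
    show "act X \<bullet>\<^bsub>T\<^esub> (mult A \<star>\<^bsub>T\<^esub> Ide T ?x) = act X \<bullet>\<^bsub>T\<^esub> (Ide T ?j \<star>\<^bsub>T\<^esub> act X) \<bullet>\<^bsub>T\<^esub> assoc T ?j ?j ?x"
      by (rule T_square_eq[OF e3 T.comp_hom[OF T.tensor_hom[OF mult i] act]
            T.comp_hom[OF T.comp_hom[OF T_hom(2)[OF j j x] T.tensor_hom[OF k act]] act]])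
        (use dom in \<open>simp add: is_module_def\<close>)
    show "act X \<bullet>\<^bsub>T\<^esub> (unit A \<star>\<^bsub>T\<^esub> Ide T ?x) = lunit T ?x"
      by (rule T_square_eq[OF eu T.comp_hom[OF T.tensor_hom[OF unit i] act] T_hom(3)[OF x]])
        (use dom in \<open>simp add: is_module_def\<close>)
  qed (use act x in auto)
qed

lemma is_monoid_hom_cod_pushout:
  assumes "is_monoid_hom P A B s"
  shows "is_monoid_hom C (cod_mon C A) (cod_mon C B) (cod_part s)"
proof -
  have "cod_part (s \<bullet>\<^bsub>P\<^esub> mult A) = cod_part (mult B \<bullet>\<^bsub>P\<^esub> (s \<star>\<^bsub>P\<^esub> s))" "cod_part (s \<bullet>\<^bsub>P\<^esub> unit A) = cod_part (unit B)"
    using assms by (simp_all only: is_monoid_hom_def)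
  then show ?thesis
    using assms by (simp add: is_monoid_hom_def is_monoid_cod_pushout square_iff hom_iff)
qed

lemma is_monoid_hom_dom_tensor:
  assumes "is_monoid_hom T A B s"
  shows "is_monoid_hom C (dom_mon C A) (dom_mon C B) (dom_part s)"
proof -
  have "dom_part (s \<bullet>\<^bsub>T\<^esub> mult A) = dom_part (mult B \<bullet>\<^bsub>T\<^esub> (s \<star>\<^bsub>T\<^esub> s))" "dom_part (s \<bullet>\<^bsub>T\<^esub> unit A) = dom_part (unit B)"
    using assms by (simp_all only: is_monoid_hom_def)
  then show ?thesis
    using assms by (simp add: is_monoid_hom_def is_monoid_dom_tensor square_iff hom_iff)
qed

text \<open>
  With a monic target, a square preserves the structure as soon as its map of codomains does. The next
  lemma is the counterpart for an epic source. Together they reduce a condition on squares and its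
  transpose to the same condition on one map of \<open>C\<close>.
\<close>

lemma is_monoid_hom_pushout_iff:
  assumes A: "is_monoid P A" and B: "is_monoid P B" and m: "is_mono C (mon_ob B)" and s: "s \<in> hom P (mon_ob A) (mon_ob B)"
  shows "is_monoid_hom P A B s \<longleftrightarrow> is_monoid_hom C (cod_mon C A) (cod_mon C B) (cod_part s)"
proof
  assume c: "is_monoid_hom C (cod_mon C A) (cod_mon C B) (cod_part s)"
  interpret P: tensor_category P
    by (rule tensor_category_arr_pushout)
  have h: "mult A \<in> hom P (mon_ob A \<otimes>\<^bsub>P\<^esub> mon_ob A) (mon_ob A)" "mult B \<in> hom P (mon_ob B \<otimes>\<^bsub>P\<^esub> mon_ob B) (mon_ob B)"
    "unit A \<in> hom P (unit_ob P) (mon_ob A)" "unit B \<in> hom P (unit_ob P) (mon_ob B)"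
    using A B by (auto simp: is_monoid_def)
  have "s \<bullet>\<^bsub>P\<^esub> mult A = mult B \<bullet>\<^bsub>P\<^esub> (s \<star>\<^bsub>P\<^esub> s)"
    by (rule P_square_eq[OF m P.comp_hom[OF h(1) s] P.comp_hom[OF P.tensor_hom[OF s s] h(2)]])
      (use c in \<open>simp add: is_monoid_hom_def\<close>)
  moreover have "s \<bullet>\<^bsub>P\<^esub> unit A = unit B"
    by (rule P_square_eq[OF m P.comp_hom[OF h(3) s] h(4)]) (use c in \<open>simp add: is_monoid_hom_def\<close>)
  ultimately show "is_monoid_hom P A B s"
    using A B s unfolding is_monoid_hom_def by blast
qed (rule is_monoid_hom_cod_pushout)

lemma is_monoid_hom_tensor_iff:
  assumes A: "is_monoid T A" and B: "is_monoid T B" and e: "is_epi C (mon_ob A)" and s: "s \<in> hom T (mon_ob A) (mon_ob B)"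
  shows "is_monoid_hom T A B s \<longleftrightarrow> is_monoid_hom C (dom_mon C A) (dom_mon C B) (dom_part s)"
proof
  assume c: "is_monoid_hom C (dom_mon C A) (dom_mon C B) (dom_part s)"
  interpret T: tensor_category T
    by (rule tensor_category_arr_tensor)
  have h: "mult A \<in> hom T (mon_ob A \<otimes>\<^bsub>T\<^esub> mon_ob A) (mon_ob A)" "mult B \<in> hom T (mon_ob B \<otimes>\<^bsub>T\<^esub> mon_ob B) (mon_ob B)"
    "unit A \<in> hom T (unit_ob T) (mon_ob A)" "unit B \<in> hom T (unit_ob T) (mon_ob B)"
    using A B by (auto simp: is_monoid_def)
  have e2: "is_epi C (mon_ob A \<otimes>\<^bsub>T\<^esub> mon_ob A)" "is_epi C (unit_ob T)"
    using e by (auto intro: epi_tensor epi_Ide)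
  have "s \<bullet>\<^bsub>T\<^esub> mult A = mult B \<bullet>\<^bsub>T\<^esub> (s \<star>\<^bsub>T\<^esub> s)"
    by (rule T_square_eq[OF e2(1) T.comp_hom[OF h(1) s] T.comp_hom[OF T.tensor_hom[OF s s] h(2)]])
      (use c in \<open>simp add: is_monoid_hom_def\<close>)
  moreover have "s \<bullet>\<^bsub>T\<^esub> unit A = unit B"
    by (rule T_square_eq[OF e2(2) T.comp_hom[OF h(3) s] h(4)]) (use c in \<open>simp add: is_monoid_hom_def\<close>)
  ultimately show "is_monoid_hom T A B s"
    using A B s unfolding is_monoid_hom_def by blast
qed (rule is_monoid_hom_dom_tensor)

lemma is_module_hom_cod_pushout:
  assumes A: "is_monoid P A" and s: "is_module_hom P A X Y s"
  shows "is_module_hom C (cod_mon C A) (cod_module C X) (cod_module C Y) (cod_part s)"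
proof -
  have "cod_part (s \<bullet>\<^bsub>P\<^esub> act X) = cod_part (act Y \<bullet>\<^bsub>P\<^esub> (Ide P (mon_ob A) \<star>\<^bsub>P\<^esub> s))"
    using s by (simp_all only: is_module_hom_def)
  then show ?thesis
    using s A by (simp add: is_module_hom_def is_module_cod_pushout square_iff hom_iff)
qed

lemma is_module_hom_dom_tensor:
  assumes A: "is_monoid T A" and s: "is_module_hom T A X Y s"
  shows "is_module_hom C (dom_mon C A) (dom_module C X) (dom_module C Y) (dom_part s)"
proof -
  have "dom_part (s \<bullet>\<^bsub>T\<^esub> act X) = dom_part (act Y \<bullet>\<^bsub>T\<^esub> (Ide T (mon_ob A) \<star>\<^bsub>T\<^esub> s))"
    using s by (simp_all only: is_module_hom_def)
  then show ?thesis
    using s A by (simp add: is_module_hom_def is_module_dom_tensor square_iff hom_iff)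
qed

lemma is_module_hom_pushout_iff:
  assumes A: "is_monoid P A" and X: "is_module P A X" and Y: "is_module P A Y" and m: "is_mono C (mod_ob Y)"
    and s: "s \<in> hom P (mod_ob X) (mod_ob Y)"
  shows "is_module_hom P A X Y s \<longleftrightarrow> is_module_hom C (cod_mon C A) (cod_module C X) (cod_module C Y) (cod_part s)"
proof
  assume c: "is_module_hom C (cod_mon C A) (cod_module C X) (cod_module C Y) (cod_part s)"
  interpret P: tensor_category P
    by (rule tensor_category_arr_pushout)
  have h: "act X \<in> hom P (mon_ob A \<otimes>\<^bsub>P\<^esub> mod_ob X) (mod_ob X)" "act Y \<in> hom P (mon_ob A \<otimes>\<^bsub>P\<^esub> mod_ob Y) (mod_ob Y)"
    "mon_ob A \<in> Arr C"
    using A X Y by (auto simp: is_monoid_def is_module_def)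
  have "s \<bullet>\<^bsub>P\<^esub> act X = act Y \<bullet>\<^bsub>P\<^esub> (Ide P (mon_ob A) \<star>\<^bsub>P\<^esub> s)"
    by (rule P_square_eq[OF m P.comp_hom[OF h(1) s] P.comp_hom[OF P.tensor_hom[OF P_hom(1)[OF h(3)] s] h(2)]])
      (use c in \<open>simp add: is_module_hom_def\<close>)
  then show "is_module_hom P A X Y s"
    using X Y s unfolding is_module_hom_def by blast
qed (rule is_module_hom_cod_pushout[OF A])

lemma is_module_hom_tensor_iff:
  assumes A: "is_monoid T A" and X: "is_module T A X" and Y: "is_module T A Y" and e: "is_epi C (mon_ob A)" "is_epi C (mod_ob X)"
    and s: "s \<in> hom T (mod_ob X) (mod_ob Y)"
  shows "is_module_hom T A X Y s \<longleftrightarrow> is_module_hom C (dom_mon C A) (dom_module C X) (dom_module C Y) (dom_part s)"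
proof
  assume c: "is_module_hom C (dom_mon C A) (dom_module C X) (dom_module C Y) (dom_part s)"
  interpret T: tensor_category T
    by (rule tensor_category_arr_tensor)
  have h: "act X \<in> hom T (mon_ob A \<otimes>\<^bsub>T\<^esub> mod_ob X) (mod_ob X)" "act Y \<in> hom T (mon_ob A \<otimes>\<^bsub>T\<^esub> mod_ob Y) (mod_ob Y)"
    "mon_ob A \<in> Arr C"
    using A X Y by (auto simp: is_monoid_def is_module_def)
  have e2: "is_epi C (mon_ob A \<otimes>\<^bsub>T\<^esub> mod_ob X)"
    using e by (auto intro: epi_tensor)
  have "s \<bullet>\<^bsub>T\<^esub> act X = act Y \<bullet>\<^bsub>T\<^esub> (Ide T (mon_ob A) \<star>\<^bsub>T\<^esub> s)"
    by (rule T_square_eq[OF e2 T.comp_hom[OF h(1) s] T.comp_hom[OF T.tensor_hom[OF T_hom(1)[OF h(3)] s] h(2)]])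
      (use c in \<open>simp add: is_module_hom_def\<close>)
  then show "is_module_hom T A X Y s"
    using X Y s unfolding is_module_hom_def by blast
qed (rule is_module_hom_dom_tensor[OF A])

end

section \<open>Cokernels of Smith ideals and kernels of monoid homomorphisms\<close>

context pointed_closed_monoidal
begin

text \<open>
  The second component exists because the tensor product of the two cokernels is a cokernel of the pushout
  product.
\<close>

lemma coker_mu_hom:
  assumes "f \<in> Arr C" "g \<in> Arr C"
  shows "coker_mu C f g \<in> hom T (FO (Coker C) f \<otimes>\<^bsub>T\<^esub> FO (Coker C) g) (FO (Coker C) (f \<otimes>\<^bsub>P\<^esub> g))"
proof -
  have "is_cokernel (pp C f g) (coker C f \<star> coker C g)"
    using assms by (intro cokernel_pp coker_cokernel)
  from lift_coker_simps[OF this, of "coker C (pp C f g)"] show ?thesis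
    using assms by (simp add: coker_mu_def square_iff)
qed

lemma coker_eps_hom: "coker_eps C \<in> hom T (unit_ob T) (FO (Coker C) (unit_ob P))"
  by (simp add: coker_eps_def square_iff)

text \<open>
  The pushout product of the kernels is killed by \<open>p \<otimes> q\<close>: on one summand the first factor vanishes, on
  the other the second.
\<close>

lemma ker_mu_hom:
  assumes "p \<in> Arr C" "q \<in> Arr C"
  shows "ker_mu C p q \<in> hom P (FO (Ker C) p \<otimes>\<^bsub>P\<^esub> FO (Ker C) q) (FO (Ker C) (p \<otimes>\<^bsub>T\<^esub> q))"
proof -
  have "(p \<star> q) \<bullet> pp C (ker C p) (ker C q) = zero_map (Dom C (pp C (ker C p) (ker C q))) (Cod C (p \<star> q))"
    by (rule pp_arr_eq[of "ker C p" "ker C q"]) (use assms in \<open>auto simp: zero_map_tensor tensor_zero_map\<close>)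
  from lift_ker_simps[OF _ _ _ this] show ?thesis
    using assms by (simp add: ker_mu_def square_iff)
qed

lemma ker_eps_hom: "ker_eps C \<in> hom P (unit_ob P) (FO (Ker C) (unit_ob T))"
proof -
  have "ker C (Ide C (unit_ob C)) \<bullet> from_zero C (Dom C (ker C (Ide C (unit_ob C)))) = pp_unit C"
    by (rule from_zero_eq) auto
  then show ?thesis
    by (simp add: ker_eps_def square_iff)
qed

lemma ker_coker_unit_hom:
  assumes "j \<in> Arr C"
  shows "ker_coker_unit C j \<in> hom P j (ker C (coker C j))"
  using lift_ker_simps[of "coker C j" j] assms by (simp add: ker_coker_unit_def square_iff)

text \<open>
  Object parts of the functors of the theorem. A kernel module is naturally a module over \<open>ker (coker j)\<close>;
  restriction along \<open>j \<rightarrow> ker (coker j)\<close> makes it a module over \<open>j\<close>.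
\<close>

abbreviation coker_monoid where "coker_monoid \<equiv> induced_mon T (Coker C) (coker_mu C) (coker_eps C)"
abbreviation ker_monoid where "ker_monoid \<equiv> induced_mon P (Ker C) (ker_mu C) (ker_eps C)"
abbreviation coker_module where "coker_module J \<equiv> induced_module T (Coker C) (coker_mu C) J"
abbreviation ker_module where
  "ker_module J Y \<equiv> restrict_module P (ker_coker_unit C (mon_ob J)) (induced_module P (Ker C) (ker_mu C) (coker_monoid J) Y)"

lemma induced_ob [simp]:
  "mon_ob (coker_monoid J) = coker C (mon_ob J)" "mon_ob (ker_monoid B) = ker C (mon_ob B)"
  "mod_ob (coker_module J X) = coker C (mod_ob X)" "mod_ob (ker_module J Y) = ker C (mod_ob Y)"
  by (simp_all add: induced_mon_def induced_module_def restrict_module_def)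

text \<open>
  The canonical maps \<open>coker_mu\<close> and \<open>coker_eps\<close> are identities on domains, so the cokernel carries the monoid
  structure of the target of the Smith ideal over to the source of the monoid homomorphism. Kernels do the
  opposite.
\<close>

lemma dom_mon_coker:
  assumes "is_monoid P J"
  shows "dom_mon C (coker_monoid J) = cod_mon C J"
  using assms by (simp add: is_monoid_def square_iff dom_mon_def cod_mon_def induced_mon_def coker_mu_def coker_eps_def)

lemma cod_mon_ker:
  assumes "is_monoid T B"
  shows "cod_mon C (ker_monoid B) = dom_mon C B"
  using assms by (simp add: is_monoid_def square_iff dom_mon_def cod_mon_def induced_mon_def ker_mu_def ker_eps_def)

lemma is_monoid_coker:
  assumes J: "is_monoid P J"
  shows "is_monoid T (coker_monoid J)"
proof (rule is_monoid_tensorI)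
  interpret T: tensor_category T
    by (rule tensor_category_arr_tensor)
  have j: "mon_ob J \<in> Arr C" and mult: "mult J \<in> hom K (mon_ob J \<otimes>\<^bsub>P\<^esub> mon_ob J) (mon_ob J)"
    and unit: "unit J \<in> hom K (unit_ob P) (mon_ob J)"
    using J by (auto simp: is_monoid_def)
  show "is_epi C (mon_ob (coker_monoid J))"
    using coker_epi[OF j] by simp
  show "mult (coker_monoid J) \<in> hom T (mon_ob (coker_monoid J) \<otimes>\<^bsub>T\<^esub> mon_ob (coker_monoid J)) (mon_ob (coker_monoid J))"
    using T.comp_hom[OF coker_mu_hom[OF j j], of "FA (Coker C) (mult J)"] Coker_hom[OF mult] by (simp add: induced_mon_def)
  show "unit (coker_monoid J) \<in> hom T (unit_ob T) (mon_ob (coker_monoid J))"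
    using T.comp_hom[OF coker_eps_hom, of "FA (Coker C) (unit J)"] Coker_hom[OF unit] by (simp add: induced_mon_def)
  show "is_monoid C (dom_mon C (coker_monoid J))"
    using J by (simp only: dom_mon_coker is_monoid_cod_pushout)
qed

lemma is_monoid_ker:
  assumes B: "is_monoid T B"
  shows "is_monoid P (ker_monoid B)"
proof (rule is_monoid_pushoutI)
  interpret P: tensor_category P
    by (rule tensor_category_arr_pushout)
  have p: "mon_ob B \<in> Arr C" and mult: "mult B \<in> hom K (mon_ob B \<otimes>\<^bsub>T\<^esub> mon_ob B) (mon_ob B)"
    and unit: "unit B \<in> hom K (unit_ob T) (mon_ob B)"
    using B by (auto simp: is_monoid_def)
  show "is_mono C (mon_ob (ker_monoid B))"
    using ker_mono[OF p] by simp
  show "mult (ker_monoid B) \<in> hom P (mon_ob (ker_monoid B) \<otimes>\<^bsub>P\<^esub> mon_ob (ker_monoid B)) (mon_ob (ker_monoid B))"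
    using P.comp_hom[OF ker_mu_hom[OF p p], of "FA (Ker C) (mult B)"] Ker_hom[OF mult] by (simp add: induced_mon_def)
  show "unit (ker_monoid B) \<in> hom P (unit_ob P) (mon_ob (ker_monoid B))"
    using P.comp_hom[OF ker_eps_hom, of "FA (Ker C) (unit B)"] Ker_hom[OF unit] by (simp add: induced_mon_def)
  show "is_monoid C (cod_mon C (ker_monoid B))"
    using B by (simp only: cod_mon_ker is_monoid_dom_tensor)
qed

lemma dom_module_coker:
  assumes "is_monoid P J" "is_module P J X"
  shows "dom_module C (coker_module J X) = cod_module C X"
  using assms
  by (simp add: is_monoid_def is_module_def square_iff dom_module_def cod_module_def induced_module_def coker_mu_def)

text \<open>
  Like \<open>ker_mu\<close>, the square \<open>j \<rightarrow> ker (coker j)\<close> is an identity on codomains, so restriction along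
  it does not change the action there.
\<close>

lemma cod_module_ker:
  assumes J: "is_monoid P J" and Y: "is_module T (coker_monoid J) Y"
  shows "cod_module C (ker_module J Y) = dom_module C Y"
proof -
  have j: "mon_ob J \<in> Arr C"
    using J by (auto simp: is_monoid_def)
  have y: "mod_ob Y \<in> Arr C" "act Y \<in> hom T (coker C (mon_ob J) \<otimes>\<^bsub>T\<^esub> mod_ob Y) (mod_ob Y)"
    using Y by (auto simp: is_module_def simp del: arr_tensor_simps(8))
  then show ?thesis
    using j by (simp add: square_iff dom_module_def cod_module_def induced_module_def restrict_module_def
        ker_mu_def ker_coker_unit_def)
qed

lemma is_module_coker:
  assumes J: "is_monoid P J" and X: "is_module P J X"
  shows "is_module T (coker_monoid J) (coker_module J X)"
proof (rule is_module_tensorI[OF is_monoid_coker[OF J]])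
  interpret T: tensor_category T
    by (rule tensor_category_arr_tensor)
  have j: "mon_ob J \<in> Arr C" and x: "mod_ob X \<in> Arr C" and act: "act X \<in> hom K (mon_ob J \<otimes>\<^bsub>P\<^esub> mod_ob X) (mod_ob X)"
    using J X by (auto simp: is_monoid_def is_module_def)
  show "is_epi C (mon_ob (coker_monoid J))" "is_epi C (mod_ob (coker_module J X))"
    using coker_epi[OF j] coker_epi[OF x] by simp_all
  show "act (coker_module J X) \<in> hom T (mon_ob (coker_monoid J) \<otimes>\<^bsub>T\<^esub> mod_ob (coker_module J X)) (mod_ob (coker_module J X))"
    using T.comp_hom[OF coker_mu_hom[OF j x], of "FA (Coker C) (act X)"] Coker_hom[OF act] by (simp add: induced_module_def induced_mon_def)
  show "is_module C (dom_mon C (coker_monoid J)) (dom_module C (coker_module J X))"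
    using J X by (simp only: dom_mon_coker dom_module_coker is_module_cod_pushout)
qed

lemma is_module_ker:
  assumes J: "is_monoid P J" and Y: "is_module T (coker_monoid J) Y"
  shows "is_module P J (ker_module J Y)"
proof (rule is_module_pushoutI[OF J])
  interpret P: tensor_category P
    by (rule tensor_category_arr_pushout)
  let ?q = "coker C (mon_ob J)" and ?y = "mod_ob Y"
  have j: "mon_ob J \<in> Arr C" and q: "?q \<in> Arr C"
    using J by (auto simp: is_monoid_def)
  have y: "?y \<in> Arr C" and act: "act Y \<in> hom K (?q \<otimes>\<^bsub>T\<^esub> ?y) ?y"
    using Y by (auto simp: is_module_def)
  have ky: "ker C ?y \<in> Arr C"
    using y by simp
  show "is_mono C (mod_ob (ker_module J Y))"
    using ker_mono[OF y] by simp
  have 1: "ker_coker_unit C (mon_ob J) \<star>\<^bsub>P\<^esub> Ide P (ker C ?y) \<in> hom P (mon_ob J \<otimes>\<^bsub>P\<^esub> ker C ?y) (ker C ?q \<otimes>\<^bsub>P\<^esub> ker C ?y)"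
    by (rule P.tensor_hom[OF ker_coker_unit_hom[OF j] P_hom(1)[OF ky]])
  have 2: "ker_mu C ?q ?y \<in> hom P (ker C ?q \<otimes>\<^bsub>P\<^esub> ker C ?y) (ker C (?q \<otimes>\<^bsub>T\<^esub> ?y))"
    using ker_mu_hom[OF q y] by simp
  have 3: "FA (Ker C) (act Y) \<in> hom P (ker C (?q \<otimes>\<^bsub>T\<^esub> ?y)) (ker C ?y)"
    using Ker_hom[OF act] by simp
  have "(FA (Ker C) (act Y) \<bullet>\<^bsub>P\<^esub> ker_mu C ?q ?y) \<bullet>\<^bsub>P\<^esub> (ker_coker_unit C (mon_ob J) \<star>\<^bsub>P\<^esub> Ide P (ker C ?y))
      \<in> hom P (mon_ob J \<otimes>\<^bsub>P\<^esub> ker C ?y) (ker C ?y)"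
    by (rule P.comp_hom[OF 1 P.comp_hom[OF 2 3]])
  then show "act (ker_module J Y) \<in> hom P (mon_ob J \<otimes>\<^bsub>P\<^esub> mod_ob (ker_module J Y)) (mod_ob (ker_module J Y))"
    by (simp add: restrict_module_def induced_module_def induced_mon_def)
  have "is_module C (dom_mon C (coker_monoid J)) (dom_module C Y)"
    using is_monoid_coker[OF J] Y by (intro is_module_dom_tensor)
  then show "is_module C (cod_mon C J) (cod_module C (ker_module J Y))"
    using J Y by (simp only: dom_mon_coker cod_module_ker)
qed

section \<open>The two adjunctions\<close>

lemma Mon_structured:
  "Mon P = structured_category K {A. is_monoid P A} mon_ob (is_monoid_hom P)"
  "Mon T = structured_category K {A. is_monoid T A} mon_ob (is_monoid_hom T)"
  by (auto simp: Mon_def structured_category_def is_monoid_hom_def)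

lemma Mod_structured:
  "Mod P J = structured_category K {X. is_module P J X} mod_ob (is_module_hom P J)"
  "Mod T B = structured_category K {X. is_module T B X} mod_ob (is_module_hom T B)"
  by (auto simp: Mod_def structured_category_def is_module_hom_def)

text \<open>
  Morphisms of monoids \<open>coker X \<rightarrow> Y\<close> and \<open>X \<rightarrow> ker Y\<close> are both given by a monoid homomorphism in \<open>C\<close> from
  the target of \<open>X\<close> to the source of \<open>Y\<close>, subject to the vanishing condition that makes it a square.
\<close>

lemma right_adjoint_monoids:
  "right_adjoint (Smith_ideals C) (Monoid_homs C) (coker_mon_functor C) (ker_mon_functor C)"
proof -
  interpret P: tensor_category P
    by (rule tensor_category_arr_pushout)
  interpret T: tensor_category T
    by (rule tensor_category_arr_tensor)
  have "right_adjoint (Mon P) (Mon T) (structured_functor coker_monoid (Coker C)) (structured_functor ker_monoid (Ker C))"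
    unfolding Mon_structured
  proof (rule right_adjoint_structured[OF functor_Coker functor_Ker Coker_Ker_adjunction
        P.category_Mon[unfolded Mon_structured] T.category_Mon[unfolded Mon_structured]])
    fix X
    assume "X \<in> {A. is_monoid P A}"
    then show "mon_ob X \<in> Obj K \<and> coker_monoid X \<in> {A. is_monoid T A} \<and> mon_ob (coker_monoid X) = FO (Coker C) (mon_ob X)"
      using is_monoid_coker by (auto simp: is_monoid_def)
  next
    fix Y
    assume "Y \<in> {A. is_monoid T A}"
    then show "mon_ob Y \<in> Obj K \<and> ker_monoid Y \<in> {A. is_monoid P A} \<and> mon_ob (ker_monoid Y) = FO (Ker C) (mon_ob Y)"
      using is_monoid_ker by (auto simp: is_monoid_def)
  next
    fix X Y s
    assume "X \<in> {A. is_monoid P A}" "Y \<in> {A. is_monoid P A}"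
      and s: "s \<in> hom K (mon_ob X) (mon_ob Y)" "is_monoid_hom P X Y s"
    then have XY: "is_monoid P X" "is_monoid P Y"
      by auto
    have "mon_ob X \<in> Arr C"
      using XY by (simp add: is_monoid_def)
    then show "is_monoid_hom T (coker_monoid X) (coker_monoid Y) (FA (Coker C) s)"
      using is_monoid_hom_tensor_iff[OF is_monoid_coker[OF XY(1)] is_monoid_coker[OF XY(2)], of "FA (Coker C) s"]
        is_monoid_hom_cod_pushout[OF s(2)] Coker_hom[OF s(1)] XY
      by (simp add: dom_mon_coker coker_epi)
  next
    fix X Y s
    assume "X \<in> {A. is_monoid T A}" "Y \<in> {A. is_monoid T A}"
      and s: "s \<in> hom K (mon_ob X) (mon_ob Y)" "is_monoid_hom T X Y s"
    then have XY: "is_monoid T X" "is_monoid T Y"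
      by auto
    have "mon_ob Y \<in> Arr C"
      using XY by (simp add: is_monoid_def)
    then show "is_monoid_hom P (ker_monoid X) (ker_monoid Y) (FA (Ker C) s)"
      using is_monoid_hom_pushout_iff[OF is_monoid_ker[OF XY(1)] is_monoid_ker[OF XY(2)], of "FA (Ker C) s"]
        is_monoid_hom_dom_tensor[OF s(2)] Ker_hom[OF s(1)] XY
      by (simp add: cod_mon_ker ker_mono)
  next
    fix X Y s
    assume "X \<in> {A. is_monoid P A}" "Y \<in> {A. is_monoid T A}" and s: "s \<in> hom K (FO (Coker C) (mon_ob X)) (mon_ob Y)"
    then have XY: "is_monoid P X" "is_monoid T Y"
      by auto
    have o: "mon_ob X \<in> Arr C" "mon_ob Y \<in> Arr C"
      using XY by (auto simp: is_monoid_def)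
    show "is_monoid_hom T (coker_monoid X) Y s \<longleftrightarrow> is_monoid_hom P X (ker_monoid Y) (ker_transpose (mon_ob X) (mon_ob Y) s)"
      using is_monoid_hom_tensor_iff[OF is_monoid_coker[OF XY(1)] XY(2), of s]
        is_monoid_hom_pushout_iff[OF XY(1) is_monoid_ker[OF XY(2)], of "ker_transpose (mon_ob X) (mon_ob Y) s"]
        ker_transpose_hom[OF o(1), of s "mon_ob Y"] s XY o
      by (simp add: dom_mon_coker cod_mon_ker ker_mono coker_epi)
  qed
  then show ?thesis
    by (simp add: Smith_ideals_def Monoid_homs_def coker_mon_functor_def ker_mon_functor_def
        induced_Mon_def structured_functor_def)
qed

lemma right_adjoint_modules:
  assumes J: "is_monoid P J"
  shows "right_adjoint (Mod P J) (Mod T (FO (coker_mon_functor C) J)) (coker_mod_functor C J) (ker_mod_functor C J)"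
proof -
  interpret P: tensor_category P
    by (rule tensor_category_arr_pushout)
  interpret T: tensor_category T
    by (rule tensor_category_arr_tensor)
  let ?B = "coker_monoid J"
  have j: "mon_ob J \<in> Obj P" "mon_ob ?B \<in> Obj T" "mon_ob J \<in> Arr C"
    using J by (auto simp: is_monoid_def)
  have e: "is_epi C (mon_ob ?B)"
    using coker_epi[OF j(3)] by simp
  note B = is_monoid_coker[OF J]
  have "right_adjoint (Mod P J) (Mod T ?B) (structured_functor (coker_module J) (Coker C)) (structured_functor (ker_module J) (Ker C))"
    unfolding Mod_structured
  proof (rule right_adjoint_structured[OF functor_Coker functor_Ker Coker_Ker_adjunction
        P.category_Mod[OF j(1), unfolded Mod_structured] T.category_Mod[OF j(2), unfolded Mod_structured]])
    fix X
    assume "X \<in> {X. is_module P J X}"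
    then show "mod_ob X \<in> Obj K \<and> coker_module J X \<in> {X. is_module T ?B X} \<and> mod_ob (coker_module J X) = FO (Coker C) (mod_ob X)"
      using is_module_coker[OF J] by (auto simp: is_module_def)
  next
    fix Y
    assume "Y \<in> {X. is_module T ?B X}"
    then show "mod_ob Y \<in> Obj K \<and> ker_module J Y \<in> {X. is_module P J X} \<and> mod_ob (ker_module J Y) = FO (Ker C) (mod_ob Y)"
      using is_module_ker[OF J] by (auto simp: is_module_def)
  next
    fix X Y s
    assume "X \<in> {X. is_module P J X}" "Y \<in> {X. is_module P J X}"
      and s: "s \<in> hom K (mod_ob X) (mod_ob Y)" "is_module_hom P J X Y s"
    then have XY: "is_module P J X" "is_module P J Y"
      by auto
    have "mod_ob X \<in> Arr C"
      using XY by (simp add: is_module_def)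
    then show "is_module_hom T ?B (coker_module J X) (coker_module J Y) (FA (Coker C) s)"
      using is_module_hom_tensor_iff[OF B is_module_coker[OF J XY(1)] is_module_coker[OF J XY(2)] e, of "FA (Coker C) s"]
        is_module_hom_cod_pushout[OF J s(2)] Coker_hom[OF s(1)] XY J
      by (simp add: dom_mon_coker dom_module_coker coker_epi)
  next
    fix X Y s
    assume "X \<in> {X. is_module T ?B X}" "Y \<in> {X. is_module T ?B X}"
      and s: "s \<in> hom K (mod_ob X) (mod_ob Y)" "is_module_hom T ?B X Y s"
    then have XY: "is_module T ?B X" "is_module T ?B Y"
      by auto
    have "mod_ob Y \<in> Arr C"
      using XY by (simp add: is_module_def)
    then show "is_module_hom P J (ker_module J X) (ker_module J Y) (FA (Ker C) s)"
      using is_module_hom_pushout_iff[OF J is_module_ker[OF J XY(1)] is_module_ker[OF J XY(2)], of "FA (Ker C) s"]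
        is_module_hom_dom_tensor[OF B s(2)] Ker_hom[OF s(1)] XY J
      by (simp add: cod_module_ker dom_mon_coker ker_mono)
  next
    fix X Y s
    assume "X \<in> {X. is_module P J X}" "Y \<in> {X. is_module T ?B X}" and s: "s \<in> hom K (FO (Coker C) (mod_ob X)) (mod_ob Y)"
    then have XY: "is_module P J X" "is_module T ?B Y"
      by auto
    have o: "mod_ob X \<in> Arr C" "mod_ob Y \<in> Arr C"
      using XY by (auto simp: is_module_def)
    show "is_module_hom T ?B (coker_module J X) Y s \<longleftrightarrow> is_module_hom P J X (ker_module J Y) (ker_transpose (mod_ob X) (mod_ob Y) s)"
      using is_module_hom_tensor_iff[OF B is_module_coker[OF J XY(1)] XY(2) e, of s]
        is_module_hom_pushout_iff[OF J XY(1) is_module_ker[OF J XY(2)], of "ker_transpose (mod_ob X) (mod_ob Y) s"]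
        ker_transpose_hom[OF o(1), of s "mod_ob Y"] s XY o J
      by (simp add: dom_mon_coker dom_module_coker cod_module_ker ker_mono coker_epi)
  qed
  then show ?thesis
    by (simp add: coker_mod_functor_def ker_mod_functor_def coker_mon_functor_def
        induced_Mon_def induced_Mod_def restrict_Mod_def func_comp_def structured_functor_def comp_def)
qed

text \<open>
  The multiplication and the unit of \<open>coker J\<close> are squares, and their commutativity says that the
  underlying arrow is multiplicative and unital.
\<close>

lemma coker_is_monoid_hom:
  assumes J: "is_monoid P J"
  shows "is_monoid_hom C (cod_mon C J) (cod_mon C (coker_monoid J)) (coker C (mon_ob J))"
proof -
  note B = is_monoid_coker[OF J]
  have j: "mon_ob J \<in> Arr C"
    using J by (auto simp: is_monoid_def)
  have "coker C (mon_ob J) \<bullet> dom_part (mult (coker_monoid J))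
      = cod_part (mult (coker_monoid J)) \<bullet> (coker C (mon_ob J) \<star> coker C (mon_ob J))"
    "coker C (mon_ob J) \<bullet> dom_part (unit (coker_monoid J)) = cod_part (unit (coker_monoid J))"
    using B by (auto simp: is_monoid_def square_iff)
  moreover have "dom_part (mult (coker_monoid J)) = cod_part (mult J)" "dom_part (unit (coker_monoid J)) = cod_part (unit J)"
    using dom_mon_coker[OF J] by (simp_all add: dom_mon_def cod_mon_def)
  ultimately show ?thesis
    using is_monoid_cod_pushout[OF J] is_monoid_cod_tensor[OF B] j by (simp add: is_monoid_hom_def hom_iff)
qed

end

theorem theorem1p10:
  fixes C :: "('o, 'a) sym_monoidal"
  assumes "infinite (UNIV :: 'u set)"
    and "symmetric_monoidal_category C"
    and "monoidal_closed C"
    and "bicomplete TYPE('u) C"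
    and "pointed C"
  shows "right_adjoint (Smith_ideals C) (Monoid_homs C) (coker_mon_functor C) (ker_mon_functor C) \<and>
    (\<forall>J \<in> Obj (Smith_ideals C).
      dom_mon C (FO (coker_mon_functor C) J) = cod_mon C J \<and>
      is_monoid_hom C (cod_mon C J) (cod_mon C (FO (coker_mon_functor C) J)) (coker C (mon_ob J))) \<and>
    (\<forall>J \<in> Obj (Smith_ideals C).
      right_adjoint (Mod (arr_pushout C) J) (Mod (arr_tensor C) (FO (coker_mon_functor C) J))
        (coker_mod_functor C J) (ker_mod_functor C J))"
proof -
  interpret symmetric_monoidal_category C
    by (fact assms(2))
  have cat: "category C"
    by unfold_locales
  interpret pointed_closed_monoidal C
  proof unfold_locales
    show "pointed C" "monoidal_closed C"
      by fact+
    show "\<exists>i k. is_pushout C f g i k" if "f \<in> Arr C" "g \<in> Arr C" "Dom C f = Dom C g" for f g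
      using that by (rule bicomplete_has_pushouts[OF assms(1) cat assms(4)])
    show "\<exists>i k. is_pullback C f g i k" if "f \<in> Arr C" "g \<in> Arr C" "Cod C f = Cod C g" for f g
      using that by (rule bicomplete_has_pullbacks[OF assms(1) cat assms(4)])
  qed
  have "FO (coker_mon_functor C) = coker_monoid"
    by (simp add: coker_mon_functor_def induced_Mon_def)
  moreover have "Obj (Smith_ideals C) = {J. is_monoid P J}"
    by (simp add: Smith_ideals_def Mon_def)
  ultimately show ?thesis
    using right_adjoint_monoids right_adjoint_modules dom_mon_coker coker_is_monoid_hom by simp
qed

end
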